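(* Let $\mathbf{k}$ be an algebraically closed field, let $X \subseteq \mathbb{A}^2_{\mathbf{k}}$ be an irreducible curve defined by a polynomial $f \in \mathbf{k}[t,y]$, and let $\Gamma$ be the closure of $X$ in $\mathbb{P}^2_{\mathbf{k}}$. Let $L = \mathbb{P}^2_{\mathbf{k}} \setminus \mathbb{A}^2_{\mathbf{k}}$. Assume that there exists a smooth point $p$ of $\Gamma$ that does not lie in $X$, and that $\Gamma \setminus X$ contains more than one point. Then the ring $$A = \{\, h \in \Gamma(X,\mathcal{O}_X) \mid h \text{ is defined at } p \,\}$$ is an extending maximal $\mathbf{k}$-subalgebra of $\Gamma(X,\mathcal{O}_X)$ which is finitely generated over $\mathbf{k}$. Let $a_1,\dots,a_k \in A$ be a set of generators of the $\mathbf{k}$-algebra $A$ and let $r_1,\dots,r_k \in \mathbf{k}[t,y]$ be such that $r_i|_X = a_i$ for all $i$. If $\Gamma$ is tangent to $L$ at $p$ of order at least $2$, then $$\mathbf{k}[r_1,\dots,r_k] + f\,\mathbf{k}[t,y]$$ is an extending maximal $\mathbf{k}$-subalgebra of $\mathbf{k}[t,y]$ that does not contain a coordinate of $\mathbf{k}[t,y]$.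
   Context: All rings are commutative with unity. A proper subring $A \subsetneq R$ is a maximal subring if there is no ring strictly between $A$ and $R$; a maximal $\mathbf{k}$-subalgebra is a maximal subring that is a $\mathbf{k}$-subalgebra. A maximal subring $A \subsetneq R$ is called extending if $\operatorname{Spec}(R) \to \operatorname{Spec}(A)$ is not surjective. "$X$ is defined by $f$" means that $f$ is irreducible and generates the ideal of $X$. A coordinate of $\mathbf{k}[t,y]$ is a polynomial that is a component of an automorphism of $\mathbb{A}^2_{\mathbf{k}}$. Here $\mathbb{A}^2_{\mathbf{k}} \subseteq \mathbb{P}^2_{\mathbf{k}}$ is the standard embedding with complement a line. Tangency: let $L \subseteq \mathbb{P}^2$ be a line, $p \in L$, and $\Gamma \neq L$ an irreducible curve in $\mathbb{P}^2$ passing through $p$. Then $\Gamma$ is tangent to $L$ at $p$ of order at least $m$ if there exists a sequence of blow-ups $S_m \xrightarrow{\pi_m} S_{m-1} \to \cdots \to S_1 \xrightarrow{\pi_1} \mathbb{P}^2$ such that $\pi_1$ is centered at $p$, $\pi_i$ is centered at a point on the exceptional divisor of $\pi_{i-1}$ for $i=2,\dots,m$, and the strict transforms of $L$ and of $\Gamma$ under $\pi_1 \circ \cdots \circ \pi_m$ have an intersection point on the exceptional divisor of $\pi_m$. *)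

theory Defs
  imports "HOL-Algebra.Algebraic_Closure_Type" "HOL-Algebra.Generated_Rings" "HOL.Hull"
begin

section \<open>Maximal subalgebras\<close>

text \<open>An algebra over \<open>\<k>\<close> is given by a ring \<open>R\<close> and the image \<open>K\<close> of \<open>\<k>\<close> in \<open>R\<close>.\<close>

definition maximal_subring :: "'r set \<Rightarrow> ('r, 'm) ring_scheme \<Rightarrow> bool" where
  "maximal_subring A R \<longleftrightarrow> subring A R \<and> A \<noteq> carrier R \<and>
     (\<forall>B. subring B R \<and> A \<subseteq> B \<longrightarrow> B = A \<or> B = carrier R)"

definition maximal_subalgebra :: "'r set \<Rightarrow> 'r set \<Rightarrow> ('r, 'm) ring_scheme \<Rightarrow> bool" where
  "maximal_subalgebra K A R \<longleftrightarrow> maximal_subring A R \<and> subalgebra K A R"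

definition Spec :: "('r, 'm) ring_scheme \<Rightarrow> 'r set set" where
  "Spec R = {P. primeideal P R}"

definition extending :: "'r set \<Rightarrow> ('r, 'm) ring_scheme \<Rightarrow> bool" where
  "extending A R \<longleftrightarrow> \<not> Spec (R\<lparr>carrier := A\<rparr>) \<subseteq> (\<lambda>Q. Q \<inter> A) ` Spec R"

definition adjoin :: "('r, 'm) ring_scheme \<Rightarrow> 'r set \<Rightarrow> 'r set \<Rightarrow> 'r set" where
  "adjoin R K S = generate_ring R (K \<union> S)"

definition finitely_generated_over :: "('r, 'm) ring_scheme \<Rightarrow> 'r set \<Rightarrow> 'r set \<Rightarrow> bool" where
  "finitely_generated_over R K A \<longleftrightarrow>
     (\<exists>S. finite S \<and> S \<subseteq> carrier R \<and> A = adjoin R K S)"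


section \<open>The affine plane\<close>

text \<open>In \<^typ>\<open>'a poly poly\<close> the inner indeterminate is \<open>t\<close> and the outer one is \<open>y\<close>.\<close>

abbreviation k_ty :: "'a::field poly poly ring" where
  "k_ty \<equiv> ring_of_type_algebra"

definition ty_consts :: "'a::field poly poly set" where
  "ty_consts = range (\<lambda>c. [:[:c:]:])"

definition eval2 :: "'a::field poly poly \<Rightarrow> 'a \<times> 'a \<Rightarrow> 'a" where
  "eval2 g x = Polynomial.poly (Polynomial.poly g [:snd x:]) (fst x)"

definition affine_closed :: "('a::field \<times> 'a) set \<Rightarrow> bool" where
  "affine_closed Z \<longleftrightarrow> (\<exists>S. Z = {x. \<forall>g\<in>S. eval2 g x = 0})"

definition irreducible_closed :: "('a::field \<times> 'a) set \<Rightarrow> bool" where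
  "irreducible_closed Z \<longleftrightarrow> affine_closed Z \<and> Z \<noteq> {} \<and>
     (\<forall>Z1 Z2. affine_closed Z1 \<and> affine_closed Z2 \<and> Z = Z1 \<union> Z2 \<longrightarrow> Z = Z1 \<or> Z = Z2)"

text \<open>The last two conjuncts say that the Krull dimension is one.\<close>

definition irreducible_curve :: "('a::field \<times> 'a) set \<Rightarrow> bool" where
  "irreducible_curve C \<longleftrightarrow> irreducible_closed C \<and>
     (\<exists>Z. irreducible_closed Z \<and> Z \<subset> C) \<and>
     \<not> (\<exists>W Z. irreducible_closed W \<and> irreducible_closed Z \<and> W \<subset> Z \<and> Z \<subset> C)"

definition vanishing_ideal :: "('a::field \<times> 'a) set \<Rightarrow> 'a poly poly set" where
  "vanishing_ideal C = {g. \<forall>x\<in>C. eval2 g x = 0}"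

definition defined_by :: "('a::field \<times> 'a) set \<Rightarrow> 'a poly poly \<Rightarrow> bool" where
  "defined_by C f \<longleftrightarrow> Factorial_Ring.irreducible f \<and> vanishing_ideal C = PIdl\<^bsub>k_ty\<^esub> f"

definition polynomial_map :: "'a::field poly poly \<Rightarrow> 'a poly poly \<Rightarrow> 'a \<times> 'a \<Rightarrow> 'a \<times> 'a" where
  "polynomial_map P Q x = (eval2 P x, eval2 Q x)"

text \<open>Polynomial maps are compared as functions, which is adequate over an infinite field.\<close>

definition plane_automorphism :: "'a::field poly poly \<Rightarrow> 'a poly poly \<Rightarrow> bool" where
  "plane_automorphism P Q \<longleftrightarrow> (\<exists>P' Q'.
     polynomial_map P' Q' \<circ> polynomial_map P Q = id \<and>
     polynomial_map P Q \<circ> polynomial_map P' Q' = id)"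

definition coordinate :: "'a::field poly poly \<Rightarrow> bool" where
  "coordinate g \<longleftrightarrow> (\<exists>h. plane_automorphism g h \<or> plane_automorphism h g)"


section \<open>The projective plane\<close>

text \<open>A point of the projective plane is the set of its homogeneous coordinate triples.\<close>

definition hpoint :: "'a::field \<times> 'a \<times> 'a \<Rightarrow> ('a \<times> 'a \<times> 'a) set" where
  "hpoint v = (case v of (a, b, c) \<Rightarrow> {(s * a, s * b, s * c) |s. s \<noteq> 0})"

definition P2 :: "('a::field \<times> 'a \<times> 'a) set set" where
  "P2 = hpoint ` (- {(0, 0, 0)})"

definition embed_plane :: "'a::field \<times> 'a \<Rightarrow> ('a \<times> 'a \<times> 'a) set" where
  "embed_plane x = hpoint (fst x, snd x, 1)"

text \<open>In \<^typ>\<open>'a poly poly poly\<close> the innermost indeterminate stands for the first homogeneous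
  coordinate and the outermost for the third.\<close>

definition eval3 :: "'a::field poly poly poly \<Rightarrow> 'a \<times> 'a \<times> 'a \<Rightarrow> 'a" where
  "eval3 F v = (case v of (a, b, c) \<Rightarrow>
     Polynomial.poly (Polynomial.poly (Polynomial.poly F [:[:c:]:]) [:b:]) a)"

definition homogeneous :: "nat \<Rightarrow> 'a::field poly poly poly \<Rightarrow> bool" where
  "homogeneous d F \<longleftrightarrow> (\<forall>i j k.
     Polynomial.coeff (Polynomial.coeff (Polynomial.coeff F k) j) i \<noteq> 0 \<longrightarrow> i + j + k = d)"

definition vanishes_at :: "'a::field poly poly poly \<Rightarrow> ('a \<times> 'a \<times> 'a) set \<Rightarrow> bool" where
  "vanishes_at F p \<longleftrightarrow> (\<forall>v\<in>p. eval3 F v = 0)"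

definition proj_closed :: "('a::field \<times> 'a \<times> 'a) set set \<Rightarrow> bool" where
  "proj_closed Z \<longleftrightarrow> (\<exists>S. (\<forall>F\<in>S. \<exists>d. homogeneous d F) \<and>
     Z = {p \<in> P2. \<forall>F\<in>S. vanishes_at F p})"

text \<open>Smoothness of a point of a plane projective curve by the Jacobian criterion: the
  gradients at \<open>p\<close> of the forms in the ideal of \<open>\<Gamma>\<close> span a space of dimension at least one.\<close>

definition smooth_point ::
  "('a::field \<times> 'a \<times> 'a) set set \<Rightarrow> ('a \<times> 'a \<times> 'a) set \<Rightarrow> bool" where
  "smooth_point \<Gamma> p \<longleftrightarrow> p \<in> \<Gamma> \<and>
     (\<exists>d F. homogeneous d F \<and> (\<forall>q\<in>\<Gamma>. vanishes_at F q) \<and>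
        \<not> (vanishes_at (map_poly (map_poly Polynomial.pderiv) F) p \<and>
           vanishes_at (map_poly Polynomial.pderiv F) p \<and>
           vanishes_at (Polynomial.pderiv F) p))"


section \<open>Regular functions\<close>

text \<open>For an irreducible affine curve \<open>C\<close> and a point \<open>p\<close> of its projective closure: the function
  \<open>h\<close> on \<open>C\<close> agrees, near \<open>p\<close>, with a quotient of two forms of the same degree whose denominator
  does not vanish at \<open>p\<close>.\<close>

definition defined_at ::
  "('a::field \<times> 'a) set \<Rightarrow> ('a \<times> 'a \<times> 'a) set \<Rightarrow> ('a \<times> 'a \<Rightarrow> 'a) \<Rightarrow> bool" where
  "defined_at C p h \<longleftrightarrow> (\<exists>d G H. homogeneous d G \<and> homogeneous d H \<and> \<not> vanishes_at H p \<and>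
     (\<forall>(a, b)\<in>C. eval3 H (a, b, 1) \<noteq> 0 \<longrightarrow> h (a, b) = eval3 G (a, b, 1) / eval3 H (a, b, 1)))"

text \<open>The ring of regular functions on \<open>C\<close>; functions are extended by \<^term>\<open>undefined\<close> outside \<open>C\<close>.\<close>

definition regular_ring :: "('a::field \<times> 'a) set \<Rightarrow> ('a \<times> 'a \<Rightarrow> 'a) ring" where
  "regular_ring C = \<lparr>
     carrier = {h \<in> extensional C. \<forall>x\<in>C. defined_at C (embed_plane x) h},
     monoid.mult = (\<lambda>g h. restrict (\<lambda>x. g x * h x) C),
     one = restrict (\<lambda>x. 1) C,
     ring.zero = restrict (\<lambda>x. 0) C,
     add = (\<lambda>g h. restrict (\<lambda>x. g x + h x) C)\<rparr>"

definition regular_consts :: "('a::field \<times> 'a) set \<Rightarrow> ('a \<times> 'a \<Rightarrow> 'a) set" where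
  "regular_consts C = range (\<lambda>c. restrict (\<lambda>x. c) C)"


section \<open>Blow-ups and tangency\<close>

definition standard_charts :: "('a::field \<times> 'a \<Rightarrow> ('a \<times> 'a \<times> 'a) set) set" where
  "standard_charts =
     {\<lambda>(u, v). hpoint (1, u, v), \<lambda>(u, v). hpoint (u, 1, v), \<lambda>(u, v). hpoint (u, v, 1)}"

text \<open>The two affine charts covering the blow-up of the affine plane at \<open>(a, b)\<close>, composed with
  the blow-up morphism.\<close>

definition blowup_charts :: "'a::field \<times> 'a \<Rightarrow> ('a \<times> 'a \<Rightarrow> 'a \<times> 'a) set" where
  "blowup_charts c = (case c of (a, b) \<Rightarrow>
     {\<lambda>(u, v). (a + u, b + u * v), \<lambda>(u, v). (a + u * v, b + v)})"

text \<open>\<open>blowup_tower p m \<psi> E\<close>: there is a sequence of \<open>m\<close> blow-ups of the projective plane, the first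
  centered at \<open>p\<close> and each further one at a point of the preceding exceptional divisor, such that
  \<open>\<psi>\<close> is the restriction of the composite morphism to an affine plane which is open in the last
  surface and \<open>E\<close> is the part in this plane of the last exceptional divisor. Such planes cover the
  last exceptional divisor, and blowing up is local around the center.\<close>

inductive blowup_tower ::
  "('a::field \<times> 'a \<times> 'a) set \<Rightarrow> nat \<Rightarrow> ('a \<times> 'a \<Rightarrow> ('a \<times> 'a \<times> 'a) set) \<Rightarrow> ('a \<times> 'a) set \<Rightarrow> bool"
  for p where
  first: "\<lbrakk>\<phi> \<in> standard_charts; \<phi> c = p; \<beta> \<in> blowup_charts c\<rbrakk>
            \<Longrightarrow> blowup_tower p 1 (\<phi> \<circ> \<beta>) (\<beta> -` {c})"
| further: "\<lbrakk>blowup_tower p m \<psi> E; c \<in> E; \<beta> \<in> blowup_charts c\<rbrakk>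
            \<Longrightarrow> blowup_tower p (Suc m) (\<psi> \<circ> \<beta>) (\<beta> -` {c})"

text \<open>The part of the strict transform of \<open>C\<close> in the affine plane on which \<open>\<psi>\<close> is defined.\<close>

definition strict_transform ::
  "('a::field \<times> 'a \<times> 'a) set \<Rightarrow> ('a \<times> 'a \<Rightarrow> ('a \<times> 'a \<times> 'a) set) \<Rightarrow>
   ('a \<times> 'a \<times> 'a) set set \<Rightarrow> ('a \<times> 'a) set" where
  "strict_transform p \<psi> C = affine_closed hull (\<psi> -` (C - {p}))"

definition tangent_order_ge ::
  "nat \<Rightarrow> ('a::field \<times> 'a \<times> 'a) set set \<Rightarrow> ('a \<times> 'a \<times> 'a) set set \<Rightarrow>
   ('a \<times> 'a \<times> 'a) set \<Rightarrow> bool" where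
  "tangent_order_ge m \<Gamma> L p \<longleftrightarrow> p \<in> L \<and> p \<in> \<Gamma> \<and>
     (\<exists>\<psi> E. blowup_tower p m \<psi> E \<and>
        strict_transform p \<psi> L \<inter> strict_transform p \<psi> \<Gamma> \<inter> E \<noteq> {})"

end

(*
  A smooth point p at infinity gives a place: power series zeta, eta without constant term,
  one of them the uniformizer, such that t and y become Laurent series with denominator zeta.
  Evaluation is a homomorphism phi from k[t,y] to the Laurent series with kernel (f), the ring
  of regular functions is isomorphic to the image S of phi, and A corresponds to the elements of
  S of order at least 0. Since the curve has a second point at infinity, the order of zeta is
  smaller than the degree of f, and counting dimensions yields an element of S of positive order.
  As S also contains elements of negative order and generates a field with a uniformizer, the
  orders of elements of S form the group of all integers. Maximality follows: a ring strictly
  between A and S contains some w of order -1, and S = A + k[w]. An element u of order 1 shows that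
  the ideal of elements of positive order of A generates the unit ideal of S, since u * w is a unit
  up to elements of positive order.

  The preimage of A in k[t,y] inherits these properties. If it contains a coordinate x, let (x, y')
  be an automorphism. Tangency means that, in suitable linear coordinates X and Y of the plane, the
  pole orders of X and Y are i and i - 1 with i at least 3. As x has no pole, these are also the
  degrees in y' of X and Y written as polynomials in x and y', up to a common factor, which must
  be 1. Restricted to a line x = const, X and Y have degrees i and i - 1 and generate the ring
  k[y'], which is impossible because 1 is not in the semigroup generated by i and i - 1.
*)

theory Submission
  imports Defs
begin

section \<open>Valuation rings in the field of Laurent series\<close>

text \<open>One locale of rings with a map \<open>val\<close> onto the same algebra \<open>S\<close>
  of Laurent series serves both rings of the theorem: on regular functions \<open>val\<close> is
  injective, on polynomials its kernel is generated by \<open>f\<close>. Maximality and the failure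
  of lying over are thus proved once. Finite generation is a separate matter and comes from gluing:
  smoothness makes the local ring at the place a localization of \<open>k[\<eta>, \<zeta>]\<close>,
  elsewhere \<open>A\<close> looks like \<open>S\<close>, and some \<open>s\<close> with residue 1
  separates the two pieces through the comaximal pair \<open>s\<close>, \<open>1 - s\<close>. The
  global obstacle is an element of positive order: with \<open>p\<close> as the only point at
  infinity, a function without poles would be constant. The second point lowers the degree of the
  equation restricted to the line at infinity, so the intersection number with this line at
  \<open>p\<close>, which is the order of \<open>\<zeta>\<close>, stays below the degree of the
  curve. Tangency of order 2 makes the same number at least 3, which is what the final degree
  argument needs: pole orders 2 and 1 would leave 1 in the semigroup of degrees.\<close>

definition vge :: "int \<Rightarrow> 'a::field fls \<Rightarrow> bool" where
  "vge n x \<longleftrightarrow> x = 0 \<or> n \<le> fls_subdegree x"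

text \<open>With \<open>fls_subdegree 0 = 0\<close>, it is the disjunct \<open>x = 0\<close> in
  \<open>vge\<close> that gives zero infinite order. The form in terms of coefficients needs no such
  case.\<close>

lemma vge_iff: "vge n x \<longleftrightarrow> (\<forall>k<n. fls_nth x k = 0)"
  unfolding vge_def by (metis fls_eq0_below_subdegree fls_subdegree_geI fls_zero_nth
    linorder_not_less order_less_le_trans nth_fls_subdegree_nonzero)

lemma vge_add: "vge n x \<Longrightarrow> vge n y \<Longrightarrow> vge n (x + y)"
  by (simp add: vge_iff)

lemma vge_diff: "vge n x \<Longrightarrow> vge n y \<Longrightarrow> vge n (x - y)"
  by (simp add: vge_iff)

lemma vge_mult: "vge m x \<Longrightarrow> vge n y \<Longrightarrow> vge (m + n) (x * y)"
  unfolding vge_def by (cases "x = 0 \<or> y = 0") auto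

lemma vge_mult0: "vge 0 x \<Longrightarrow> vge n y \<Longrightarrow> vge n (x * y)"
  using vge_mult[of 0 x n y] by simp

lemma vge_mono: "vge n x \<Longrightarrow> m \<le> n \<Longrightarrow> vge m x"
  unfolding vge_def by auto

lemma vge_const [simp]: "vge 0 (fls_const c)"
  unfolding vge_def by simp

lemma vge_0 [simp]: "vge n 0" and vge_1 [simp]: "vge 0 1"
  unfolding vge_def by auto

lemma vge_power: "vge n x \<Longrightarrow> vge (int k * n) (x ^ k)"
  unfolding vge_def by (cases k) (auto simp: fls_subdegree_pow simp del: power_Suc of_nat_Suc
    intro!: mult_left_mono)

lemma vge_power0: "vge 0 x \<Longrightarrow> vge 0 (x ^ k)"
  using vge_power[of 0 x k] by simp

lemma vge_residue: "vge 0 x \<Longrightarrow> vge 1 (x - fls_const (fls_nth x 0))"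
  by (auto simp: vge_iff)

lemma vge_1_imp_nth0: "vge 1 x \<Longrightarrow> fls_nth x 0 = 0"
  by (simp add: vge_iff)

text \<open>The coefficient at 0 is the residue map of the valuation ring; modulo order 1 each
  factor may be replaced by its residue.\<close>

lemma fls_nth_mult_0: "vge 0 x \<Longrightarrow> vge 0 y \<Longrightarrow> fls_nth (x * y) 0 = fls_nth x 0 * fls_nth y 0"
proof -
  assume x: "vge 0 x" and y: "vge 0 y"
  let ?a = "fls_const (fls_nth x 0)" and ?b = "fls_const (fls_nth y 0)"
  have "x * y - ?a * ?b = (x - ?a) * y + ?a * (y - ?b)"
    by (simp add: algebra_simps)
  moreover have "vge 1 ((x - ?a) * y + ?a * (y - ?b))"
    using vge_mult[OF vge_residue[OF x] y] vge_mult0[OF vge_const vge_residue[OF y]]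
    by (auto intro: vge_add)
  ultimately have "vge 1 (x * y - ?a * ?b)" by simp
  then show ?thesis by (simp add: vge_iff)
qed

lemma fls_nth0_nonzero:
  assumes "vge 0 x" "fls_nth x 0 \<noteq> 0"
  shows "x \<noteq> 0" "fls_subdegree x = 0"
  using assms by (auto simp: vge_def fls_subdegree_leI antisym)

section \<open>Subalgebras of Laurent series and division by a uniformizer\<close>

inductive_set alg :: "'a::field fls set \<Rightarrow> 'a fls set" for E where
  const: "fls_const c \<in> alg E"
| incl: "x \<in> E \<Longrightarrow> x \<in> alg E"
| add: "x \<in> alg E \<Longrightarrow> y \<in> alg E \<Longrightarrow> x + y \<in> alg E"
| mult: "x \<in> alg E \<Longrightarrow> y \<in> alg E \<Longrightarrow> x * y \<in> alg E"

locale fls_subalgebra =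
  fixes S :: "'a::field fls set"
  assumes const: "fls_const c \<in> S"
    and add: "x \<in> S \<Longrightarrow> y \<in> S \<Longrightarrow> x + y \<in> S"
    and mult: "x \<in> S \<Longrightarrow> y \<in> S \<Longrightarrow> x * y \<in> S"
begin

lemma one: "1 \<in> S"
  using const[of 1] by simp

lemma diff: "x \<in> S \<Longrightarrow> y \<in> S \<Longrightarrow> x - y \<in> S"
  using add[of x "fls_const (- 1) * y"] mult[OF const[of "- 1"], of y] by simp

lemma power: "x \<in> S \<Longrightarrow> x ^ n \<in> S"
  by (induction n) (auto simp: one mult)

lemma alg_subset: "E \<subseteq> S \<Longrightarrow> alg E \<subseteq> S"
proof
  fix x assume "E \<subseteq> S" "x \<in> alg E"
  from this(2,1) show "x \<in> S"
    by (induction rule: alg.induct) (auto intro: const add mult)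
qed

end

lemma fls_subalgebra_alg: "fls_subalgebra (alg E)"
  by unfold_locales (auto intro: alg.intros)

lemma alg_mono: "E \<subseteq> E' \<Longrightarrow> alg E \<subseteq> alg E'"
  by (rule fls_subalgebra.alg_subset[OF fls_subalgebra_alg]) (auto intro: alg.incl)

lemma vge_alg: "(\<And>x. x \<in> E \<Longrightarrow> vge 0 x) \<Longrightarrow> g \<in> alg E \<Longrightarrow> vge 0 g"
  by (rotate_tac, induction rule: alg.induct) (auto intro: vge_add vge_mult0)

text \<open>After multiplication by \<open>W\<close>, all generators vanish modulo \<open>u\<close>,
  so every element reduces to a constant. The product case is the Leibniz identity
  \<open>x * y - c * c' = (x - c) * y + c * (y - c')\<close>.\<close>

lemma alg_residue_divisible:
  assumes "W \<in> alg E" "u \<in> alg E" and gen: "\<And>x. x \<in> E \<Longrightarrow> \<exists>b\<in>alg E. W * x = u * b"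
    and "g \<in> alg E"
  shows "\<exists>c. \<exists>b\<in>alg E. W * (g - fls_const c) = u * b"
  using assms(4)
proof (induction rule: alg.induct)
  case (const c)
  have "W * (fls_const c - fls_const c) = u * fls_const 0" by simp
  then show ?case using alg.const by blast
next
  case (incl x)
  then show ?case using gen[OF incl] by (metis diff_zero fls_const_0)
next
  case (add x y)
  then obtain c b c' b' where b: "b \<in> alg E" "W * (x - fls_const c) = u * b"
    "b' \<in> alg E" "W * (y - fls_const c') = u * b'" by blast
  then have "W * (x + y - fls_const (c + c')) = u * (b + b')"
    by (simp add: algebra_simps flip: fls_plus_const)
  then show ?case using b alg.add by blast
next
  case (mult x y)
  then obtain c b c' b' where b: "b \<in> alg E" "W * (x - fls_const c) = u * b"
    "b' \<in> alg E" "W * (y - fls_const c') = u * b'" by blast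
  have "W * (x * y - fls_const (c * c'))
      = (W * (x - fls_const c)) * y + fls_const c * (W * (y - fls_const c'))"
    by (simp add: algebra_simps flip: fls_const_mult_const)
  also have "\<dots> = u * (b * y + fls_const c * b')"
    unfolding b by (simp add: algebra_simps)
  finally show ?case using b mult.hyps by (blast intro: alg.intros)
qed

text \<open>Where \<open>W\<close> is invertible, \<open>u\<close> generates the maximal ideal of
  the place, so an order of at least \<open>n\<close> can be traded for \<open>n\<close> factors
  \<open>u\<close>. Each of them costs one factor \<open>W\<close>.\<close>

lemma alg_power_divisible:
  assumes E: "\<And>x. x \<in> E \<Longrightarrow> vge 0 x"
    and W: "W \<in> alg E" "fls_nth W 0 \<noteq> 0" and u: "u \<in> alg E" "u \<noteq> 0" "fls_subdegree u = 1"
    and gen: "\<And>x. x \<in> E \<Longrightarrow> \<exists>b\<in>alg E. W * x = u * b"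
    and "g \<in> alg E" "vge (int n) g"
  shows "\<exists>b\<in>alg E. W ^ n * g = u ^ n * b"
  using assms(9)
proof (induction n)
  case 0
  then show ?case using assms(8) by auto
next
  case (Suc n)
  then obtain b where b: "b \<in> alg E" "W ^ n * g = u ^ n * b"
    using vge_mono[of "int (Suc n)" g "int n"] by auto
  have W0: "W \<noteq> 0" "fls_subdegree W = 0"
    using fls_nth0_nonzero[OF vge_alg[OF E W(1)] W(2)] by auto
  obtain c b' where b': "b' \<in> alg E" "W * (b - fls_const c) = u * b'"
    using alg_residue_divisible[OF W(1) u(1) gen b(1)] by blast
  \<comment> \<open>The order of \<open>g\<close> exceeds \<open>n\<close>, so the quotient still
    has positive order; this forces the constant \<open>c\<close> to vanish.\<close>
  have "vge 1 b"
  proof (cases "b = 0")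
    case False
    then have "g \<noteq> 0" using b(2) u(2) by auto
    then have "fls_subdegree g = int n + fls_subdegree b"
      using arg_cong[OF b(2), of fls_subdegree] W0 u False by (simp add: fls_subdegree_pow)
    then show ?thesis using Suc.prems \<open>g \<noteq> 0\<close> by (auto simp: vge_def)
  qed auto
  have "vge 1 (u * b')"
    using vge_mult[of 1 u 0 b'] u vge_alg[OF E b'(1)] by (simp add: vge_def)
  then have "fls_nth (W * (b - fls_const c)) 0 = 0"
    by (simp add: b' vge_1_imp_nth0)
  then have "fls_nth W 0 * fls_nth (b - fls_const c) 0 = 0"
    using fls_nth_mult_0[OF vge_alg[OF E W(1)], of "b - fls_const c"]
      vge_diff[OF vge_alg[OF E b(1)] vge_const] by simp
  then have "c = 0" using W(2) \<open>vge 1 b\<close> by (simp add: vge_1_imp_nth0)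
  then have "W ^ Suc n * g = u ^ Suc n * b'"
    using b b' by (simp add: algebra_simps)
  then show ?case using b' by blast
qed

section \<open>Orders of elements, maximality and lying over\<close>

lemma int_semigroup_UNIV:
  fixes V :: "int set"
  assumes zero: "0 \<in> V" and add: "\<And>x y. x \<in> V \<Longrightarrow> y \<in> V \<Longrightarrow> x + y \<in> V"
    and pos: "P \<in> V" "P > 0" and neg: "N \<in> V" "N < 0" and z: "z \<in> V" "z + 1 \<in> V"
  shows "n \<in> V"
proof -
  have m: "int k * x \<in> V" if "x \<in> V" for k x
    using that by (induction k) (auto simp: zero algebra_simps intro: add)
  have m': "k * x \<in> V" if "x \<in> V" "k \<ge> 0" for k x
    using m[OF that(1), of "nat k"] that by simp
  \<comment> \<open>\<open>- z\<close> is a combination with nonnegative coefficients of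
    \<open>z\<close> and an element of the opposite sign, \<open>N\<close> or \<open>P\<close>.
    Together with \<open>z + 1\<close> this yields 1.\<close>
  have "- z \<in> V"
  proof (cases "z \<ge> 0")
    case True
    have "- z = (- N - 1) * z + z * N" by (simp add: algebra_simps)
    then show ?thesis using add[OF m'[of z "- N - 1"] m'[of N z]] True neg z by simp
  next
    case False
    have "- z = (P - 1) * z + (- z) * P" by (simp add: algebra_simps)
    moreover have "(P - 1) * z + (- z) * P \<in> V"
      using False pos z by (intro add m') auto
    ultimately show ?thesis by metis
  qed
  then have "1 \<in> V" using add[OF z(2), of "- z"] by simp
  have "- 1 \<in> V"
    using add[OF neg(1) m'[OF \<open>1 \<in> V\<close>, of "- N - 1"]] neg by simp
  show ?thesis
  proof (cases "n \<ge> 0")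
    case True
    then show ?thesis using m'[OF \<open>1 \<in> V\<close>, of n] by simp
  next
    case False
    then show ?thesis using m'[OF \<open>- 1 \<in> V\<close>, of "- n"] by simp
  qed
qed

text \<open>In \<open>pos\<close> and \<open>neg\<close> the witnesses are nonzero because
  \<open>fls_subdegree 0 = 0\<close>. The consecutive orders in \<open>unif\<close> keep the orders
  from lying in a proper subgroup of the integers.\<close>

locale place_algebra = fls_subalgebra +
  assumes pos: "\<exists>u\<in>S. fls_subdegree u > 0"
    and neg: "\<exists>w\<in>S. fls_subdegree w < 0"
    and unif: "\<exists>x\<in>S. \<exists>y\<in>S. x \<noteq> 0 \<and> y \<noteq> 0 \<and> fls_subdegree x = fls_subdegree y + 1"
begin

lemma ex_value: "\<exists>c\<in>S. c \<noteq> 0 \<and> fls_subdegree c = n"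
proof -
  let ?V = "fls_subdegree ` (S - {0})"
  obtain u w x y where *: "u \<in> S" "fls_subdegree u > 0" "w \<in> S" "fls_subdegree w < 0"
    "x \<in> S" "y \<in> S" "x \<noteq> 0" "y \<noteq> 0" "fls_subdegree x = fls_subdegree y + 1"
    using pos neg unif by blast
  then have "u \<noteq> 0" "w \<noteq> 0" by auto
  have "n \<in> ?V"
  proof (rule int_semigroup_UNIV)
    show "0 \<in> ?V" using one by (force intro: image_eqI[of _ _ 1])
    fix a b assume "a \<in> ?V" "b \<in> ?V"
    then obtain a' b' where "a' \<in> S" "b' \<in> S" "a' \<noteq> 0" "b' \<noteq> 0"
      "a = fls_subdegree a'" "b = fls_subdegree b'" by auto
    then show "a + b \<in> ?V" using mult[of a' b'] by (intro image_eqI[of _ _ "a' * b'"]) auto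
  next
    show "fls_subdegree u \<in> ?V" "fls_subdegree w \<in> ?V" using * \<open>u \<noteq> 0\<close> \<open>w \<noteq> 0\<close> by auto
    show "fls_subdegree y \<in> ?V" using * by auto
    show "fls_subdegree y + 1 \<in> ?V" using * by (metis DiffI empty_iff image_eqI insertE)
  qed (use * in auto)
  then show ?thesis by auto
qed

lemma maximal:
  assumes B: "B \<subseteq> S" "\<And>x. x \<in> S \<Longrightarrow> vge 0 x \<Longrightarrow> x \<in> B"
    and add_B: "\<And>x y. x \<in> B \<Longrightarrow> y \<in> B \<Longrightarrow> x + y \<in> B"
    and mult_B: "\<And>x y. x \<in> B \<Longrightarrow> y \<in> B \<Longrightarrow> x * y \<in> B"
    and h: "h \<in> B" "\<not> vge 0 h"
  shows "B = S"
proof -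
  have hn: "h \<noteq> 0" "fls_subdegree h < 0" using h by (auto simp: vge_def)
  \<comment> \<open>The order of \<open>c\<close> makes \<open>c * h\<close> a simple pole; it is
    nonnegative, so \<open>c\<close> belongs to \<open>B\<close>.\<close>
  obtain c where c: "c \<in> S" "c \<noteq> 0" "fls_subdegree c = - fls_subdegree h - 1"
    using ex_value by blast
  define w where "w = c * h"
  have "c \<in> B" using B c hn by (auto simp: vge_def)
  then have w: "w \<in> B" "w \<noteq> 0" "fls_subdegree w = - 1"
    using mult_B h c hn by (auto simp: w_def)
  have const_B: "fls_const c \<in> B" for c
    using B(2)[OF const] by simp
  have powB: "w ^ k \<in> B" for k
    by (induction k) (use w mult_B const_B[of 1] in auto)
  have "r \<in> S \<Longrightarrow> vge (- int N) r \<Longrightarrow> r \<in> B" for N r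
  proof (induction N arbitrary: r)
    case 0
    then show ?case using B by simp
  next
    case (Suc N)
    \<comment> \<open>\<open>q\<close> agrees with \<open>r\<close> in the coefficient at
      \<open>- (N + 1)\<close>, so subtracting it lowers the pole order.\<close>
    define q where "q = fls_const (fls_nth r (- int (Suc N)) / fls_nth (w ^ Suc N) (- int (Suc N)))
      * w ^ Suc N"
    have sd: "fls_subdegree (w ^ Suc N) = - int (Suc N)" "w ^ Suc N \<noteq> 0"
      using w(2,3) fls_subdegree_pow[of w "Suc N"] by simp_all
    then have nz: "fls_nth (w ^ Suc N) (- int (Suc N)) \<noteq> 0"
      by (metis nth_fls_subdegree_nonzero)
    have "q \<in> B" unfolding q_def by (intro mult_B const_B powB)
    have "fls_nth (r - q) k = 0" if "k < - int N" for k
    proof (cases "k = - int (Suc N)")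
      case True
      then show ?thesis using nz by (simp add: q_def del: power_Suc)
    next
      case False
      then have "k < - int (Suc N)" using that by simp
      then have "fls_nth r k = 0" "fls_nth (w ^ Suc N) k = 0"
        using Suc.prems sd by (auto simp: vge_iff)
      then show ?thesis by (simp add: q_def del: power_Suc)
    qed
    then have "vge (- int N) (r - q)" by (simp add: vge_iff)
    moreover have "r - q \<in> S" using diff Suc.prems(1) \<open>q \<in> B\<close> B(1) by auto
    ultimately have "r - q \<in> B" using Suc.IH by blast
    then show ?case using add_B[OF _ \<open>q \<in> B\<close>, of "r - q"] by simp
  qed
  moreover have "vge (- int (nat (- fls_subdegree r))) r" for r
    by (auto simp: vge_def)
  ultimately show ?thesis using B(1) by blast
qed

text \<open>A product of elements of orders 1 and -1 has a nonzero residue, which is normalized to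
  1. A prime of \<open>S\<close> containing the elements of positive order would contain
  \<open>u\<close> and \<open>e\<close>, hence 1.\<close>

lemma no_lying_over: "\<exists>u\<in>S. \<exists>w\<in>S. \<exists>e\<in>S. vge 1 u \<and> vge 1 e \<and> u * w = 1 + e"
proof -
  obtain u w where u: "u \<in> S" "u \<noteq> 0" "fls_subdegree u = 1"
    and w: "w \<in> S" "w \<noteq> 0" "fls_subdegree w = - 1"
    using ex_value by meson
  define c where "c = fls_nth (u * w) 0"
  have "fls_subdegree (u * w) = 0" "u * w \<noteq> 0" using u w by auto
  then have "c \<noteq> 0" and v0: "vge 0 (u * w)"
    unfolding c_def by (metis nth_fls_subdegree_nonzero, simp add: vge_def)
  let ?w = "fls_const (1 / c) * w" and ?e = "u * (fls_const (1 / c) * w) - 1"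
  have eq: "?e = fls_const (1 / c) * (u * w - fls_const c)"
    using \<open>c \<noteq> 0\<close> by (simp add: algebra_simps)
  have "vge 1 (u * w - fls_const c)"
    using vge_residue[OF v0] by (simp add: c_def)
  then have "vge 1 ?e"
    unfolding eq by (intro vge_mult0) auto
  moreover have "vge 1 u" using u by (simp add: vge_def)
  moreover have "?w \<in> S" "?e \<in> S" using u w by (auto intro!: diff mult const one)
  ultimately show ?thesis using u(1) by (intro bexI[of _ u] bexI[of _ ?w] bexI[of _ ?e]) auto
qed

end

section \<open>Gluing two localizations, and finite generation\<close>

lemma comaximal_membership:
  assumes "fls_subalgebra T" and T: "s \<in> T" "s ^ M * a \<in> T" "(1 - s) ^ K * a \<in> T"
  shows "a \<in> T"
proof -
  interpret fls_subalgebra T by fact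
  \<comment> \<open>The geometric sum is chosen so that \<open>z\<close> is a multiple of
    \<open>1 - s\<close> while \<open>1 - z = s ^ M\<close>. Then \<open>z ^ K\<close> and
    \<open>1 - z ^ K\<close> add up to 1, and each of them multiplies \<open>a\<close> into
    \<open>T\<close>.\<close>
  define q where "q = (\<Sum>i<M. s ^ i)"
  define z where "z = (1 - s) * q"
  have sum: "(\<Sum>i<m. x ^ i) \<in> T" if "x \<in> T" for m :: nat and x
    by (induction m) (use const[of 0] that in \<open>auto intro: add power\<close>)
  have q: "q \<in> T" "z \<in> T" "1 - z = s ^ M"
    unfolding z_def q_def using T(1)
    by (auto intro!: sum mult diff one power simp flip: one_diff_power_eq)
  have "z ^ K * a = q ^ K * ((1 - s) ^ K * a)"
    by (simp add: z_def power_mult_distrib)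
  also have "\<dots> \<in> T" by (rule mult) (use T(3) q in \<open>auto intro: power\<close>)
  finally have 1: "z ^ K * a \<in> T" .
  have "(1 - z ^ K) * a = (\<Sum>i<K. z ^ i) * (s ^ M * a)"
    by (simp add: one_diff_power_eq q(3))
  also have "\<dots> \<in> T" by (rule mult[OF sum[OF q(2)] T(2)])
  finally have "(1 - z ^ K) * a \<in> T" .
  from add[OF this 1] show ?thesis by (simp add: algebra_simps)
qed

lemma clear_denominators:
  assumes "fls_subalgebra T" and u: "u \<in> T" and G: "\<And>x. x \<in> G \<Longrightarrow> u ^ K * x \<in> T"
    and "g \<in> alg G"
  shows "\<exists>M. u ^ M * g \<in> T"
  using assms(4)
proof (induction rule: alg.induct)
  interpret fls_subalgebra T by fact
  {
    case (const c)
    then show ?case using fls_subalgebra.const[OF assms(1)] by (metis mult_1 power_0)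
  next
    case (incl x)
    then show ?case using G by blast
  next
    case (add x y)
    then obtain M M' where *: "u ^ M * x \<in> T" "u ^ M' * y \<in> T" by blast
    have "u ^ (M + M') * (x + y) = u ^ M' * (u ^ M * x) + u ^ M * (u ^ M' * y)"
      by (simp add: power_add algebra_simps)
    also have "\<dots> \<in> T"
      by (rule fls_subalgebra.add[OF assms(1)]; rule fls_subalgebra.mult[OF assms(1)])
        (use * u in \<open>auto intro: power\<close>)
    finally show ?case by blast
  next
    case (mult x y)
    then obtain M M' where *: "u ^ M * x \<in> T" "u ^ M' * y \<in> T" by blast
    have "u ^ (M + M') * (x * y) = (u ^ M * x) * (u ^ M' * y)"
      by (simp add: power_add algebra_simps)
    also have "\<dots> \<in> T"
      using * by (rule fls_subalgebra.mult[OF assms(1)])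
    finally show ?case by blast
  }
qed

context place_algebra
begin

text \<open>Geometrically, the place is a point \<open>p\<close> which is added to an affine curve with ring \<open>S\<close>.
  Near \<open>p\<close>, i.e. after inverting \<open>s\<close>, the ring of the larger curve is generated by the elements
  of \<open>E0\<close> and finitely many others, and away from \<open>p\<close>, i.e. after inverting \<open>1 - s\<close>, it
  coincides with the localization of \<open>S\<close>.\<close>

lemma finitely_generated:
  assumes G: "finite G" "G \<subseteq> S" "S \<subseteq> alg G"
    and E0: "finite E0" "E0 \<subseteq> S" "\<And>x. x \<in> E0 \<Longrightarrow> vge 0 x"
    and frac: "\<And>g1 g2. g1 \<in> S \<Longrightarrow> g2 \<in> S \<Longrightarrow> g2 \<noteq> 0 \<Longrightarrow> vge (fls_subdegree g2) g1 \<Longrightarrow>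
      \<exists>b\<in>alg E0. \<exists>s\<in>alg E0. fls_nth s 0 \<noteq> 0 \<and> g1 * s = b * g2"
  shows "\<exists>E. finite E \<and> alg E = {x \<in> S. vge 0 x}"
proof -
  let ?A = "{x \<in> S. vge 0 x}"
  have A: "fls_subalgebra ?A"
    by unfold_locales (auto intro: const add mult vge_add vge_mult0)
  obtain u where u: "u \<in> S" "u \<noteq> 0" "fls_subdegree u = 1" using ex_value by blast
  then have u1: "vge 1 u" by (simp add: vge_def)
  \<comment> \<open>The sum of the pole orders serves as a common bound.\<close>
  obtain N where N: "\<And>x. x \<in> G \<Longrightarrow> vge (- int N) x"
  proof
    fix x assume "x \<in> G"
    then have "nat (- fls_subdegree x) \<le> (\<Sum>x\<in>G. nat (- fls_subdegree x))"
      using G(1) by (intro member_le_sum) auto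
    then show "vge (- int (\<Sum>x\<in>G. nat (- fls_subdegree x))) x"
      unfolding vge_def by linarith
  qed
  \<comment> \<open>Subtracting residues puts the generators into the maximal ideal without changing
    the algebra they generate, so that each of them can be divided by \<open>u\<close>
    locally.\<close>
  define E1 where "E1 = (\<lambda>x. x - fls_const (fls_nth x 0)) `
    (E0 \<union> {u} \<union> (\<lambda>x. u ^ N * x) ` G)"
  have genA: "E0 \<union> {u} \<union> (\<lambda>x. u ^ N * x) ` G \<subseteq> ?A"
  proof -
    have "vge 0 (u ^ N * x)" if "x \<in> G" for x
      using vge_mult[OF vge_power[OF u1, of N] N[OF that]] by simp
    then show ?thesis
      using E0 u G vge_mono[OF u1, of 0] by (auto intro!: mult power)
  qed
  have E1: "finite E1" "E1 \<subseteq> ?A" "\<And>x. x \<in> E1 \<Longrightarrow> vge 1 x"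
    unfolding E1_def using E0(1) G(1) genA
    by (auto intro!: diff const vge_diff vge_residue)
  interpret alg1: fls_subalgebra "alg E1" by (rule fls_subalgebra_alg)
  have gen1: "x \<in> alg E1" if "x \<in> E0 \<union> {u} \<union> (\<lambda>x. u ^ N * x) ` G" for x
  proof -
    have "x - fls_const (fls_nth x 0) \<in> alg E1"
      using that unfolding E1_def by (intro alg.incl) blast
    from alg1.add[OF this alg1.const[of "fls_nth x 0"]] show ?thesis by simp
  qed
  have E0_1: "alg E0 \<subseteq> alg E1" using gen1 by (intro alg1.alg_subset) blast
  have "\<forall>x\<in>E1. \<exists>b s. b \<in> alg E0 \<and> s \<in> alg E0 \<and> fls_nth s 0 \<noteq> 0 \<and> x * s = b * u"
  proof
    fix x assume "x \<in> E1"
    then show "\<exists>b s. b \<in> alg E0 \<and> s \<in> alg E0 \<and> fls_nth s 0 \<noteq> 0 \<and> x * s = b * u"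
      using frac[of x u] E1(2) E1(3)[of x] u by auto
  qed
  then obtain bf sf where sf: "\<And>x. x \<in> E1 \<Longrightarrow> bf x \<in> alg E0 \<and> sf x \<in> alg E0 \<and>
      fls_nth (sf x) 0 \<noteq> 0 \<and> x * sf x = bf x * u" by metis
  have prod: "prod sf I \<in> alg E1 \<and> fls_nth (prod sf I) 0 \<noteq> 0" if "I \<subseteq> E1" for I
    using finite_subset[OF that E1(1)] that
  proof (induction I rule: finite_induct)
    case empty
    then show ?case by (simp add: alg1.one)
  next
    case (insert x I)
    have "vge 0 (sf x)" "vge 0 (prod sf I)"
      using vge_alg[OF E0(3)] vge_alg[of E1 "prod sf I"] E1 sf insert by auto
    then have "fls_nth (sf x * prod sf I) 0 = fls_nth (sf x) 0 * fls_nth (prod sf I) 0"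
      by (rule fls_nth_mult_0)
    then show ?case using insert sf[of x] E0_1 by (auto intro!: alg1.mult)
  qed
  \<comment> \<open>The product of the denominators works for all generators at once: after
    inverting \<open>s\<close>, each of them is a multiple of \<open>u\<close>. Residue 1 puts
    \<open>1 - s\<close> into the maximal ideal.\<close>
  define s where "s = fls_const (1 / fls_nth (prod sf E1) 0) * prod sf E1"
  have s: "s \<in> alg E1" "fls_nth s 0 = 1"
    unfolding s_def using prod[of E1] by (auto intro: alg1.mult alg1.const)
  have sx: "\<exists>b\<in>alg E1. s * x = u * b" if x: "x \<in> E1" for x
  proof -
    let ?c = "fls_const (1 / fls_nth (prod sf E1) 0)"
    have "prod sf E1 = sf x * prod sf (E1 - {x})"
      using x E1(1) by (simp add: prod.remove)
    then have "s * x = ?c * prod sf (E1 - {x}) * (x * sf x)"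
      by (simp add: s_def)
    also have "\<dots> = u * (?c * prod sf (E1 - {x}) * bf x)"
      using sf[OF x] by simp
    finally show ?thesis
      using prod[of "E1 - {x}"] sf[OF x] E0_1 by (blast intro: alg1.mult alg1.const)
  qed
  have s0: "vge 0 s" using vge_alg[OF _ s(1)] E1 by blast
  have s'1: "vge 1 (1 - s)"
    using vge_diff[OF vge_0 vge_residue[OF s0]] s(2) by simp
  have sS: "s \<in> S" using fls_subalgebra.alg_subset[OF A E1(2)] s(1) by blast
  \<comment> \<open>Since \<open>1 - s\<close> has positive order, its \<open>N\<close>-th power
    cancels the poles of \<open>G\<close>. The added elements generate the ring where
    \<open>1 - s\<close> is invertible.\<close>
  define E where "E = E1 \<union> (\<lambda>x. (1 - s) ^ N * x) ` G"
  have "vge 0 ((1 - s) ^ N * x)" if "x \<in> G" for x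
    using vge_mult[OF vge_power[OF s'1, of N] N[OF that]] by simp
  then have EA: "E \<subseteq> ?A" unfolding E_def using E1(2) G(2) sS
    by (auto intro!: mult power diff one)
  interpret algE: fls_subalgebra "alg E" by (rule fls_subalgebra_alg)
  have E1E: "alg E1 \<subseteq> alg E" by (rule alg_mono) (simp add: E_def)
  have "a \<in> alg E" if a: "a \<in> ?A" for a
  proof -
    have aX: "a \<in> alg G" using a G(3) by blast
    obtain M where M: "u ^ M * a \<in> alg E1"
      using clear_denominators[OF fls_subalgebra_alg _ _ aX, of u E1 N] gen1 by blast
    have "vge (int M) (u ^ M * a)"
      using vge_mult[OF vge_power[OF u1, of M], of 0 a] a by simp
    then obtain b where b: "b \<in> alg E1" "s ^ M * (u ^ M * a) = u ^ M * b"
      using alg_power_divisible[OF _ s(1) _ gen1 _ _ sx M, of M] E1 s u by auto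
    have "s ^ M * a = b"
      using b(2) u(2) by (simp add: mult.left_commute)
    then have 1: "s ^ M * a \<in> alg E" using b E1E by blast
    have "(1 - s) ^ N * x \<in> alg E" if "x \<in> G" for x
      unfolding E_def using that by (intro alg.incl) blast
    then obtain K where 2: "(1 - s) ^ K * a \<in> alg E"
      using clear_denominators[OF fls_subalgebra_alg _ _ aX, of "1 - s" E N]
        algE.diff[OF algE.one] s(1) E1E by blast
    show ?thesis
      using comaximal_membership[OF fls_subalgebra_alg _ 1 2] s(1) E1E by blast
  qed
  then have "alg E = ?A"
    using fls_subalgebra.alg_subset[OF A EA] by blast
  moreover have "finite E" unfolding E_def using E1(1) G(1) by simp
  ultimately show ?thesis by blast
qed

end

section \<open>Evaluation of polynomials in two variables\<close>

definition pv :: "('a::comm_ring_1 \<Rightarrow> 'b::comm_ring_1) \<Rightarrow> 'a poly \<Rightarrow> 'b \<Rightarrow> 'b" where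
  "pv \<kappa> q x = poly (map_poly \<kappa> q) x"

text \<open>One evaluation serves several purposes: \<open>\<kappa>\<close> is the identity for
  values, \<open>cconst\<close> for substitution of polynomials, and \<open>fls_const\<close> for
  expansion at a place.\<close>

definition ev :: "('a::comm_ring_1 \<Rightarrow> 'b::comm_ring_1) \<Rightarrow> 'a poly poly \<Rightarrow> 'b \<Rightarrow> 'b \<Rightarrow> 'b" where
  "ev \<kappa> g x y = pv (\<lambda>q. pv \<kappa> q x) g y"

locale coeff_hom =
  fixes \<kappa> :: "'a::comm_ring_1 \<Rightarrow> 'b::comm_ring_1"
  assumes zero [simp]: "\<kappa> 0 = 0" and one [simp]: "\<kappa> 1 = 1"
    and add: "\<kappa> (a + b) = \<kappa> a + \<kappa> b" and mult: "\<kappa> (a * b) = \<kappa> a * \<kappa> b"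
begin

lemma uminus: "\<kappa> (- a) = - \<kappa> a"
  using add[of a "- a"] by (simp add: eq_neg_iff_add_eq_0 add.commute)

lemma diff: "\<kappa> (a - b) = \<kappa> a - \<kappa> b"
  using add[of a "- b"] by (simp add: uminus)

lemma power: "\<kappa> (a ^ n) = \<kappa> a ^ n"
  by (induction n) (auto simp: mult)

lemma sum: "\<kappa> (sum h I) = (\<Sum>i\<in>I. \<kappa> (h i))"
  by (induction I rule: infinite_finite_induct) (auto simp: add)

lemma pv_0 [simp]: "pv \<kappa> 0 x = 0"
  by (simp add: pv_def)

lemma pv_pCons [simp]: "pv \<kappa> (pCons c q) x = \<kappa> c + x * pv \<kappa> q x"
  by (simp add: pv_def map_poly_pCons)

lemma pv_add: "pv \<kappa> (p + q) x = pv \<kappa> p x + pv \<kappa> q x"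
proof (induction p arbitrary: q)
  case (pCons c p)
  then show ?case by (cases q) (simp add: add algebra_simps)
qed simp

lemma pv_smult: "pv \<kappa> (smult c q) x = \<kappa> c * pv \<kappa> q x"
  by (induction q) (auto simp: mult algebra_simps)

lemma pv_mult: "pv \<kappa> (p * q) x = pv \<kappa> p x * pv \<kappa> q x"
  by (induction p) (auto simp: pv_add pv_smult algebra_simps)

lemma coeff_hom_pv: "coeff_hom (\<lambda>q. pv \<kappa> q x)"
  by unfold_locales (auto simp: pv_add pv_mult one_pCons simp del: one_poly_eq_simps)

lemma pv_sum:
  assumes "Polynomial.degree q \<le> n"
  shows "pv \<kappa> q x = (\<Sum>i\<le>n. \<kappa> (Polynomial.coeff q i) * x ^ i)"
  using assms
proof (induction n arbitrary: q)
  case 0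
  then show ?case by (auto elim!: degree_eq_zeroE)
next
  case (Suc n)
  obtain c q' where q: "q = pCons c q'" by (cases q)
  then have "Polynomial.degree q' \<le> n" using Suc.prems by (cases "q' = 0") auto
  then show ?case
    using Suc.IH[of q'] unfolding q
    by (subst sum.atMost_Suc_shift) (simp add: sum_distrib_left algebra_simps)
qed

end

lemma coeff_hom_ev: "coeff_hom \<kappa> \<Longrightarrow> coeff_hom (\<lambda>g. ev \<kappa> g x y)"
  unfolding ev_def by (intro coeff_hom.coeff_hom_pv)

lemma coeff_hom_id: "coeff_hom (\<lambda>c. c)"
  by unfold_locales auto

lemma hom_pv:
  assumes "coeff_hom \<kappa>" "coeff_hom \<theta>"
  shows "\<theta> (pv \<kappa> q x) = pv (\<lambda>c. \<theta> (\<kappa> c)) q (\<theta> x)"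
proof -
  interpret k: coeff_hom \<kappa> by fact
  interpret t: coeff_hom \<theta> by fact
  interpret c: coeff_hom "\<lambda>c. \<theta> (\<kappa> c)"
    by unfold_locales (auto simp: k.add t.add k.mult t.mult)
  show ?thesis by (induction q) (auto simp: t.add t.mult)
qed

lemma hom_ev:
  assumes "coeff_hom \<kappa>" "coeff_hom \<theta>"
  shows "\<theta> (ev \<kappa> g x y) = ev (\<lambda>c. \<theta> (\<kappa> c)) g (\<theta> x) (\<theta> y)"
  unfolding ev_def hom_pv[OF coeff_hom.coeff_hom_pv[OF assms(1)] assms(2)]
  by (simp add: hom_pv[OF assms])

abbreviation cconst :: "'a::comm_ring_1 \<Rightarrow> 'a poly poly" where "cconst c \<equiv> [:[:c:]:]"
abbreviation tvar :: "'a::comm_ring_1 poly poly" where "tvar \<equiv> [:[:0, 1:]:]"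
abbreviation yvar :: "'a::comm_ring_1 poly poly" where "yvar \<equiv> [:0, 1:]"
abbreviation cf :: "'a::zero poly poly \<Rightarrow> nat \<Rightarrow> nat \<Rightarrow> 'a" where
  "cf g i j \<equiv> Polynomial.coeff (Polynomial.coeff g j) i"

lemma coeff_hom_cconst: "coeff_hom cconst"
  by unfold_locales (auto simp: one_pCons)

context coeff_hom
begin

lemma coeff_hom_ev': "coeff_hom (\<lambda>g. ev \<kappa> g x y)"
  by (rule coeff_hom_ev) unfold_locales

lemmas ev_0 [simp] = coeff_hom.zero[OF coeff_hom_ev']
  and ev_1 [simp] = coeff_hom.one[OF coeff_hom_ev']
  and ev_add = coeff_hom.add[OF coeff_hom_ev']
  and ev_mult = coeff_hom.mult[OF coeff_hom_ev']
  and ev_diff = coeff_hom.diff[OF coeff_hom_ev']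
  and ev_power = coeff_hom.power[OF coeff_hom_ev']
  and ev_sum = coeff_hom.sum[OF coeff_hom_ev']

lemma ev_cconst [simp]: "ev \<kappa> (cconst c) x y = \<kappa> c"
  and ev_tvar [simp]: "ev \<kappa> tvar x y = x"
  and ev_yvar [simp]: "ev \<kappa> yvar x y = y"
proof -
  interpret p: coeff_hom "\<lambda>q. pv \<kappa> q x" by (rule coeff_hom_pv)
  show "ev \<kappa> (cconst c) x y = \<kappa> c" "ev \<kappa> tvar x y = x" "ev \<kappa> yvar x y = y"
    by (simp_all add: ev_def)
qed

lemma ev_ev: "ev \<kappa> (ev cconst g p q) x y = ev \<kappa> g (ev \<kappa> p x y) (ev \<kappa> q x y)"
  by (subst hom_ev[OF coeff_hom_cconst coeff_hom_ev[of \<kappa> x y]]) (unfold_locales, simp)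

end

lemma eval2_eq_ev: "eval2 g (x, y) = ev (\<lambda>c. c) g x y"
proof -
  have 1: "coeff_hom (\<lambda>q::'a poly. poly q x)"
    by unfold_locales simp_all
  have "poly (poly g [:y:]) x = pv (\<lambda>q. poly q x) g y"
  proof (induction g)
    case 0
    show ?case by (simp add: pv_def)
  next
    case (pCons a q)
    then show ?case by (simp add: coeff_hom.pv_pCons[OF 1])
  qed
  then show ?thesis by (simp add: eval2_def ev_def pv_def)
qed

subsection \<open>Total degree\<close>

definition tdeg_le :: "nat \<Rightarrow> 'a::zero poly poly \<Rightarrow> bool" where
  "tdeg_le d g \<longleftrightarrow> (\<forall>i j. cf g i j \<noteq> 0 \<longrightarrow> i + j \<le> d)"

lemma tdeg_leD: "tdeg_le d g \<Longrightarrow> i + j > d \<Longrightarrow> cf g i j = 0"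
  unfolding tdeg_le_def by (metis linorder_not_le)

lemma tdeg_le_mono: "tdeg_le d g \<Longrightarrow> d \<le> e \<Longrightarrow> tdeg_le e g"
  unfolding tdeg_le_def by (meson order_trans)

lemma tdeg_le_add: "tdeg_le d g \<Longrightarrow> tdeg_le d h \<Longrightarrow> tdeg_le d (g + h)"
  unfolding tdeg_le_def by (metis add.right_neutral coeff_add)

lemma cf_mult:
  fixes g h :: "'a::comm_ring_1 poly poly"
  shows "cf (g * h) i j = (\<Sum>j'\<le>j. \<Sum>i'\<le>i. cf g i' j' * cf h (i - i') (j - j'))"
  by (simp add: Polynomial.coeff_mult coeff_sum)

lemma tdeg_le_mult:
  fixes g h :: "'a::comm_ring_1 poly poly"
  assumes "tdeg_le d g" "tdeg_le e h"
  shows "tdeg_le (d + e) (g * h)"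
  unfolding tdeg_le_def
proof (intro allI impI)
  fix i j assume nz: "cf (g * h) i j \<noteq> 0"
  show "i + j \<le> d + e"
  proof (rule ccontr)
    assume *: "\<not> i + j \<le> d + e"
    have "cf g i' j' * cf h (i - i') (j - j') = 0" if "i' \<le> i" "j' \<le> j" for i' j'
    proof (cases "i' + j' > d")
      case True
      then show ?thesis using tdeg_leD[OF assms(1)] by simp
    next
      case False
      then have "i - i' + (j - j') > e" using * that by linarith
      then show ?thesis using tdeg_leD[OF assms(2)] by simp
    qed
    then have "cf (g * h) i j = 0"
      unfolding cf_mult by (intro sum.neutral ballI) auto
    with nz show False by contradiction
  qed
qed

lemma tdeg_le_cconst: "tdeg_le d (cconst c)"
  by (auto simp: tdeg_le_def coeff_pCons split: nat.splits)

lemma tdeg_le_tvar: "tdeg_le 1 tvar" and tdeg_le_yvar: "tdeg_le 1 yvar"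
  by (auto simp: tdeg_le_def coeff_pCons split: nat.splits)

lemma tdeg_le_power:
  fixes g :: "'a::comm_ring_1 poly poly"
  shows "tdeg_le d g \<Longrightarrow> tdeg_le (n * d) (g ^ n)"
  by (induction n) (auto simp: one_pCons tdeg_le_cconst tdeg_le_mult simp del: one_poly_eq_simps)

lemma tdeg_le_0 [simp]: "tdeg_le d 0"
  by (simp add: tdeg_le_def)

lemma tdeg_le_sum: "(\<And>i. i \<in> I \<Longrightarrow> tdeg_le d (h i)) \<Longrightarrow> tdeg_le d (\<Sum>i\<in>I. h i)"
proof (induction I rule: infinite_finite_induct)
  case (insert x F)
  then have "tdeg_le d (h x + (\<Sum>i\<in>F. h i))" by (intro tdeg_le_add) simp_all
  then show ?case using insert.hyps by simp
qed simp_all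

lemma ex_tdeg_le: "\<exists>d. tdeg_le d g"
proof
  let ?d = "Polynomial.degree g + (\<Sum>j\<le>Polynomial.degree g. Polynomial.degree (Polynomial.coeff g j))"
  show "tdeg_le ?d g"
    unfolding tdeg_le_def
  proof (intro allI impI)
    fix i j assume nz: "cf g i j \<noteq> 0"
    then have "j \<le> Polynomial.degree g" "i \<le> Polynomial.degree (Polynomial.coeff g j)"
      by (auto intro: le_degree)
    moreover from this have "Polynomial.degree (Polynomial.coeff g j)
        \<le> (\<Sum>j\<le>Polynomial.degree g. Polynomial.degree (Polynomial.coeff g j))"
      by (intro member_le_sum) auto
    ultimately show "i + j \<le> ?d" by linarith
  qed
qed

definition tri :: "nat \<Rightarrow> (nat \<times> nat) set" where
  "tri d = {(i, j). i + j \<le> d}"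

lemma finite_tri [simp]: "finite (tri d)"
  by (rule finite_subset[of _ "{..d} \<times> {..d}"]) (auto simp: tri_def)

lemma (in coeff_hom) ev_tri:
  assumes "tdeg_le d g"
  shows "ev \<kappa> g x y = (\<Sum>(i, j)\<in>tri d. \<kappa> (cf g i j) * x ^ i * y ^ j)"
proof -
  interpret e: coeff_hom "\<lambda>q. pv \<kappa> q x" by (rule coeff_hom_pv)
  have dg: "Polynomial.degree g \<le> d"
  proof (rule Polynomial.degree_le, intro allI impI)
    fix j assume "d < j"
    then show "Polynomial.coeff g j = 0"
      using tdeg_leD[OF assms] by (intro poly_eqI) simp
  qed
  have dc: "Polynomial.degree (Polynomial.coeff g j) \<le> d" for j
    by (rule Polynomial.degree_le) (simp add: tdeg_leD[OF assms])
  have "ev \<kappa> g x y = (\<Sum>j\<le>d. \<Sum>i\<le>d. \<kappa> (cf g i j) * x ^ i * y ^ j)"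
    unfolding ev_def e.pv_sum[OF dg] pv_sum[OF dc] by (simp add: sum_distrib_right)
  also have "\<dots> = (\<Sum>(i, j)\<in>{..d} \<times> {..d}. \<kappa> (cf g i j) * x ^ i * y ^ j)"
    by (subst sum.swap) (simp add: sum.cartesian_product)
  also have "\<dots> = (\<Sum>(i, j)\<in>tri d. \<kappa> (cf g i j) * x ^ i * y ^ j)"
  proof (rule sum.mono_neutral_right)
    show "\<forall>p\<in>{..d} \<times> {..d} - tri d. (case p of (i, j) \<Rightarrow> \<kappa> (cf g i j) * x ^ i * y ^ j) = 0"
    proof
      fix p assume p: "p \<in> {..d} \<times> {..d} - tri d"
      obtain i j where ij: "p = (i, j)" by (cases p)
      then have "cf g i j = 0" using p by (intro tdeg_leD[OF assms]) (simp add: tri_def)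
      then show "(case p of (i, j) \<Rightarrow> \<kappa> (cf g i j) * x ^ i * y ^ j) = 0" by (simp add: ij)
    qed
  qed (force simp: tri_def)+
  finally show ?thesis .
qed

text \<open>The homogenization of \<open>g\<close> to degree \<open>d\<close>, evaluated at
  \<open>(x, y, z)\<close>. Terms of \<open>g\<close> of degree above \<open>d\<close> are dropped,
  which is exploited when the top form is split off; inside \<open>tri d\<close> the truncated
  subtraction is exact.\<close>

definition hval ::
  "('a::comm_ring_1 \<Rightarrow> 'b::comm_ring_1) \<Rightarrow> nat \<Rightarrow> 'a poly poly \<Rightarrow> 'b \<Rightarrow> 'b \<Rightarrow> 'b \<Rightarrow> 'b" where
  "hval \<kappa> d g x y z = (\<Sum>(i, j)\<in>tri d. \<kappa> (cf g i j) * x ^ i * y ^ j * z ^ (d - i - j))"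

lemma hval_ev:
  fixes \<kappa> :: "'a::comm_ring_1 \<Rightarrow> 'b::field"
  assumes "coeff_hom \<kappa>" "tdeg_le d g" "z \<noteq> 0"
  shows "hval \<kappa> d g x y z = z ^ d * ev \<kappa> g (x / z) (y / z)"
proof -
  have "\<kappa> (cf g i j) * x ^ i * y ^ j * z ^ (d - i - j)
      = z ^ d * (\<kappa> (cf g i j) * (x / z) ^ i * (y / z) ^ j)" if "i + j \<le> d" for i j
  proof -
    have "d = (d - i - j) + i + j" using that by simp
    then have "z ^ d = z ^ (d - i - j) * z ^ i * z ^ j"
      by (metis power_add)
    then have "z ^ d * (\<kappa> (cf g i j) * (x / z) ^ i * (y / z) ^ j)
        = \<kappa> (cf g i j) * ((x / z) ^ i * z ^ i) * ((y / z) ^ j * z ^ j) * z ^ (d - i - j)"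
      by (simp only: ac_simps)
    also have "(x / z) ^ i * z ^ i = x ^ i"
      using assms(3) by (simp add: power_divide)
    also have "(y / z) ^ j * z ^ j = y ^ j"
      using assms(3) by (simp add: power_divide)
    finally show ?thesis by (rule sym)
  qed
  then show ?thesis
    unfolding coeff_hom.ev_tri[OF assms(1,2)] hval_def sum_distrib_left
    by (intro sum.cong) (auto simp: tri_def)
qed

lemma hval_1: "coeff_hom \<kappa> \<Longrightarrow> tdeg_le d g \<Longrightarrow> hval \<kappa> d g x y 1 = ev \<kappa> g x y"
  by (simp add: hval_def coeff_hom.ev_tri)

text \<open>Over a finite field, 1 plus the product of all \<open>X - a\<close> would have no
  root.\<close>

lemma infinite_UNIV_alg_closed: "infinite (UNIV :: 'a::alg_closed_field set)"
proof
  assume fin: "finite (UNIV :: 'a set)"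
  define p :: "'a poly" where "p = (\<Prod>a\<in>UNIV. [:- a, 1:])"
  have "Polynomial.degree p = card (UNIV :: 'a set)"
    unfolding p_def by (subst degree_prod_eq_sum_degree) auto
  moreover have "card (UNIV :: 'a set) > 0" using fin by (simp add: card_gt_0_iff)
  ultimately have deg: "Polynomial.degree p > 0" by simp
  then have "Polynomial.degree (1 + p) > 0"
    by (subst degree_add_eq_right) auto
  then obtain x where "poly (1 + p) x = 0"
    using alg_closed_imp_poly_has_root by blast
  moreover have "poly p x = 0"
    unfolding p_def poly_prod using fin by (intro prod_zero) auto
  ultimately show False by simp
qed

lemma poly_eq_0_cofinite:
  fixes p :: "'a::alg_closed_field poly"
  assumes "finite F" "\<And>x. x \<notin> F \<Longrightarrow> poly p x = 0"
  shows "p = 0"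
proof (rule ccontr)
  assume "p \<noteq> 0"
  then have "finite ({x. poly p x = 0} \<union> F)"
    using assms(1) poly_roots_finite by blast
  moreover have "{x. poly p x = 0} \<union> F = UNIV" using assms(2) by blast
  ultimately show False using infinite_UNIV_alg_closed by metis
qed

lemma eval2_eq_0_imp:
  fixes g :: "'a::alg_closed_field poly poly"
  assumes "\<And>x. eval2 g x = 0"
  shows "g = 0"
proof (rule ccontr)
  assume "g \<noteq> 0"
  then have "finite {q. poly g q = 0}" by (rule poly_roots_finite)
  moreover have "range (\<lambda>y. [:y:]) \<subseteq> {q. poly g q = 0}"
  proof safe
    fix y
    have "poly (poly g [:y:]) x = 0" for x
      using assms[of "(x, y)"] by (simp add: eval2_def)
    then show "poly g [:y:] = 0" by (intro poly_eq_0_cofinite[of "{}"]) auto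
  qed
  ultimately have "finite (range (\<lambda>y::'a. [:y:]))" by (rule rev_finite_subset)
  then show False
    using infinite_UNIV_alg_closed[where 'a = 'a] by (simp add: finite_image_iff inj_on_def)
qed

lemma hval_poly: "\<exists>P. \<forall>z. hval \<kappa> d g x y z = poly P z"
proof
  show "\<forall>z. hval \<kappa> d g x y z =
      poly (\<Sum>(i, j)\<in>tri d. Polynomial.monom (\<kappa> (cf g i j) * x ^ i * y ^ j) (d - i - j)) z"
    by (simp add: hval_def poly_sum Polynomial.poly_monom case_prod_unfold)
qed

lemma hval_100:
  assumes "coeff_hom \<kappa>"
  shows "hval \<kappa> d g 1 0 0 = \<kappa> (cf g d 0)" "hval \<kappa> d g 0 1 0 = \<kappa> (cf g 0 d)"
proof -
  have "hval \<kappa> d g 1 0 0 = (\<Sum>p\<in>tri d. if p = (d, 0) then \<kappa> (cf g d 0) else 0)"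
    unfolding hval_def by (rule sum.cong) (auto simp: tri_def power_0_left split: if_splits)
  then show "hval \<kappa> d g 1 0 0 = \<kappa> (cf g d 0)"
    by (simp add: sum.delta[OF finite_tri]) (simp add: tri_def)
  have "hval \<kappa> d g 0 1 0 = (\<Sum>p\<in>tri d. if p = (0, d) then \<kappa> (cf g 0 d) else 0)"
    unfolding hval_def by (rule sum.cong) (auto simp: tri_def power_0_left split: if_splits)
  then show "hval \<kappa> d g 0 1 0 = \<kappa> (cf g 0 d)"
    by (simp add: sum.delta[OF finite_tri]) (simp add: tri_def)
qed

subsection \<open>Linear substitutions\<close>

text \<open>The directions \<open>(1, 0)\<close> and \<open>(0, 1)\<close> go to
  \<open>(a, b)\<close> and \<open>(a', b')\<close>. Hence the behaviour of \<open>g\<close> at the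
  points \<open>[a:b:0]\<close> and \<open>[a':b':0]\<close> is that of
  \<open>lin a b a' b' g\<close> at \<open>[1:0:0]\<close> and \<open>[0:1:0]\<close>.\<close>

definition lin :: "'a::comm_ring_1 \<Rightarrow> 'a \<Rightarrow> 'a \<Rightarrow> 'a \<Rightarrow> 'a poly poly \<Rightarrow> 'a poly poly" where
  "lin a b a' b' g =
    ev cconst g (cconst a * tvar + cconst a' * yvar) (cconst b * tvar + cconst b' * yvar)"

lemma coeff_hom_lin: "coeff_hom (lin a b a' b')"
  unfolding lin_def by (intro coeff_hom_ev coeff_hom_cconst)

lemma ev_lin:
  assumes "coeff_hom \<kappa>"
  shows "ev \<kappa> (lin a b a' b' g) x y = ev \<kappa> g (\<kappa> a * x + \<kappa> a' * y) (\<kappa> b * x + \<kappa> b' * y)"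
  unfolding lin_def
  by (simp only: coeff_hom.ev_ev[OF assms] coeff_hom.ev_add[OF assms] coeff_hom.ev_mult[OF assms]
      coeff_hom.ev_cconst[OF assms] coeff_hom.ev_tvar[OF assms] coeff_hom.ev_yvar[OF assms])

lemma tdeg_le_lin:
  assumes "tdeg_le d g"
  shows "tdeg_le d (lin a b a' b' g)"
proof -
  have l: "tdeg_le 1 (cconst x * tvar + cconst y * yvar)" for x y :: 'a
    using tdeg_le_mult[OF tdeg_le_cconst[of 0] tdeg_le_tvar]
      tdeg_le_mult[OF tdeg_le_cconst[of 0] tdeg_le_yvar]
    by (metis tdeg_le_add add_0)
  show ?thesis
    unfolding lin_def coeff_hom.ev_tri[OF coeff_hom_cconst assms]
  proof (intro tdeg_le_sum, clarify)
    fix i j assume "(i, j) \<in> tri d"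
    then have "0 + i * 1 + j * 1 \<le> d" by (simp add: tri_def)
    with tdeg_le_mult[OF tdeg_le_mult[OF tdeg_le_cconst tdeg_le_power[OF l]] tdeg_le_power[OF l]]
    show "tdeg_le d (cconst (cf g i j) * (cconst a * tvar + cconst a' * yvar) ^ i *
        (cconst b * tvar + cconst b' * yvar) ^ j)"
      by (rule tdeg_le_mono)
  qed
qed

text \<open>For nonzero \<open>z\<close> both sides can be dehomogenized and \<open>ev_lin\<close>
  applies. The case \<open>z = 0\<close>, the line at infinity, follows because both sides are
  polynomials in \<open>z\<close> over an infinite field.\<close>

lemma hval_lin:
  fixes g :: "'a::alg_closed_field poly poly"
  assumes g: "tdeg_le d g"
  shows "hval (\<lambda>c. c) d (lin a b a' b' g) x y z
    = hval (\<lambda>c. c) d g (a * x + a' * y) (b * x + b' * y) z"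
proof -
  obtain P where P: "\<And>z. hval (\<lambda>c. c) d (lin a b a' b' g) x y z = poly P z"
    using hval_poly by metis
  obtain Q where Q: "\<And>z. hval (\<lambda>c. c) d g (a * x + a' * y) (b * x + b' * y) z
      = poly Q z"
    using hval_poly by metis
  have "P - Q = 0"
  proof (rule poly_eq_0_cofinite[of "{0}"])
    fix z :: 'a assume "z \<notin> {0}"
    then have z: "z \<noteq> 0" by simp
    have "hval (\<lambda>c. c) d (lin a b a' b' g) x y z = z ^ d * ev (\<lambda>c. c) (lin a b a' b' g) (x / z) (y / z)"
      by (rule hval_ev[OF coeff_hom_id tdeg_le_lin[OF g] z])
    also have "\<dots> = z ^ d * ev (\<lambda>c. c) g ((a * x + a' * y) / z) ((b * x + b' * y) / z)"
      by (simp add: ev_lin[OF coeff_hom_id] add_divide_distrib)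
    also have "\<dots> = hval (\<lambda>c. c) d g (a * x + a' * y) (b * x + b' * y) z"
      by (rule hval_ev[OF coeff_hom_id g z, symmetric])
    finally show "poly (P - Q) z = 0" by (simp add: P Q)
  qed simp
  then show ?thesis by (simp add: P Q)
qed

subsection \<open>Forms in three variables\<close>

lemma eval3_pCons: "eval3 (pCons g F) (a, b, c) = eval2 g (a, b) + c * eval3 F (a, b, c)"
  by (simp add: eval3_def eval2_def)

lemma eval2_pCons: "eval2 (pCons q g) (a, b) = poly q a + b * eval2 g (a, b)"
  by (simp add: eval2_def)

lemma eval3_0 [simp]: "eval3 0 v = 0" and eval2_0 [simp]: "eval2 0 x = 0"
  by (simp_all add: eval3_def eval2_def case_prod_unfold)

lemma eval2_add: "eval2 (g + h) x = eval2 g x + eval2 h x"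
  and eval2_diff: "eval2 (g - h) x = eval2 g x - eval2 h x"
  and eval2_mult: "eval2 (g * h) x = eval2 g x * eval2 h x"
  and eval2_cconst: "eval2 (cconst c) x = c"
  by (simp_all add: eval2_def)

lemma eval3_1: "eval3 F (a, b, 1) = eval2 (poly F 1) (a, b)"
  by (simp add: eval3_def eval2_def one_pCons)

text \<open>The coefficient of \<open>e\<close> is the directional derivative. The remainder is kept
  polynomial in \<open>e\<close> so that coefficients can later be compared.\<close>

lemma poly_directional:
  "\<exists>R. \<forall>e. poly p (a + e * u) =
    poly p a + e * (u * poly (pderiv p) a) + e\<^sup>2 * poly R e"
  for a :: "'a::field"
proof (induction p)
  case 0
  show ?case by (intro exI[of _ 0]) simp
next
  case (pCons c p)
  then obtain R where R: "\<And>e. poly p (a + e * u) =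
    poly p a + e * (u * poly (pderiv p) a) + e\<^sup>2 * poly R e" by blast
  show ?case
    by (rule exI[of _ "[:u * u * poly (pderiv p) a:] + [:a, u:] * R"])
      (simp add: R pderiv_pCons power2_eq_square algebra_simps)
qed

lemma eval2_directional:
  "\<exists>R. \<forall>e. eval2 g (a + e * u, b + e * v) = eval2 g (a, b)
    + e * (u * eval2 (map_poly pderiv g) (a, b) + v * eval2 (pderiv g) (a, b))
    + e\<^sup>2 * poly R e"
  for a :: "'a::field"
proof (induction g)
  case 0
  show ?case by (intro exI[of _ 0]) simp
next
  case (pCons q g)
  obtain S where S: "\<And>e. poly q (a + e * u) =
    poly q a + e * (u * poly (pderiv q) a) + e\<^sup>2 * poly S e"
    using poly_directional by blast
  let ?D = "u * eval2 (map_poly pderiv g) (a, b) + v * eval2 (pderiv g) (a, b)"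
  from pCons obtain R where R: "\<And>e. eval2 g (a + e * u, b + e * v) = eval2 g (a, b)
    + e * ?D + e\<^sup>2 * poly R e" by blast
  show ?case
    by (rule exI[of _ "[:v * ?D:] + [:b, v:] * R + S"])
      (simp add: R S eval2_pCons eval2_add pderiv_pCons map_poly_pCons power2_eq_square algebra_simps)
qed

lemma eval3_directional:
  "\<exists>R. \<forall>e. eval3 F (a + e * u, b + e * v, c + e * w) = eval3 F (a, b, c)
    + e * (u * eval3 (map_poly (map_poly pderiv) F) (a, b, c)
      + v * eval3 (map_poly pderiv F) (a, b, c) + w * eval3 (pderiv F) (a, b, c))
    + e\<^sup>2 * poly R e"
  for a :: "'a::field"
proof (induction F)
  case 0
  show ?case by (intro exI[of _ 0]) simp
next
  case (pCons g F)
  let ?E = "u * eval2 (map_poly pderiv g) (a, b) + v * eval2 (pderiv g) (a, b)"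
  obtain S where S: "\<And>e. eval2 g (a + e * u, b + e * v) = eval2 g (a, b)
    + e * ?E + e\<^sup>2 * poly S e"
    using eval2_directional by blast
  let ?D = "u * eval3 (map_poly (map_poly pderiv) F) (a, b, c)
      + v * eval3 (map_poly pderiv F) (a, b, c) + w * eval3 (pderiv F) (a, b, c)"
  from pCons obtain R where R: "\<And>e. eval3 F (a + e * u, b + e * v, c + e * w) = eval3 F (a, b, c)
    + e * ?D + e\<^sup>2 * poly R e" by blast
  have add: "eval3 (F + G) v = eval3 F v + eval3 G v" for F G and v :: "'a \<times> 'a \<times> 'a"
    by (simp add: eval3_def case_prod_unfold)
  show ?case
    by (rule exI[of _ "[:w * ?D:] + [:c, w:] * R + S"])
      (simp add: R S eval3_pCons add pderiv_pCons map_poly_pCons power2_eq_square algebra_simps)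
qed

lemma poly_poly_one:
  "Polynomial.degree F \<le> n \<Longrightarrow> poly F x = (\<Sum>k\<le>n. Polynomial.coeff F k * x ^ k)"
  for F :: "'b::comm_ring_1 poly"
  using coeff_hom.pv_sum[OF coeff_hom_id] by (simp add: pv_def)

lemma homogeneous_degree:
  assumes "homogeneous d F"
  shows "Polynomial.degree F \<le> d"
proof (rule Polynomial.degree_le, intro allI impI)
  fix k assume "k > d"
  then show "Polynomial.coeff F k = 0"
    using assms unfolding homogeneous_def by (intro poly_eqI) (fastforce intro!: poly_eqI)
qed

text \<open>Homogeneity determines the exponent of the third variable from the other two, so setting
  this variable to 1 merges no monomials.\<close>

lemma cf_dehomogenize:
  assumes "homogeneous d F"
  shows "cf (poly F 1) i j = (if i + j \<le> d then cf (Polynomial.coeff F (d - i - j)) i j else 0)"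
proof -
  have z: "cf (Polynomial.coeff F k) i j = 0" if "k \<noteq> d - i - j \<or> i + j > d" for k
    using assms that unfolding homogeneous_def by (metis add.commute add_diff_cancel_left' diff_diff_left le_add1 linorder_not_le)
  have "cf (poly F 1) i j = (\<Sum>k\<le>d. cf (Polynomial.coeff F k) i j)"
    by (simp add: poly_poly_one[OF homogeneous_degree[OF assms]] coeff_sum)
  also have "\<dots> = (\<Sum>k\<in>{d - i - j}. cf (Polynomial.coeff F k) i j)"
    by (rule sum.mono_neutral_right) (use z in auto)
  finally show ?thesis using z by auto
qed

lemma tdeg_le_dehomogenize: "homogeneous d F \<Longrightarrow> tdeg_le d (poly F 1)"
  unfolding tdeg_le_def by (auto simp: cf_dehomogenize split: if_splits)

lemma eval3_homogeneous:
  assumes "homogeneous d F"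
  shows "eval3 F (x, y, z) = hval (\<lambda>c. c) d (poly F 1) x y z"
proof -
  have h: "i + j + k = d" if "cf (Polynomial.coeff F k) i j \<noteq> 0" for i j k
    using assms that unfolding homogeneous_def by blast
  have t: "tdeg_le d (Polynomial.coeff F k)" for k
    unfolding tdeg_le_def using h le_add1 by blast
  have n: "cf (Polynomial.coeff F k) i j = 0" if "k \<noteq> d - i - j" for i j k
    using h[of k j i] that by (metis add_diff_cancel_left' diff_diff_left)
  note ih = coeff_hom_id[where 'a = 'a]
  have "eval3 F (x, y, z) = eval2 (poly F (cconst z)) (x, y)"
    by (simp add: eval3_def eval2_def)
  also have "\<dots> = (\<Sum>k\<le>d. eval2 (Polynomial.coeff F k) (x, y) * z ^ k)"
    unfolding poly_poly_one[OF homogeneous_degree[OF assms]] eval2_eq_ev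
    by (simp add: coeff_hom.ev_sum[OF ih] coeff_hom.ev_mult[OF ih] coeff_hom.ev_power[OF ih]
      coeff_hom.ev_cconst[OF ih] del: poly_const_pow)
  also have "\<dots> = (\<Sum>k\<le>d. \<Sum>(i, j)\<in>tri d. cf (Polynomial.coeff F k) i j * x ^ i * y ^ j * z ^ k)"
    unfolding eval2_eq_ev coeff_hom.ev_tri[OF ih t] by (simp only: sum_distrib_right case_prod_unfold)
  also have "\<dots> = (\<Sum>(i, j)\<in>tri d. \<Sum>k\<le>d. cf (Polynomial.coeff F k) i j * x ^ i * y ^ j * z ^ k)"
    by (simp only: case_prod_unfold) (rule sum.swap)
  also have "\<dots> = hval (\<lambda>c. c) d (poly F 1) x y z"
    unfolding hval_def
  proof (intro sum.cong refl, clarify)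
    fix i j assume ij: "(i, j) \<in> tri d"
    have "(\<Sum>k\<le>d. cf (Polynomial.coeff F k) i j * x ^ i * y ^ j * z ^ k)
      = (\<Sum>k\<in>{d - i - j}. cf (Polynomial.coeff F k) i j * x ^ i * y ^ j * z ^ k)"
      using ij by (intro sum.mono_neutral_right ballI) (simp_all add: n tri_def)
    also have "\<dots> = cf (Polynomial.coeff F (d - i - j)) i j * x ^ i * y ^ j * z ^ (d - i - j)"
      by simp
    also have "cf (Polynomial.coeff F (d - i - j)) i j = cf (poly F 1) i j"
      unfolding cf_dehomogenize[OF assms] using ij by (simp add: tri_def)
    finally show "(\<Sum>k\<le>d. cf (Polynomial.coeff F k) i j * x ^ i * y ^ j * z ^ k)
      = cf (poly F 1) i j * x ^ i * y ^ j * z ^ (d - i - j)" .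
  qed
  finally show ?thesis .
qed

lemma ex_homogenization:
  fixes g :: "'a::field poly poly"
  assumes "tdeg_le d g"
  obtains F where "homogeneous d F" "poly F 1 = g"
proof
  let ?F = "\<Sum>(i, j)\<in>tri d. Polynomial.monom (Polynomial.monom (Polynomial.monom (cf g i j) i) j) (d - i - j)"
  have c: "cf (Polynomial.coeff ?F k) i j = (if i + j \<le> d \<and> k = d - i - j then cf g i j else 0)" for i j k
  proof -
    have "cf (Polynomial.coeff ?F k) i j = (\<Sum>p\<in>tri d.
        if p = (i, j) then (if k = d - i - j then cf g i j else 0) else 0)"
      unfolding coeff_sum case_prod_unfold
      by (intro sum.cong) (auto simp: coeff_monom)
    also have "\<dots> = (if (i, j) \<in> tri d then (if k = d - i - j then cf g i j else 0) else 0)"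
      by (simp add: sum.delta)
    finally show ?thesis by (simp add: tri_def)
  qed
  show h: "homogeneous d ?F"
    unfolding homogeneous_def c by auto
  show "poly ?F 1 = g"
  proof (intro poly_eqI)
    fix j i
    show "cf (poly ?F 1) i j = cf g i j"
      unfolding cf_dehomogenize[OF h] c using tdeg_leD[OF assms, of i j] by auto
  qed
qed

section \<open>The place at a smooth point at infinity\<close>

lemma poly_taylor2:
  fixes p :: "'b::idom poly"
  shows "\<exists>r. poly p (x + h) = poly p x + h * poly (pderiv p) x + h * h * r"
proof (induction p)
  case (pCons c p)
  then obtain r where "poly p (x + h) =
      poly p x + h * poly (pderiv p) x + h * h * r" by blast
  then show ?case
    by (intro exI[of _ "poly (pderiv p) x + (x + h) * r"])
      (simp add: pderiv_pCons algebra_simps)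
qed simp

lemma fps_X_power_dvd_iff: "fps_X ^ n dvd (f :: 'a::field fps) \<longleftrightarrow> (\<forall>k<n. fps_nth f k = 0)"
proof
  assume "fps_X ^ n dvd f"
  then obtain g where "f = fps_X ^ n * g" by (elim dvdE)
  then show "\<forall>k<n. fps_nth f k = 0" by (simp add: fps_X_power_mult_nth)
next
  assume *: "\<forall>k<n. fps_nth f k = 0"
  have "f = fps_X ^ n * fps_shift n f"
    by (rule fps_ext) (use * in \<open>simp add: fps_X_power_mult_nth\<close>)
  then show "fps_X ^ n dvd f" by (rule dvdI)
qed

text \<open>Newton iteration with the constant inverse slope \<open>c\<close>: every step gains a
  power of \<open>fps_X\<close>, because \<open>1 - c * poly (pderiv P) w\<close> has no constant
  term.\<close>

lemma fps_hensel:
  fixes P :: "'a::field fps poly"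
  assumes c0: "fps_nth (Polynomial.coeff P 0) 0 = 0"
    and c1: "fps_nth (Polynomial.coeff P 1) 0 \<noteq> 0"
  shows "\<exists>z. fps_nth z 0 = 0 \<and> poly P z = 0"
proof -
  define c where "c = fps_const (1 / fps_nth (Polynomial.coeff P 1) 0)"
  define w where "w n = ((\<lambda>z. z - c * poly P z) ^^ n) 0" for n
  have w_Suc: "w (Suc n) = w n + (- c * poly P (w n))" for n
    by (simp add: w_def)
  have nth0: "fps_nth (poly Q z) 0 = fps_nth (Polynomial.coeff Q 0) 0"
    if "fps_nth z 0 = 0" for Q z
    using that by (cases Q) simp
  have inv: "fps_nth (w n) 0 = 0 \<and> fps_X ^ Suc n dvd poly P (w n)" for n
  proof (induction n)
    case 0
    have "w 0 = 0" by (simp add: w_def)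
    then show ?case unfolding fps_X_power_dvd_iff using c0 nth0[of 0 P] by simp
  next
    case (Suc n)
    let ?h = "- c * poly P (w n)"
    have wn: "fps_nth (w n) 0 = 0" and dv: "fps_X ^ Suc n dvd poly P (w n)"
      using Suc by auto
    have z: "fps_nth (w (Suc n)) 0 = 0"
      unfolding w_Suc using wn nth0[OF wn, of P] c0 by simp
    obtain r where r: "poly P (w n + ?h) = poly P (w n)
        + ?h * poly (pderiv P) (w n) + ?h * ?h * r"
      using poly_taylor2[of P "w n" ?h] by blast
    have "fps_nth (1 - c * poly (pderiv P) (w n)) 0 = 0"
      using nth0[OF wn, of "pderiv P"] c1 by (simp add: c_def coeff_pderiv)
    then have "fps_X ^ 1 dvd 1 - c * poly (pderiv P) (w n)"
      unfolding fps_X_power_dvd_iff by simp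
    from mult_dvd_mono[OF dv this]
    have d1: "fps_X ^ Suc (Suc n) dvd poly P (w n) * (1 - c * poly (pderiv P) (w n))"
      by (simp add: mult_ac)
    have dh: "fps_X ^ Suc n dvd ?h" using dv by simp
    have "fps_X ^ Suc (Suc n) dvd (fps_X ^ Suc n * fps_X ^ Suc n :: 'a fps)"
      unfolding power_add[symmetric] by (rule le_imp_power_dvd) simp
    also have "\<dots> dvd ?h * ?h * r" using mult_dvd_mono[OF dh dh] by (rule dvd_mult2)
    finally have d2: "fps_X ^ Suc (Suc n) dvd ?h * ?h * r" .
    have "poly P (w (Suc n))
        = poly P (w n) * (1 - c * poly (pderiv P) (w n)) + ?h * ?h * r"
      unfolding w_Suc r by (simp add: algebra_simps)
    then show ?case using dvd_add[OF d1 d2] z by (simp del: power_Suc)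
  qed
  \<comment> \<open>From step \<open>n\<close> on, the approximations agree up to order
    \<open>n\<close>, so the diagonal is their limit.\<close>
  define z where "z = Abs_fps (\<lambda>n. fps_nth (w n) n)"
  have step: "fps_nth (w (Suc n)) k = fps_nth (w n) k" if "k \<le> n" for n k
  proof -
    have "fps_X ^ Suc n dvd - c * poly P (w n)" using inv[of n] by simp
    then show ?thesis using that unfolding w_Suc fps_X_power_dvd_iff by simp
  qed
  have stable: "fps_nth (w n) k = fps_nth (w k) k" if "k \<le> n" for n k
    using that by (induction n rule: dec_induct) (simp_all add: step)
  have "fps_nth (poly P z) n = 0" for n
  proof -
    obtain r where r: "poly P (w n + (z - w n)) = poly P (w n)
        + (z - w n) * poly (pderiv P) (w n) + (z - w n) * (z - w n) * r"
      using poly_taylor2[of P "w n" "z - w n"] by blast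
    have "fps_nth (z - w n) k = 0" if "k < Suc n" for k
      using stable[of k n, symmetric] that by (simp add: z_def)
    then have "fps_X ^ Suc n dvd z - w n"
      unfolding fps_X_power_dvd_iff by blast
    then have "fps_X ^ Suc n dvd poly P (w n + (z - w n))"
      unfolding r using inv[of n] by (intro dvd_add) (auto simp del: power_Suc)
    then show ?thesis unfolding fps_X_power_dvd_iff by simp
  qed
  then have "poly P z = 0" by (intro fps_ext) simp
  moreover have "fps_nth z 0 = 0" using inv[of 0] by (simp add: z_def)
  ultimately show ?thesis by blast
qed

section \<open>Forms evaluated at points specializing to \<open>[1:0:0]\<close>\<close>

lemma hom_hval:
  assumes "coeff_hom \<theta>"
  shows "\<theta> (hval \<kappa> d g x y z) = hval (\<lambda>c. \<theta> (\<kappa> c)) d g (\<theta> x) (\<theta> y) (\<theta> z)"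
  unfolding hval_def
  by (simp add: coeff_hom.sum[OF assms] coeff_hom.mult[OF assms] coeff_hom.power[OF assms]
      case_prod_unfold)

definition top_form :: "('a::comm_ring_1 \<Rightarrow> 'b::comm_ring_1) \<Rightarrow> nat \<Rightarrow> 'a poly poly \<Rightarrow> 'b \<Rightarrow> 'b \<Rightarrow> 'b" where
  "top_form \<kappa> d g x y = (\<Sum>j\<le>d. \<kappa> (cf g (d - j) j) * x ^ (d - j) * y ^ j)"

text \<open>On the right, \<open>hval \<kappa> d\<close> keeps only the terms of degree at most
  \<open>d\<close>. For a curve of degree \<open>d + 1\<close> this separates its restriction to the
  line at infinity \<open>z = 0\<close> from the terms divisible by \<open>z\<close>.\<close>

lemma hval_Suc: "hval \<kappa> (Suc d) g x y z = top_form \<kappa> (Suc d) g x y + z * hval \<kappa> d g x y z"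
proof -
  let ?D = "(\<lambda>j. (Suc d - j, j)) ` {..Suc d}"
  let ?t = "\<lambda>(i, j). \<kappa> (cf g i j) * x ^ i * y ^ j * z ^ (Suc d - i - j)"
  have tri: "tri (Suc d) = ?D \<union> tri d" "?D \<inter> tri d = {}"
    by (auto simp: tri_def image_iff)
  have "hval \<kappa> (Suc d) g x y z = sum ?t ?D + sum ?t (tri d)"
    unfolding hval_def tri by (rule sum.union_disjoint) (use tri in auto)
  also have "sum ?t ?D = top_form \<kappa> (Suc d) g x y"
    unfolding top_form_def by (subst sum.reindex) (auto intro!: inj_onI sum.cong)
  also have "sum ?t (tri d) = z * hval \<kappa> d g x y z"
    unfolding hval_def sum_distrib_left
  proof (intro sum.cong refl, clarify)
    fix i j assume "(i, j) \<in> tri d"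
    then have "Suc d - i - j = Suc (d - i - j)" by (simp add: tri_def)
    then show "\<kappa> (cf g i j) * x ^ i * y ^ j * z ^ (Suc d - i - j)
      = z * (\<kappa> (cf g i j) * x ^ i * y ^ j * z ^ (d - i - j))"
      by (simp add: mult_ac)
  qed
  finally show ?thesis .
qed

lemma top_form_1:
  "top_form \<kappa> (Suc d) g 1 y = \<kappa> (cf g (Suc d) 0) + y * (\<Sum>j\<le>d. \<kappa> (cf g (d - j) (Suc j)) * y ^ j)"
  unfolding top_form_def by (subst sum.atMost_Suc_shift) (simp add: sum_distrib_left mult_ac)

lemma coeff_hom_fls_const: "coeff_hom (fls_const :: 'a::field \<Rightarrow> _)"
  by unfold_locales (auto simp: fls_plus_const)

lemma coeff_hom_fps_to_fls: "coeff_hom (fps_to_fls :: 'a::field fps \<Rightarrow> _)"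
  by unfold_locales (auto simp: fls_times_fps_to_fls)

lemma vge_sum: "(\<And>i. i \<in> I \<Longrightarrow> vge n (h i)) \<Longrightarrow> vge n (sum h I)"
proof (induction I rule: infinite_finite_induct)
  case (insert x F)
  then show ?case by (simp add: vge_add)
qed simp_all

lemma vge_hval:
  assumes "vge 0 x" "vge 0 y" "vge 0 z"
  shows "vge 0 (hval fls_const d g x y z)"
  unfolding hval_def
  by (intro vge_sum) (auto intro!: vge_mult0 vge_power0 assms)

text \<open>The point \<open>[1:y:z]\<close> specializes to \<open>[1:0:0]\<close>, where only
  \<open>t^d\<close> survives. This is how the value of a form at the place is read off from its
  expansion.\<close>

lemma hval_1_residue:
  assumes "vge 1 y" "vge 1 z"
  shows "fls_nth (hval fls_const d g 1 y z) 0 = cf g d 0"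
proof (cases d)
  case 0
  then show ?thesis by (simp add: hval_def tri_def)
next
  case (Suc d')
  have y0: "vge 0 y" and z0: "vge 0 z" using assms by (auto intro: vge_mono)
  have "vge (1 + 0) (y * (\<Sum>j\<le>d'. fls_const (cf g (d' - j) (Suc j)) * y ^ j))"
    by (intro vge_mult assms vge_sum vge_mult0 vge_power0 y0 vge_const)
  moreover have "vge (1 + 0) (z * hval fls_const d' g 1 y z)"
    by (intro vge_mult assms vge_hval y0 z0 vge_1)
  ultimately show ?thesis
    unfolding Suc hval_Suc top_form_1 by (simp add: vge_1_imp_nth0)
qed

lemma fls_nth_polynomial:
  "fls_nth (\<Sum>j\<le>n. fls_const (c j) * fls_X ^ j) (int k) = (if k \<le> n then c k else (0::'a::field))"
proof -
  have "(\<Sum>j\<le>n. fls_const (c j) * fls_X ^ j) = fps_to_fls (\<Sum>j\<le>n. fps_const (c j) * fps_X ^ j)"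
    by (simp add: coeff_hom.sum[OF coeff_hom_fps_to_fls] fls_times_fps_to_fls fps_to_fls_power)
  also have "fls_nth \<dots> (int k) = fps_nth (\<Sum>j\<le>n. fps_const (c j) * fps_X ^ j) k"
    by simp
  also have "\<dots> = (\<Sum>j\<le>n. if j = k then c j else 0)"
    unfolding fps_sum_nth by (rule sum.cong) (auto simp: fps_X_power_nth)
  finally show ?thesis by simp
qed

lemma (in fls_subalgebra) sum: "(\<And>i. i \<in> I \<Longrightarrow> h i \<in> S) \<Longrightarrow> sum h I \<in> S"
proof (induction I rule: infinite_finite_induct)
  case (insert x F)
  then show ?case by (simp add: add)
qed (use const[of 0] in simp_all)

lemma (in fls_subalgebra) hval_mem:
  assumes "x \<in> S" "y \<in> S" "z \<in> S"
  shows "hval fls_const n g x y z \<in> S"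
  unfolding hval_def by (intro sum) (auto intro!: mult const power assms)

text \<open>The derivative in \<open>\<zeta>\<close> at the origin of the equation in local
  coordinates is the coefficient of \<open>t^d\<close>, so \<open>\<zeta>\<close> is a power series
  in the other coordinate.\<close>

lemma ex_place_1:
  fixes g :: "'a::field poly poly"
  assumes c0: "cf g (Suc d) 0 = 0" and c: "cf g d 0 \<noteq> 0"
  shows "\<exists>\<zeta>. vge 1 \<zeta> \<and> hval fls_const (Suc d) g 1 fls_X \<zeta> = 0"
proof -
  define P where "P = (\<Sum>(i, j)\<in>tri (Suc d).
    Polynomial.monom (fps_const (cf g i j) * fps_X ^ j) (Suc d - i - j))"
  have P: "poly P z = hval fps_const (Suc d) g 1 fps_X z" for z
    by (simp add: P_def hval_def poly_sum Polynomial.poly_monom case_prod_unfold)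
  have co: "fps_nth (Polynomial.coeff P k) 0 = cf g (Suc d - k) 0" if "k \<le> Suc d" for k
  proof -
    have "fps_nth (Polynomial.coeff P k) 0
      = (\<Sum>p\<in>tri (Suc d). if p = (Suc d - k, 0) then cf g (Suc d - k) 0 else 0)"
      unfolding P_def coeff_sum fps_sum_nth
      by (rule sum.cong) (use that in \<open>auto simp: tri_def power_0_left fps_X_power_nth split: if_splits\<close>)
    then show ?thesis
      by (simp add: sum.delta[OF finite_tri]) (simp add: tri_def)
  qed
  obtain z where z: "fps_nth z 0 = 0" "poly P z = 0"
    using fps_hensel[of P] co[of 0] co[of 1] c0 c by auto
  have "vge 1 (fps_to_fls z)" using z(1) by (auto simp: vge_iff)
  moreover have "hval fls_const (Suc d) g 1 fls_X (fps_to_fls z) = 0"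
    using hom_hval[OF coeff_hom_fps_to_fls, of fps_const "Suc d" g 1 fps_X z] z(2) P by simp
  ultimately show ?thesis by blast
qed

text \<open>The derivative in \<open>\<eta>\<close> is the coefficient of \<open>t^d * y\<close>, so
  here \<open>\<eta>\<close> is the dependent coordinate.\<close>

lemma ex_place_2:
  fixes g :: "'a::field poly poly"
  assumes c0: "cf g (Suc d) 0 = 0" and c: "cf g d 1 \<noteq> 0"
  shows "\<exists>\<eta>. vge 1 \<eta> \<and> hval fls_const (Suc d) g 1 \<eta> fls_X = 0"
proof -
  define P where "P = (\<Sum>(i, j)\<in>tri (Suc d).
    Polynomial.monom (fps_const (cf g i j) * fps_X ^ (Suc d - i - j)) j)"
  have P: "poly P z = hval fps_const (Suc d) g 1 z fps_X" for z
    by (simp add: P_def hval_def poly_sum Polynomial.poly_monom case_prod_unfold mult_ac)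
  have co: "fps_nth (Polynomial.coeff P k) 0 = cf g (Suc d - k) k" if "k \<le> Suc d" for k
  proof -
    have "fps_nth (Polynomial.coeff P k) 0
      = (\<Sum>p\<in>tri (Suc d). if p = (Suc d - k, k) then cf g (Suc d - k) k else 0)"
      unfolding P_def coeff_sum fps_sum_nth
      by (rule sum.cong) (use that in \<open>auto simp: tri_def power_0_left fps_X_power_nth split: if_splits\<close>)
    then show ?thesis using that
      by (simp add: sum.delta[OF finite_tri]) (simp add: tri_def)
  qed
  obtain z where z: "fps_nth z 0 = 0" "poly P z = 0"
    using fps_hensel[of P] co[of 0] co[of 1] c0 c by auto
  have "vge 1 (fps_to_fls z)" using z(1) by (auto simp: vge_iff)
  moreover have "hval fls_const (Suc d) g 1 (fps_to_fls z) fls_X = 0"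
    using hom_hval[OF coeff_hom_fps_to_fls, of fps_const "Suc d" g 1 z fps_X] z(2) P by simp
  ultimately show ?thesis by blast
qed

text \<open>In the coordinates \<open>t = 1 / \<zeta>\<close>, \<open>y = \<eta> / \<zeta>\<close>, the conditions on \<open>g\<close> say that the curve \<open>g = 0\<close>
  passes through \<open>[1:0:0]\<close> and is smooth there, and that it contains \<open>[0:1:0]\<close>.\<close>

lemma ex_place:
  fixes g :: "'a::field poly poly"
  assumes c0: "cf g (Suc d) 0 = 0" and smooth: "cf g d 0 \<noteq> 0 \<or> cf g d 1 \<noteq> 0"
    and other: "cf g 0 (Suc d) = 0" and top: "\<exists>j\<le>Suc d. cf g (Suc d - j) j \<noteq> 0"
  shows "\<exists>\<eta> \<zeta>. vge 1 \<eta> \<and> vge 1 \<zeta> \<and> hval fls_const (Suc d) g 1 \<eta> \<zeta> = 0 \<and> fls_X \<in> {\<eta>, \<zeta>} \<and>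
    \<zeta> \<noteq> 0 \<and> fls_subdegree \<zeta> < int (Suc d) \<and>
    (\<exists>W\<in>alg {\<eta>, \<zeta>}. fls_nth W 0 \<noteq> 0 \<and> (\<forall>x\<in>{\<eta>, \<zeta>}. \<exists>b\<in>alg {\<eta>, \<zeta>}. W * x = fls_X * b)) \<and>
    (cf g d 1 = 0 \<and> (d \<ge> 1 \<longrightarrow> cf g (d - 1) 2 = 0) \<longrightarrow> \<eta> = fls_X \<and> fls_subdegree \<zeta> \<ge> 3)"
proof -
  have hval_alg: "hval fls_const n g 1 \<eta> \<zeta> \<in> alg {\<eta>, \<zeta>}" for n \<eta> \<zeta>
  proof -
    interpret fls_subalgebra "alg {\<eta>, \<zeta>}" by (rule fls_subalgebra_alg)
    show ?thesis by (intro hval_mem) (auto intro: alg.incl one)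
  qed
  have poly_alg: "(\<Sum>j\<le>n. fls_const (c j) * \<eta> ^ j) \<in> alg {\<eta>, \<zeta>}" for n \<eta> \<zeta> and c :: "nat \<Rightarrow> 'a"
  proof -
    interpret fls_subalgebra "alg {\<eta>, \<zeta>}" by (rule fls_subalgebra_alg)
    have "\<eta> \<in> alg {\<eta>, \<zeta>}" by (auto intro: alg.incl)
    then show ?thesis by (induction n) (auto intro!: mult add const power one)
  qed
  have X1: "vge 1 (fls_X :: 'a fls)" by (simp add: vge_def)
  show ?thesis
  proof (cases "cf g d 0 = 0")
    case False
    obtain \<zeta> where \<zeta>: "vge 1 \<zeta>" "hval fls_const (Suc d) g 1 fls_X \<zeta> = 0"
      using ex_place_1[OF c0 False] by blast
    define W where "W = hval fls_const d g 1 fls_X \<zeta>"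
    \<comment> \<open>\<open>T\<close> is the restriction of the equation to the line at infinity.
      Since \<open>T = - (\<zeta> * W)\<close> with a unit \<open>W\<close>, the order of
      \<open>\<zeta>\<close> is the intersection number with this line at
      \<open>[1:0:0]\<close>.\<close>
    define T where "T = (\<Sum>j\<le>Suc d. fls_const (cf g (Suc d - j) j) * fls_X ^ j)"
    have W: "W \<in> alg {fls_X, \<zeta>}" "fls_nth W 0 \<noteq> 0" "vge 0 W"
      unfolding W_def using hval_alg hval_1_residue[OF X1 \<zeta>(1), of d g] False \<zeta>(1)
      by (auto intro!: vge_hval vge_mono[OF \<zeta>(1)] vge_mono[OF X1])
    note W0 = fls_nth0_nonzero[OF W(3,2)]
    have eq: "T + \<zeta> * W = 0"
      using \<zeta>(2) unfolding hval_Suc W_def[symmetric] T_def by (simp add: top_form_def)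
    define B where "B = (\<Sum>j\<le>d. fls_const (cf g (d - j) (Suc j)) * fls_X ^ j)"
    have "T = fls_X * B"
      unfolding T_def B_def using top_form_1[of fls_const d g fls_X] c0 by (simp add: top_form_def)
    then have "W * \<zeta> = fls_X * (fls_const (- 1) * B)"
      using eq by (simp add: add_eq_0_iff mult.commute)
    moreover have "fls_const (- 1) * B \<in> alg {fls_X, \<zeta>}"
      unfolding B_def by (intro alg.mult alg.const poly_alg)
    moreover have "W * fls_X = fls_X * W" by simp
    ultimately have div: "\<forall>x\<in>{fls_X, \<zeta>}. \<exists>b\<in>alg {fls_X, \<zeta>}. W * x = fls_X * b"
      using W(1) by blast
    obtain j where j: "j \<le> Suc d" "cf g (Suc d - j) j \<noteq> 0" using top by blast
    \<comment> \<open>The second point at infinity removes the monomial \<open>y^(d+1)\<close>,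
      which keeps the order of \<open>T\<close> below the degree of the curve.\<close>
    then have jd: "j \<le> d" using other by (cases "j = Suc d") auto
    have Tj: "fls_nth T (int k) = (if k \<le> Suc d then cf g (Suc d - k) k else 0)" for k
      unfolding T_def by (rule fls_nth_polynomial)
    then have "T \<noteq> 0" "fls_subdegree T \<le> int j"
      using j by (metis fls_zero_nth, metis fls_subdegree_leI)
    have \<zeta>0: "\<zeta> \<noteq> 0" using eq \<open>T \<noteq> 0\<close> by auto
    have "T = - (\<zeta> * W)" using eq by (simp add: add_eq_0_iff2)
    then have sd: "fls_subdegree T = fls_subdegree \<zeta>"
      using W0 \<zeta>0 by simp
    have "fls_subdegree \<zeta> \<ge> 3" if "cf g d 1 = 0" "d \<ge> 1 \<longrightarrow> cf g (d - 1) 2 = 0"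
    proof -
      have "fls_nth T k = 0" if "k < 3" for k
      proof (cases "k \<ge> 0")
        case True
        then have "k = int 0 \<or> k = int 1 \<or> k = int 2" using that by auto
        then show ?thesis unfolding Tj
        proof (elim disjE)
          assume "k = int 2"
          then show "fls_nth T k = 0"
            using Tj[of 2] \<open>d \<ge> 1 \<longrightarrow> cf g (d - 1) 2 = 0\<close> by (cases d) auto
        qed (use Tj[of 0] Tj[of 1] c0 \<open>cf g d 1 = 0\<close> in auto)
      next
        case False
        have "vge 1 T" unfolding \<open>T = - (\<zeta> * W)\<close>
          using vge_diff[OF vge_0 vge_mult[OF \<zeta>(1) W(3)]] by simp
        then show ?thesis using False by (simp add: vge_iff)
      qed
      then show ?thesis using fls_subdegree_geI[OF \<open>T \<noteq> 0\<close>, of 3] sd by simp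
    qed
    moreover have "\<exists>W\<in>alg {fls_X, \<zeta>}. fls_nth W 0 \<noteq> 0 \<and>
        (\<forall>x\<in>{fls_X, \<zeta>}. \<exists>b\<in>alg {fls_X, \<zeta>}. W * x = fls_X * b)"
      using W div by blast
    moreover have "fls_subdegree \<zeta> < int (Suc d)"
      using sd \<open>fls_subdegree T \<le> int j\<close> jd by simp
    ultimately show ?thesis
      using X1 \<zeta> \<zeta>0 by (intro exI[of _ fls_X] exI[of _ \<zeta>] conjI) simp_all
  next
    case True
    then have c1: "cf g d 1 \<noteq> 0" using smooth by simp
    obtain \<eta> where \<eta>: "vge 1 \<eta>" "hval fls_const (Suc d) g 1 \<eta> fls_X = 0"
      using ex_place_2[OF c0 c1] by blast
    define W where "W = (\<Sum>j\<le>d. fls_const (cf g (d - j) (Suc j)) * \<eta> ^ j)"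
    have W: "W \<in> alg {\<eta>, fls_X}" unfolding W_def by (rule poly_alg)
    have "fls_nth W 0 = cf g d 1"
    proof (cases d)
      case (Suc e)
      have "W = fls_const (cf g d 1) + \<eta> * (\<Sum>j\<le>e. fls_const (cf g (e - j) (Suc (Suc j))) * \<eta> ^ j)"
        unfolding W_def Suc by (subst sum.atMost_Suc_shift) (simp add: sum_distrib_left mult_ac)
      moreover have "vge (1 + 0) (\<eta> * (\<Sum>j\<le>e. fls_const (cf g (e - j) (Suc (Suc j))) * \<eta> ^ j))"
        by (intro vge_mult \<eta> vge_sum vge_mult0 vge_power0 vge_const vge_mono[OF \<eta>(1)]) simp
      ultimately show ?thesis by (simp add: vge_1_imp_nth0)
    qed (simp add: W_def)
    then have Wn: "fls_nth W 0 \<noteq> 0" using c1 by simp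
    have "\<eta> * W + fls_X * hval fls_const d g 1 \<eta> fls_X = 0"
      using \<eta>(2) unfolding hval_Suc top_form_1 W_def c0 by simp
    then have "W * \<eta> = fls_X * (fls_const (- 1) * hval fls_const d g 1 \<eta> fls_X)"
      by (simp add: add_eq_0_iff mult.commute)
    moreover have "fls_const (- 1) * hval fls_const d g 1 \<eta> fls_X \<in> alg {\<eta>, fls_X}"
      by (intro alg.mult alg.const hval_alg)
    moreover have "W * fls_X = fls_X * W" by simp
    ultimately have div: "\<forall>x\<in>{\<eta>, fls_X}. \<exists>b\<in>alg {\<eta>, fls_X}. W * x = fls_X * b"
      using W by blast
    \<comment> \<open>Here \<open>\<zeta>\<close> is the uniformizer, of order 1; the second point
      at infinity excludes a curve of degree 1.\<close>
    have "d \<noteq> 0" using c1 other by (metis One_nat_def)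
    moreover have "\<exists>W\<in>alg {\<eta>, fls_X}. fls_nth W 0 \<noteq> 0 \<and>
        (\<forall>x\<in>{\<eta>, fls_X}. \<exists>b\<in>alg {\<eta>, fls_X}. W * x = fls_X * b)"
      using W Wn div by blast
    ultimately show ?thesis
      using X1 \<eta> c1 by (intro exI[of _ \<eta>] exI[of _ fls_X] conjI) simp_all
  qed
qed

section \<open>Elimination and linear algebra\<close>

text \<open>Gaussian elimination: one equation is solved for an unknown \<open>i0\<close> that
  occurs in it, and both are removed.\<close>

lemma ex_kernel_vector:
  fixes m :: "'i \<Rightarrow> 'j \<Rightarrow> 'a::field"
  assumes "finite J" "finite I" "card J < card I"
  shows "\<exists>c. (\<exists>i\<in>I. c i \<noteq> 0) \<and> (\<forall>j\<in>J. (\<Sum>i\<in>I. c i * m i j) = 0)"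
  using assms
proof (induction J arbitrary: I m rule: finite_induct)
  case empty
  then have "I \<noteq> {}" by auto
  then show ?case by (intro exI[of _ "\<lambda>_. 1"]) auto
next
  case (insert j0 J)
  show ?case
  proof (cases "\<forall>i\<in>I. m i j0 = 0")
    case True
    obtain c where "\<exists>i\<in>I. c i \<noteq> 0" "\<forall>j\<in>J. (\<Sum>i\<in>I. c i * m i j) = 0"
      using insert.IH[of I m] insert.prems insert.hyps by auto
    then show ?thesis using True by (intro exI[of _ c]) auto
  next
    case False
    then obtain i0 where i0: "i0 \<in> I" "m i0 j0 \<noteq> 0" by blast
    let ?I = "I - {i0}"
    have "card J < card ?I" using insert.prems insert.hyps i0(1) by simp
    then obtain c where c: "\<exists>i\<in>?I. c i \<noteq> 0"
      "\<forall>j\<in>J. (\<Sum>i\<in>?I. c i * (m i j - m i j0 / m i0 j0 * m i0 j)) = 0"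
      using insert.IH[of ?I "\<lambda>i j. m i j - m i j0 / m i0 j0 * m i0 j"] insert.prems insert.hyps i0
      by auto
    define s where "s = - (\<Sum>i\<in>?I. c i * m i j0) / m i0 j0"
    have sum: "(\<Sum>i\<in>I. (if i = i0 then s else c i) * m i j) = s * m i0 j + (\<Sum>i\<in>?I. c i * m i j)" for j
    proof -
      have "(\<Sum>i\<in>?I. (if i = i0 then s else c i) * m i j) = (\<Sum>i\<in>?I. c i * m i j)"
        by (intro sum.cong) auto
      then show ?thesis using insert.prems(1) i0(1) by (simp add: sum.remove)
    qed
    have "s * m i0 j + (\<Sum>i\<in>?I. c i * m i j) = 0" if "j \<in> J" for j
    proof -
      have "0 = (\<Sum>i\<in>?I. c i * m i j - (c i * m i j0) * (m i0 j / m i0 j0))"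
        using c(2) that by (simp add: algebra_simps)
      also have "\<dots> = (\<Sum>i\<in>?I. c i * m i j) - (\<Sum>i\<in>?I. c i * m i j0) * (m i0 j / m i0 j0)"
        by (simp only: sum_subtractf sum_distrib_right)
      finally show ?thesis by (simp add: s_def)
    qed
    moreover have "s * m i0 j0 + (\<Sum>i\<in>?I. c i * m i j0) = 0"
      using i0(2) by (simp add: s_def)
    moreover have "\<exists>i\<in>I. (if i = i0 then s else c i) \<noteq> 0" using c(1) by auto
    ultimately show ?thesis
      by (intro exI[of _ "\<lambda>i. if i = i0 then s else c i"] conjI ballI) (auto simp: sum)
  qed
qed

text \<open>An element of least positive \<open>y\<close>-degree of the ideal generated by \<open>f\<close> and \<open>g\<close> would
  divide both up to factors from \<open>\<k>[t]\<close>, by pseudo-division.\<close>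

lemma elimination:
  fixes f g :: "'a::field poly poly"
  assumes prime: "\<And>u v. f dvd u * v \<Longrightarrow> f dvd u \<or> f dvd v" and f0: "f \<noteq> 0" and g: "\<not> f dvd g"
  shows "\<exists>u v r. r \<noteq> 0 \<and> u * f + v * g = [:r:]"
proof -
  define I where "I = {u * f + v * g |u v. True}"
  have I_f: "f \<in> I" and I_g: "g \<in> I"
    unfolding I_def by (metis (mono_tags, lifting) add_0 add_0_right mem_Collect_eq mult_1 mult_zero_left)+
  have I_diff: "x - y \<in> I" if xy: "x \<in> I" "y \<in> I" for x y
  proof -
    obtain u v u' v' where "x = u * f + v * g" "y = u' * f + v' * g"
      using xy unfolding I_def by blast
    then have "x - y = (u - u') * f + (v - v') * g" by (simp add: algebra_simps)
    then show ?thesis unfolding I_def by blast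
  qed
  have I_mult: "x * y \<in> I" if x: "x \<in> I" for x y
  proof -
    obtain u v where "x = u * f + v * g" using x unfolding I_def by blast
    then have "x * y = (u * y) * f + (v * y) * g" by (simp add: algebra_simps)
    then show ?thesis unfolding I_def by blast
  qed
  obtain h where h: "h \<in> I" "h \<noteq> 0"
    and min: "\<And>x. x \<in> I \<Longrightarrow> x \<noteq> 0 \<Longrightarrow> Polynomial.degree h \<le> Polynomial.degree x"
    using ex_has_least_nat[of "\<lambda>x. x \<in> I \<and> x \<noteq> 0" f Polynomial.degree] I_f f0 by blast
  have "Polynomial.degree h = 0"
  proof (rule ccontr)
    assume pos: "Polynomial.degree h \<noteq> 0"
    have pdiv: "\<exists>n q. [:Polynomial.lead_coeff h ^ n:] * x = h * q" if x: "x \<in> I" for x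
    proof -
      obtain q r where qr: "pseudo_divmod x h = (q, r)" by force
      from pseudo_divmod[OF h(2) qr] obtain n where
        e: "[:Polynomial.lead_coeff h ^ n:] * x = h * q + r" and
        r: "r = 0 \<or> Polynomial.degree r < Polynomial.degree h" by auto
      have "r = x * [:Polynomial.lead_coeff h ^ n:] - h * q" using e by (simp add: algebra_simps)
      then have "r \<in> I" using I_diff I_mult x h(1) by presburger
      then have "r = 0" using r min by fastforce
      then show ?thesis using e by auto
    qed
    have lc: "[:Polynomial.lead_coeff h ^ n:] \<noteq> 0" for n using h(2) by simp
    \<comment> \<open>A divisor of a nonzero polynomial in \<open>t\<close> alone has degree 0 in
      \<open>y\<close>, below the minimal positive degree of \<open>h\<close>.\<close>
    have deg0: False if "f dvd [:c:]" "c \<noteq> 0" for c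
    proof -
      have "Polynomial.degree f \<le> Polynomial.degree [:c:]"
        using that by (intro dvd_imp_degree_le) auto
      then show False using min[OF I_f f0] pos by simp
    qed
    obtain n q where q: "[:Polynomial.lead_coeff h ^ n:] * f = h * q" using pdiv[OF I_f] by blast
    obtain n' q' where q': "[:Polynomial.lead_coeff h ^ n':] * g = h * q'" using pdiv[OF I_g] by blast
    have "f dvd h * q" unfolding q[symmetric] by (rule dvd_triv_right)
    then show False
    proof (elim disjE[OF prime])
      assume "f dvd h"
      then have "f dvd [:Polynomial.lead_coeff h ^ n':] * g" unfolding q' by simp
      then have "f dvd [:Polynomial.lead_coeff h ^ n':]" using prime g by blast
      then show False using deg0[of "Polynomial.lead_coeff h ^ n'"] h(2) by simp
    next
      assume "f dvd q"
      then obtain q2 where "q = f * q2" by (elim dvdE)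
      then have "f * [:Polynomial.lead_coeff h ^ n:] = f * (h * q2)"
        using q by (simp only: ac_simps)
      then have e: "[:Polynomial.lead_coeff h ^ n:] = h * q2" using f0 mult_left_cancel by blast
      then have "q2 \<noteq> 0" using lc[of n] by (metis mult_zero_right)
      then have "Polynomial.degree (h * q2) = Polynomial.degree h + Polynomial.degree q2"
        using h(2) by (intro degree_mult_eq)
      then show False using e pos by (metis add_is_0 degree_pCons_0)
    qed
  qed
  then obtain r where r: "h = [:r:]" by (elim degree_eq_zeroE)
  then have "r \<noteq> 0" using h(2) by auto
  then show ?thesis using h(1) r unfolding I_def by (smt (verit) mem_Collect_eq)
qed

section \<open>Restriction to the lines \<open>t = c\<close>, the kernel of an expansion, and a
  Nullstellensatz\<close>

abbreviation at_t :: "'a::comm_ring_1 \<Rightarrow> 'a poly poly \<Rightarrow> 'a poly" where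
  "at_t c g \<equiv> map_poly (\<lambda>q. poly q c) g"

lemma at_t_eq_pv: "at_t c g = pv (\<lambda>q. [:poly q c:]) g [:0, 1:]"
proof -
  have "coeff_hom (\<lambda>q. [:poly q c:])" by unfold_locales (auto simp: one_pCons)
  from coeff_hom.pv_pCons[OF this] show ?thesis
    by (induction g) (simp_all add: map_poly_pCons pv_def)
qed

lemma coeff_hom_at_t: "coeff_hom (at_t c)"
proof -
  have "coeff_hom (\<lambda>q. [:poly q c:])" by unfold_locales (auto simp: one_pCons)
  from coeff_hom.coeff_hom_pv[OF this] show ?thesis unfolding at_t_eq_pv .
qed

lemma eval2_at_t: "eval2 g (c, y) = poly (at_t c g) y"
  by (induction g) (simp_all add: eval2_pCons map_poly_pCons)

lemma at_t_eq_0: "at_t c g = 0 \<Longrightarrow> [:[:- c, 1:]:] dvd g" for g :: "'a::field poly poly"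
  unfolding const_poly_dvd_iff poly_eq_0_iff_dvd[symmetric]
  by (metis coeff_0 coeff_map_poly poly_0)

lemma ev_at_t:
  assumes "coeff_hom \<kappa>"
  shows "ev \<kappa> g (\<kappa> c) y = pv \<kappa> (at_t c g) y"
proof -
  have 1: "pv \<kappa> q (\<kappa> c) = \<kappa> (poly q c)" for q
    by (induction q) (simp_all add: coeff_hom.pv_pCons[OF assms] coeff_hom.add[OF assms]
      coeff_hom.mult[OF assms] coeff_hom.zero[OF assms] coeff_hom.pv_0[OF assms])
  have 2: "coeff_hom (\<lambda>q. \<kappa> (poly q c))"
    by unfold_locales (simp_all add: coeff_hom.add[OF assms]
      coeff_hom.mult[OF assms] coeff_hom.zero[OF assms] coeff_hom.one[OF assms])
  show ?thesis unfolding ev_def 1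
    by (induction g) (simp_all add: coeff_hom.pv_pCons[OF assms] coeff_hom.pv_pCons[OF 2]
      map_poly_pCons coeff_hom.pv_0[OF assms] coeff_hom.pv_0[OF 2])
qed

text \<open>\<open>r\<close> splits into linear factors over the algebraically closed field, and one
  of them vanishes at \<open>x\<close> because Laurent series form a field.\<close>

lemma algebraic_imp_const:
  fixes r :: "'a::alg_closed_field poly" and x :: "'a fls"
  assumes "pv fls_const r x = 0" "r \<noteq> 0"
  shows "\<exists>c. x = fls_const c"
  using assms
proof (induction "Polynomial.degree r" arbitrary: r)
  case 0
  then obtain c where "r = [:c:]" by (metis degree_eq_zeroE)
  then show ?case
    using 0 by (simp add: pv_def map_poly_pCons)
next
  case (Suc n)
  then obtain c where "poly r c = 0" using alg_closed_imp_poly_has_root[of r] by auto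
  then obtain q where q: "r = [:- c, 1:] * q" by (auto simp: poly_eq_0_iff_dvd elim: dvdE)
  then have q0: "q \<noteq> 0" using Suc.prems by auto
  then have "Polynomial.degree r = Suc (Polynomial.degree q)"
    unfolding q by (subst degree_mult_eq) auto
  then have dq: "n = Polynomial.degree q" using Suc.hyps(2) by simp
  have "(x - fls_const c) * pv fls_const q x = 0"
    using Suc.prems(1) unfolding q coeff_hom.pv_mult[OF coeff_hom_fls_const]
    by (simp add: pv_def map_poly_pCons)
  then show ?case using Suc.hyps(1)[OF dq _ q0] by auto
qed

text \<open>By elimination, a further relation \<open>g\<close> would make \<open>T\<close>
  algebraic, hence a constant \<open>c\<close>. Then \<open>Y\<close> is transcendental, so
  \<open>f\<close> and \<open>g\<close> both vanish on the line \<open>t = c\<close>, and the prime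
  \<open>f\<close> is \<open>t - c\<close> up to a unit.\<close>

lemma ev_kernel:
  fixes f :: "'a::alg_closed_field poly poly"
  assumes prime: "\<And>u v. f dvd u * v \<Longrightarrow> f dvd u \<or> f dvd v" and f0: "f \<noteq> 0"
    and zero: "ev fls_const f T Y = 0"
    and nonconst: "\<And>c d. \<not> (T = fls_const c \<and> Y = fls_const d)"
  shows "ev fls_const g T Y = 0 \<longleftrightarrow> f dvd g"
proof
  note h = coeff_hom_fls_const[where 'a = 'a]
  assume "f dvd g"
  then show "ev fls_const g T Y = 0" using zero by (auto simp: coeff_hom.ev_mult[OF h])
next
  note h = coeff_hom_fls_const[where 'a = 'a]
  assume g: "ev fls_const g T Y = 0"
  show "f dvd g"
  proof (rule ccontr)
    assume nd: "\<not> f dvd g"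
    obtain u v r where r: "r \<noteq> 0" "u * f + v * g = [:r:]"
      using elimination[OF prime f0 nd] by blast
    have "ev fls_const (u * f + v * g) T Y = 0"
      by (simp add: coeff_hom.ev_add[OF h] coeff_hom.ev_mult[OF h] zero g)
    then have "pv fls_const r T = 0"
      unfolding r by (simp add: ev_def pv_def map_poly_pCons)
    then obtain c where T: "T = fls_const c" using algebraic_imp_const r(1) by blast
    have e: "pv fls_const (at_t c f) Y = 0" "pv fls_const (at_t c g) Y = 0"
      using zero g unfolding T ev_at_t[OF h] by auto
    then have z: "at_t c f = 0" "at_t c g = 0"
      using algebraic_imp_const nonconst T by blast+
    let ?l = "[:[:- c, 1:]:]"
    obtain f' g' where f': "f = ?l * f'" and g': "g = ?l * g'" using at_t_eq_0 z by (metis dvdE)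
    have "\<not> f dvd f'"
    proof
      assume "f dvd f'"
      then obtain s where "f' = f * s" by (elim dvdE)
      then have "f * (?l * s) = f * 1" using f' by (metis mult.commute mult.left_commute mult_1)
      then have "?l dvd 1" using f0 by (metis dvd_triv_left mult_cancel_left)
      then show False by (simp add: is_unit_pCons_iff is_unit_poly_iff)
    qed
    then have "f dvd ?l" using prime[of ?l f'] f' by auto
    then show False using nd g' by (metis dvd_mult2)
  qed
qed

lemma poly_ideal_no_zero:
  fixes J :: "'a::alg_closed_field poly set"
  assumes diff: "\<And>x y. x \<in> J \<Longrightarrow> y \<in> J \<Longrightarrow> x - y \<in> J" and mult: "\<And>x y. x \<in> J \<Longrightarrow> x * y \<in> J"
    and zeros: "\<And>c. \<exists>q\<in>J. poly q c \<noteq> 0"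
  shows "1 \<in> J"
proof -
  obtain q0 where "q0 \<in> J" "q0 \<noteq> 0" using zeros[of 0] by force
  then obtain d where d: "d \<in> J" "d \<noteq> 0"
    and min: "\<And>x. x \<in> J \<Longrightarrow> x \<noteq> 0 \<Longrightarrow> Polynomial.degree d \<le> Polynomial.degree x"
    using ex_has_least_nat[of "\<lambda>x. x \<in> J \<and> x \<noteq> 0" q0 Polynomial.degree] by blast
  have dvd: "d dvd x" if "x \<in> J" for x
  proof -
    have "x mod d = x - d * (x div d)" by (simp add: minus_mult_div_eq_mod)
    then have "x mod d \<in> J" using diff mult that d(1) by metis
    then have "x mod d = 0" using min degree_mod_less[OF d(2), of x] by fastforce
    then show ?thesis by (simp add: mod_eq_0_iff_dvd)
  qed
  have "Polynomial.degree d = 0"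
  proof (rule ccontr)
    assume "Polynomial.degree d \<noteq> 0"
    then obtain c where c: "poly d c = 0" using alg_closed_imp_poly_has_root by blast
    obtain q where "q \<in> J" "poly q c \<noteq> 0" using zeros by blast
    then show False using dvd[of q] c by auto
  qed
  then obtain a where a: "d = [:a:]" by (elim degree_eq_zeroE)
  then have "d * [:1 / a:] = 1" using d(2) by (simp add: one_pCons)
  then show ?thesis using mult[OF d(1)] by metis
qed

text \<open>Elimination yields a nonzero polynomial \<open>r\<close> in \<open>t\<close> alone that
  lies in \<open>I\<close>. A root \<open>c\<close> of \<open>r\<close> can be removed: on the line
  \<open>t = c\<close> the ideal restricts to the unit ideal of \<open>k[y]\<close>, so
  \<open>I\<close> contains some \<open>1 + (t - c) * s\<close>.\<close>

lemma nullstellensatz_curve: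
  fixes f :: "'a::alg_closed_field poly poly"
  assumes prime: "\<And>u v. f dvd u * v \<Longrightarrow> f dvd u \<or> f dvd v" and f0: "f \<noteq> 0"
    and diff: "\<And>x y. x \<in> I \<Longrightarrow> y \<in> I \<Longrightarrow> x - y \<in> I" and mult: "\<And>x y. x \<in> I \<Longrightarrow> x * y \<in> I"
    and f: "f \<in> I" "\<exists>x. eval2 f x = 0" and zeros: "\<And>x. \<exists>g\<in>I. eval2 g x \<noteq> 0"
  shows "1 \<in> I"
proof -
  obtain x where x: "eval2 f x = 0" using f(2) by blast
  obtain g where g: "g \<in> I" "eval2 g x \<noteq> 0" using zeros by blast
  then have "\<not> f dvd g" using x by (auto simp: eval2_mult)
  then obtain u v r where r: "r \<noteq> 0" "u * f + v * g = [:r:]"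
    using elimination[OF prime f0] by blast
  have "u * f + v * g = g * v - f * (- u)" by (simp add: algebra_simps)
  also have "\<dots> \<in> I" by (intro diff mult f g)
  finally have "[:r:] \<in> I" unfolding r .
  then show ?thesis using r(1)
  proof (induction "Polynomial.degree r" arbitrary: r)
    case 0
    then obtain a where a: "r = [:a:]" by (metis degree_eq_zeroE)
    then have "[:r:] * [:[:1 / a:]:] = 1" using 0 by (simp add: one_pCons)
    then show ?case using mult 0 by metis
  next
    case (Suc n)
    then obtain c where "poly r c = 0" using alg_closed_imp_poly_has_root[of r] by auto
    then obtain q where q: "r = [:- c, 1:] * q" by (auto simp: poly_eq_0_iff_dvd elim: dvdE)
    then have q0: "q \<noteq> 0" using Suc.prems by auto
    then have "Polynomial.degree r = Suc (Polynomial.degree q)"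
      unfolding q by (subst degree_mult_eq) auto
    then have dq: "n = Polynomial.degree q" using Suc.hyps(2) by simp
    note ah = coeff_hom_at_t[of c]
    have "1 \<in> at_t c ` I"
    proof (rule poly_ideal_no_zero)
      fix x y assume "x \<in> at_t c ` I" "y \<in> at_t c ` I"
      then obtain z w where zw: "z \<in> I" "w \<in> I" "x = at_t c z" "y = at_t c w" by blast
      then have "x - y = at_t c (z - w)" by (simp only: coeff_hom.diff[OF ah])
      then show "x - y \<in> at_t c ` I" using diff[OF zw(1,2)] by (rule image_eqI)
    next
      fix x y assume "x \<in> at_t c ` I"
      then obtain z where z: "z \<in> I" "x = at_t c z" by blast
      have "at_t c (map_poly (\<lambda>a. [:a:]) y) = y"
        by (simp add: map_poly_map_poly o_def)
      then have "x * y = at_t c (z * map_poly (\<lambda>a. [:a:]) y)"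
        by (simp only: coeff_hom.mult[OF ah] z(2))
      then show "x * y \<in> at_t c ` I" using mult[OF z(1)] by (rule image_eqI)
    next
      fix y
      obtain g where "g \<in> I" "eval2 g (c, y) \<noteq> 0" using zeros by blast
      then show "\<exists>q\<in>at_t c ` I. poly q y \<noteq> 0" by (auto simp: eval2_at_t)
    qed
    then obtain g where g: "g \<in> I" "at_t c g = 1" by auto
    then have "at_t c (g - 1) = 0" by (simp add: coeff_hom.diff[OF ah] coeff_hom.one[OF ah])
    then obtain s where "g - 1 = [:[:- c, 1:]:] * s" using at_t_eq_0 by (metis dvdE)
    then have s: "g = 1 + [:[:- c, 1:]:] * s" by (simp add: algebra_simps)
    have "[:r:] = [:[:- c, 1:]:] * [:q:]" using q by simp
    then have "[:q:] = g * [:q:] - [:r:] * s" unfolding s by (simp only:) (simp add: algebra_simps)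
    then have "[:q:] \<in> I" using diff[OF mult[OF g(1)] mult[OF Suc.prems(1)]] by metis
    then show ?case using Suc.hyps(1)[OF dq _ q0] by blast
  qed
qed

subsection \<open>Functions of low degree with a zero at the place\<close>

text \<open>\<open>t^i * y^(d-i)\<close> is the leading monomial for the order by total degree, with
  ties broken by the exponent of \<open>t\<close>.\<close>

lemma ex_total_degree:
  assumes "g \<noteq> 0"
  shows "\<exists>d i. tdeg_le d g \<and> i \<le> d \<and> cf g i (d - i) \<noteq> 0 \<and> (\<forall>i'. i < i' \<and> i' \<le> d \<longrightarrow> cf g i' (d - i') = 0)"
proof -
  define d where "d = (LEAST d. tdeg_le d g)"
  have d: "tdeg_le d g" unfolding d_def using ex_tdeg_le by (rule LeastI_ex)
  have ex: "\<exists>i\<le>d. cf g i (d - i) \<noteq> 0"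
  proof (rule ccontr)
    assume *: "\<not> (\<exists>i\<le>d. cf g i (d - i) \<noteq> 0)"
    have lt: "i + j < d" if "cf g i j \<noteq> 0" for i j
    proof -
      have "i + j \<le> d" using d that unfolding tdeg_le_def by blast
      moreover have "i + j \<noteq> d" using * that by (metis add_diff_cancel_left' le_add1)
      ultimately show ?thesis by simp
    qed
    have "\<exists>i j. cf g i j \<noteq> 0" using assms by (metis coeff_0 poly_eqI)
    then have "d > 0" using lt by fastforce
    moreover have "tdeg_le (d - 1) g" unfolding tdeg_le_def using lt by fastforce
    then have "d \<le> d - 1" unfolding d_def by (rule Least_le)
    ultimately show False by simp
  qed
  define i where "i = (GREATEST i. i \<le> d \<and> cf g i (d - i) \<noteq> 0)"
  have i: "i \<le> d \<and> cf g i (d - i) \<noteq> 0"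
    unfolding i_def by (rule GreatestI_ex_nat[where b = d]) (use ex in auto)
  have "cf g i' (d - i') = 0" if "i < i'" "i' \<le> d" for i'
  proof (rule ccontr)
    assume "cf g i' (d - i') \<noteq> 0"
    then have "i' \<le> i" unfolding i_def using that by (intro Greatest_le_nat[where b = d]) auto
    then show False using that by simp
  qed
  then show ?thesis using d i by blast
qed

text \<open>Leading monomials multiply: in any other pair of monomials with the same product, one
  exceeds the leading monomial of its factor.\<close>

lemma cf_mult_top:
  fixes f q :: "'a::field poly poly"
  assumes f: "tdeg_le d f" "a \<le> d" "\<And>i. a < i \<Longrightarrow> i \<le> d \<Longrightarrow> cf f i (d - i) = 0"
    and q: "tdeg_le e q" "b \<le> e" "\<And>i. b < i \<Longrightarrow> i \<le> e \<Longrightarrow> cf q i (e - i) = 0"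
  shows "cf (f * q) (a + b) (d - a + (e - b)) = cf f a (d - a) * cf q b (e - b)"
proof -
  let ?i = "a + b" and ?j = "d - a + (e - b)"
  have z: "cf f i j * cf q (?i - i) (?j - j) = 0"
    if ij: "i \<le> ?i" "j \<le> ?j" "i \<noteq> a \<or> j \<noteq> d - a" for i j
  proof (cases "i + j = d")
    case True
    then have j: "j = d - i" by simp
    then have "i \<noteq> a" using ij(3) by auto
    show ?thesis
    proof (cases "a < i")
      case True
      then show ?thesis using f(3)[of i] \<open>i + j = d\<close> j by simp
    next
      case False
      then have *: "b < ?i - i" using \<open>i \<noteq> a\<close> by simp
      have **: "?i - i + (?j - j) = e" using True f(2) q(2) ij by linarith
      then have "cf q (?i - i) (e - (?i - i)) = 0" using * by (intro q(3)) auto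
      moreover have "?j - j = e - (?i - i)" using ** by simp
      ultimately show ?thesis by simp
    qed
  next
    case False
    show ?thesis
    proof (cases "i + j > d")
      case True
      then show ?thesis using tdeg_leD[OF f(1)] by simp
    next
      case False
      then have "?i - i + (?j - j) > e" using \<open>i + j \<noteq> d\<close> f(2) q(2) ij by linarith
      then show ?thesis using tdeg_leD[OF q(1)] by simp
    qed
  qed
  have "cf (f * q) ?i ?j = (\<Sum>j\<le>?j. \<Sum>i\<le>?i. if j = d - a \<and> i = a then cf f a (d - a) * cf q b (e - b) else 0)"
    unfolding cf_mult
  proof (intro sum.cong refl)
    fix j i assume "j \<in> {..?j}" "i \<in> {..?i}"
    then show "cf f i j * cf q (?i - i) (?j - j)
        = (if j = d - a \<and> i = a then cf f a (d - a) * cf q b (e - b) else 0)"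
      using z[of i j] by auto
  qed
  also have "\<dots> = (\<Sum>j\<le>?j. if j = d - a then cf f a (d - a) * cf q b (e - b) else 0)"
    by (intro sum.cong refl) auto
  also have "\<dots> = cf f a (d - a) * cf q b (e - b)" by simp
  finally show ?thesis .
qed

text \<open>The monomials of degree at most \<open>n\<close> which are not divisible by the leading monomial
  of \<open>f\<close> are linearly independent modulo \<open>f\<close>. If \<open>n\<close> is large, there are more of them than
  conditions for a zero at the place, because the pole orders are at most \<open>n * i\<close> with \<open>i < d\<close>.\<close>

lemma ex_zero_at_place:
  fixes f :: "'a::alg_closed_field poly poly" and T Y :: "'a fls"
  assumes kernel: "\<And>g. ev fls_const g T Y = 0 \<longleftrightarrow> f dvd g"
    and f: "f \<noteq> 0" "tdeg_le d f" "i0 \<le> d" "cf f i0 (d - i0) \<noteq> 0"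
    and pole: "\<And>n g. tdeg_le n g \<Longrightarrow> vge (- int (n * i)) (ev fls_const g T Y)" and "i < d"
  shows "\<exists>g. ev fls_const g T Y \<noteq> 0 \<and> vge 1 (ev fls_const g T Y)"
proof -
  note h = coeff_hom_fls_const[where 'a = 'a]
  obtain d' a where d': "tdeg_le d' f" "a \<le> d'" "cf f a (d' - a) \<noteq> 0"
    and a: "\<And>i'. a < i' \<and> i' \<le> d' \<Longrightarrow> cf f i' (d' - i') = 0"
    using ex_total_degree[OF f(1)] by metis
  have "d' = d"
  proof (rule antisym)
    show "d' \<le> d" using f(2) d'(2,3) unfolding tdeg_le_def by (metis le_add_diff_inverse)
    show "d \<le> d'" using d'(1) f(3,4) unfolding tdeg_le_def by (metis le_add_diff_inverse)
  qed
  note a = a[unfolded \<open>d' = d\<close>] and d' = d'[unfolded \<open>d' = d\<close>]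
  \<comment> \<open>There are \<open>d * (n - d)\<close> monomials in \<open>M\<close> and at most
    \<open>n * (d - 1) + 1\<close> conditions, so any \<open>n > d * d + 1\<close> with
    \<open>n \<ge> d\<close> would do; with this choice \<open>n - d\<close> is
    \<open>d * d + 2\<close>.\<close>
  define n where "n = d * d + d + 2"
  \<comment> \<open>Two strips of exponents: the exponent of \<open>t\<close> is below
    \<open>a\<close>, or that of \<open>y\<close> is below \<open>d - a\<close>. Both stay within
    total degree \<open>n\<close>.\<close>
  define M where "M = {..<a} \<times> {..<n - d} \<union> {a..<a + (n - d)} \<times> {..<d - a}"
  have "card M = a * (n - d) + (n - d) * (d - a)"
    unfolding M_def by (subst card_Un_disjoint) (auto simp: card_cartesian_product)
  also have "\<dots> = d * (n - d)" using d'(2) by (metis add_mult_distrib le_add_diff_inverse mult.commute)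
  finally have cM: "card M = d * (d * d + 2)" by (simp add: n_def)
  define J where "J = {- int (n * i)..0}"
  have cJ: "card J = n * i + 1" by (simp add: J_def nat_add_distrib nat_mult_distrib)
  have "n * i + 1 < d * (d * d + 2)"
  proof -
    have "n * i \<le> n * (d - 1)" using \<open>i < d\<close> by (intro mult_left_mono) auto
    moreover have "n * (d - 1) + 1 < d * (d * d + 2)"
      using \<open>i < d\<close> by (cases d) (simp_all add: n_def algebra_simps)
    ultimately show ?thesis by linarith
  qed
  then have "card J < card M" using cM cJ by simp
  moreover have "finite M" "finite J" by (simp_all add: M_def J_def)
  ultimately obtain c where c: "\<exists>p\<in>M. c p \<noteq> 0"
    "\<And>k. k \<in> J \<Longrightarrow> (\<Sum>p\<in>M. c p * fls_nth (T ^ fst p * Y ^ snd p) k) = 0"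
    using ex_kernel_vector[of J M "\<lambda>p k. fls_nth (T ^ fst p * Y ^ snd p) k"] by blast
  define g where "g = (\<Sum>p\<in>M. cconst (c p) * tvar ^ fst p * yvar ^ snd p)"
  have mon: "cf (cconst b * tvar ^ i * yvar ^ j) i' j' = (if i' = i \<and> j' = j then b else 0)" for b :: 'a and i j i' j'
  proof -
    have "cconst b * tvar ^ i * yvar ^ j = Polynomial.monom (Polynomial.monom b i) j"
    proof -
      have "[:Polynomial.monom b i:] = cconst b * tvar ^ i"
        by (induction i) (simp_all add: monom_0 monom_Suc poly_const_pow)
      then show ?thesis
        by (induction j) (simp_all add: monom_0 monom_Suc algebra_simps)
    qed
    then show ?thesis by simp
  qed
  have cg: "cf g i j = (if (i, j) \<in> M then c (i, j) else 0)" for i j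
  proof -
    have "cf g i j = (\<Sum>p\<in>M. if p = (i, j) then c (i, j) else 0)"
      unfolding g_def coeff_sum mon by (intro sum.cong) auto
    then show ?thesis using \<open>finite M\<close> by simp
  qed
  have "tdeg_le n g"
    unfolding tdeg_le_def cg using d'(2) by (auto simp: M_def n_def split: if_splits)
  have "fls_nth (ev fls_const g T Y) k = 0" if "k < 1" for k
  proof (cases "k \<in> J")
    case True
    have "ev fls_const g T Y = (\<Sum>p\<in>M. fls_const (c p) * (T ^ fst p * Y ^ snd p))"
      unfolding g_def by (simp only: coeff_hom.ev_sum[OF h] coeff_hom.ev_mult[OF h]
        coeff_hom.ev_power[OF h] coeff_hom.ev_cconst[OF h] coeff_hom.ev_tvar[OF h]
        coeff_hom.ev_yvar[OF h] mult.assoc)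
    then show ?thesis using c(2)[OF True] by (simp add: fls_nth_sum)
  next
    case False
    then have "k < - int (n * i)" using that by (auto simp: J_def)
    then show ?thesis using pole[OF \<open>tdeg_le n g\<close>] by (simp add: vge_iff)
  qed
  then have "vge 1 (ev fls_const g T Y)" by (simp add: vge_iff)
  moreover have "\<not> f dvd g"
  proof
    assume "f dvd g"
    then obtain q where q: "g = f * q" by (elim dvdE)
    have "g \<noteq> 0" using c(1) cg by (metis coeff_0 surj_pair)
    then have "q \<noteq> 0" using q by auto
    then obtain e b where e: "tdeg_le e q" "b \<le> e" "cf q b (e - b) \<noteq> 0"
      and b: "\<And>i'. b < i' \<and> i' \<le> e \<Longrightarrow> cf q i' (e - i') = 0"
      using ex_total_degree by metis
    \<comment> \<open>A nonzero multiple of \<open>f\<close> contains a monomial divisible by the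
      leading monomial of \<open>f\<close>, and \<open>M\<close> has none.\<close>
    have "cf g (a + b) (d - a + (e - b)) = cf f a (d - a) * cf q b (e - b)"
      unfolding q by (rule cf_mult_top) (use d' a e b in auto)
    then have "cf g (a + b) (d - a + (e - b)) \<noteq> 0" using d' e by simp
    then have "(a + b, d - a + (e - b)) \<in> M" unfolding cg by metis
    then show False by (auto simp: M_def)
  qed
  ultimately show ?thesis using kernel by blast
qed

section \<open>The coordinate ring of a curve with a place at infinity\<close>

lemma (in fls_subalgebra) ev_mem:
  assumes "x \<in> S" "y \<in> S"
  shows "ev fls_const g x y \<in> S"
proof -
  obtain d where d: "tdeg_le d g" using ex_tdeg_le by blast
  show ?thesis unfolding coeff_hom.ev_tri[OF coeff_hom_fls_const d]
    by (intro sum) (auto intro!: mult const power assms)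
qed

text \<open>In the basis \<open>(a, b)\<close>, \<open>(a', b')\<close> of the line at infinity,
  \<open>[1:\<eta>:\<zeta>]\<close> is the moving point of the curve near
  \<open>p = [a:b:0]\<close>. The second point at infinity is reflected in the bound on the order of
  \<open>\<zeta>\<close>, and \<open>smooth\<close> says that the uniformizer divides both
  coordinates once the unit \<open>W\<close> is inverted.\<close>

locale curve_place =
  fixes f :: "'a::alg_closed_field poly poly" and d :: nat and a b a' b' :: 'a and \<eta> \<zeta> :: "'a fls"
  assumes prime: "\<And>u v. f dvd u * v \<Longrightarrow> f dvd u \<or> f dvd v" and f0: "f \<noteq> 0"
    and deg: "tdeg_le d f" and top: "\<exists>i\<le>d. cf f i (d - i) \<noteq> 0"
    and det: "a * b' - a' * b \<noteq> 0"
    and \<eta>: "vge 1 \<eta>" and \<zeta>: "vge 1 \<zeta>" "\<zeta> \<noteq> 0" "fls_subdegree \<zeta> < int d"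
    and place: "hval fls_const d (lin a b a' b' f) 1 \<eta> \<zeta> = 0"
    and unif: "fls_X \<in> {\<eta>, \<zeta>}"
    and smooth: "\<exists>W\<in>alg {\<eta>, \<zeta>}. fls_nth W 0 \<noteq> 0 \<and>
      (\<forall>x\<in>{\<eta>, \<zeta>}. \<exists>b\<in>alg {\<eta>, \<zeta>}. W * x = fls_X * b)"
begin

definition T :: "'a fls" where "T = fls_const a * (1 / \<zeta>) + fls_const a' * (\<eta> / \<zeta>)"
definition Y :: "'a fls" where "Y = fls_const b * (1 / \<zeta>) + fls_const b' * (\<eta> / \<zeta>)"
definition \<phi> :: "'a poly poly \<Rightarrow> 'a fls" where "\<phi> g = ev fls_const g T Y"
text \<open>\<open>l\<close> and \<open>l'\<close> invert the linear substitution by Cramer's rule;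
  their expansions are \<open>1 / \<zeta>\<close> and \<open>\<eta> / \<zeta>\<close>.\<close>

definition l :: "'a poly poly" where
  "l = cconst (b' / (a * b' - a' * b)) * tvar - cconst (a' / (a * b' - a' * b)) * yvar"
definition l' :: "'a poly poly" where
  "l' = cconst (a / (a * b' - a' * b)) * yvar - cconst (b / (a * b' - a' * b)) * tvar"

lemma hom: "coeff_hom \<phi>"
  unfolding \<phi>_def by (intro coeff_hom_ev coeff_hom_fls_const)

lemma \<phi>_const: "\<phi> (cconst c) = fls_const c" and \<phi>_t: "\<phi> tvar = T" and \<phi>_y: "\<phi> yvar = Y"
  unfolding \<phi>_def
  by (simp_all only: coeff_hom.ev_cconst[OF coeff_hom_fls_const]
    coeff_hom.ev_tvar[OF coeff_hom_fls_const] coeff_hom.ev_yvar[OF coeff_hom_fls_const])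

lemmas \<phi>_add = coeff_hom.add[OF hom] and \<phi>_mult = coeff_hom.mult[OF hom]
  and \<phi>_diff = coeff_hom.diff[OF hom] and \<phi>_power = coeff_hom.power[OF hom]
  and \<phi>_1 = coeff_hom.one[OF hom]

lemma \<phi>_l: "\<phi> l = 1 / \<zeta>" and \<phi>_l': "\<phi> l' = \<eta> / \<zeta>"
proof -
  let ?D = "a * b' - a' * b"
  have D: "fls_const (x / ?D) = fls_const x / fls_const ?D" for x
    by (simp add: fls_const_divide_const)
  have D0: "fls_const ?D \<noteq> 0" using det by simp
  have Dc: "fls_const ?D = fls_const a * fls_const b' - fls_const a' * fls_const b"
    by (simp add: fls_minus_const)
  have "\<phi> l = (fls_const b' * T - fls_const a' * Y) / fls_const ?D"
    unfolding l_def \<phi>_diff \<phi>_mult \<phi>_const \<phi>_t \<phi>_y D by (simp add: diff_divide_distrib)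
  also have "fls_const b' * T - fls_const a' * Y = fls_const ?D * (1 / \<zeta>)"
    unfolding T_def Y_def Dc by (simp only: algebra_simps)
  finally show "\<phi> l = 1 / \<zeta>" using D0 by simp
  have "\<phi> l' = (fls_const a * Y - fls_const b * T) / fls_const ?D"
    unfolding l'_def \<phi>_diff \<phi>_mult \<phi>_const \<phi>_t \<phi>_y D by (simp add: diff_divide_distrib)
  also have "fls_const a * Y - fls_const b * T = fls_const ?D * (\<eta> / \<zeta>)"
    unfolding T_def Y_def Dc by (simp only: algebra_simps)
  finally show "\<phi> l' = \<eta> / \<zeta>" using D0 by simp
qed

lemma tdeg_l: "tdeg_le 1 l" "tdeg_le 1 l'"
proof -
  have *: "tdeg_le 1 (cconst x * tvar + cconst y * yvar)" for x y :: 'a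
    using tdeg_le_mult[OF tdeg_le_cconst[of 0] tdeg_le_tvar]
      tdeg_le_mult[OF tdeg_le_cconst[of 0] tdeg_le_yvar]
    by (metis tdeg_le_add add_0)
  have "l = cconst (b' / (a * b' - a' * b)) * tvar + cconst (- (a' / (a * b' - a' * b))) * yvar"
    "l' = cconst (- (b / (a * b' - a' * b))) * tvar + cconst (a / (a * b' - a' * b)) * yvar"
    by (simp_all add: l_def l'_def)
  then show "tdeg_le 1 l" "tdeg_le 1 l'" using * by presburger+
qed

text \<open>The factor \<open>\<zeta> ^ n\<close> clears the pole of a polynomial of degree at most
  \<open>n\<close> and turns its expansion into the value of the degree \<open>n\<close> form at
  \<open>[1:\<eta>:\<zeta>]\<close>.\<close>

lemma \<phi>_hval:
  assumes "tdeg_le n g"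
  shows "\<zeta> ^ n * \<phi> g = hval fls_const n (lin a b a' b' g) 1 \<eta> \<zeta>"
proof -
  have "\<phi> g = ev fls_const (lin a b a' b' g) (1 / \<zeta>) (\<eta> / \<zeta>)"
    unfolding ev_lin[OF coeff_hom_fls_const] \<phi>_def T_def Y_def ..
  then show ?thesis
    using hval_ev[OF coeff_hom_fls_const tdeg_le_lin[OF assms] \<zeta>(2), of a b a' b' 1 \<eta>] by simp
qed

lemma \<eta>0: "vge 0 \<eta>" and \<zeta>0: "vge 0 \<zeta>"
  using \<eta> \<zeta>(1) by (auto intro: vge_mono)

lemma vge_\<phi>: "tdeg_le n g \<Longrightarrow> vge 0 (\<zeta> ^ n * \<phi> g)"
  by (simp add: \<phi>_hval vge_hval \<eta>0 \<zeta>0)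

lemma residue_\<phi>: "tdeg_le n g \<Longrightarrow> fls_nth (\<zeta> ^ n * \<phi> g) 0 = cf (lin a b a' b' g) n 0"
  by (simp add: \<phi>_hval hval_1_residue[OF \<eta> \<zeta>(1)])

lemma sd_\<zeta>: "fls_subdegree \<zeta> \<ge> 1"
  using \<zeta> by (auto simp: vge_def)

lemma pole: "tdeg_le n g \<Longrightarrow> vge (- int (n * nat (fls_subdegree \<zeta>))) (\<phi> g)"
  using vge_\<phi>[of n g] \<zeta>(2) sd_\<zeta> unfolding vge_def by (cases "\<phi> g = 0") (auto simp: fls_subdegree_pow)

lemma kernel: "\<phi> g = 0 \<longleftrightarrow> f dvd g"
  unfolding \<phi>_def
proof (rule ev_kernel[OF prime f0])
  show "ev fls_const f T Y = 0"
    using \<phi>_hval[OF deg] place \<zeta>(2) by (simp add: \<phi>_def)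
  fix c c' show "\<not> (T = fls_const c \<and> Y = fls_const c')"
  proof
    assume "T = fls_const c \<and> Y = fls_const c'"
    then have "\<phi> l = fls_const (b' / (a * b' - a' * b) * c - a' / (a * b' - a' * b) * c')"
      unfolding l_def \<phi>_diff \<phi>_mult \<phi>_const \<phi>_t \<phi>_y by (simp add: fls_minus_const)
    then have "fls_subdegree (\<phi> l) = 0" by simp
    then show False using sd_\<zeta> \<zeta>(2) unfolding \<phi>_l by (simp add: fls_divide_subdegree)
  qed
qed

sublocale place_algebra "range \<phi>"
proof unfold_locales
  show "fls_const c \<in> range \<phi>" for c using \<phi>_const by (metis rangeI)
  show "x + y \<in> range \<phi>" "x * y \<in> range \<phi>" if "x \<in> range \<phi>" "y \<in> range \<phi>" for x y
    using that by (auto simp flip: \<phi>_add \<phi>_mult)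
  obtain i0 where i0: "i0 \<le> d" "cf f i0 (d - i0) \<noteq> 0" using top by blast
  have "nat (fls_subdegree \<zeta>) < d" using \<zeta>(3) sd_\<zeta> by linarith
  with ex_zero_at_place[OF kernel[unfolded \<phi>_def] f0 deg i0 pole[unfolded \<phi>_def]]
  obtain g where "\<phi> g \<noteq> 0" "vge 1 (\<phi> g)" unfolding \<phi>_def by blast
  then show "\<exists>u\<in>range \<phi>. fls_subdegree u > 0"
    by (intro bexI[of _ "\<phi> g"]) (auto simp: vge_def)
  have sl: "fls_subdegree (1 / \<zeta>) = - fls_subdegree \<zeta>" "1 / \<zeta> \<noteq> 0"
    using \<zeta>(2) by (simp_all add: fls_divide_subdegree)
  have r: "1 / \<zeta> \<in> range \<phi>" "\<eta> / \<zeta> \<in> range \<phi>" "1 \<in> range \<phi>"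
    using \<phi>_l \<phi>_l' \<phi>_1 by (metis rangeI)+
  show "\<exists>w\<in>range \<phi>. fls_subdegree w < 0"
    using r(1) sl(1) sd_\<zeta> by (intro bexI[of _ "1 / \<zeta>"]) simp_all
  show "\<exists>x\<in>range \<phi>. \<exists>y\<in>range \<phi>. x \<noteq> 0 \<and> y \<noteq> 0 \<and> fls_subdegree x = fls_subdegree y + 1"
  proof (cases "\<eta> = fls_X")
    case True
    then have "\<eta> / \<zeta> \<noteq> 0" "fls_subdegree (\<eta> / \<zeta>) = fls_subdegree (1 / \<zeta>) + 1"
      using \<zeta>(2) by (simp_all add: fls_divide_subdegree)
    then show ?thesis using r sl by blast
  next
    case False
    then have "\<zeta> = fls_X" using unif by simp
    then have "fls_subdegree 1 = fls_subdegree (1 / \<zeta>) + 1" using sl by simp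
    then show ?thesis using r sl by (metis zero_neq_one)
  qed
qed

text \<open>The local ring of the curve at the place is a localization of \<open>\<k>[\<eta>, \<zeta>]\<close>: by smoothness
  a high power of the uniformizer can be split off numerator and denominator.\<close>

lemma local_fraction:
  assumes "g1 \<in> range \<phi>" "g2 \<in> range \<phi>" "g2 \<noteq> 0" "vge (fls_subdegree g2) g1"
  shows "\<exists>h1\<in>alg {\<eta>, \<zeta>}. \<exists>h2\<in>alg {\<eta>, \<zeta>}. fls_nth h2 0 \<noteq> 0 \<and> g1 * h2 = h1 * g2"
proof -
  let ?O = "alg {\<eta>, \<zeta>}"
  interpret O: fls_subalgebra ?O by (rule fls_subalgebra_alg)
  have gen: "\<eta> \<in> ?O" "\<zeta> \<in> ?O" by (auto intro: alg.incl)
  have E: "vge 0 x" if "x \<in> {\<eta>, \<zeta>}" for x using that \<eta>0 \<zeta>0 by auto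
  obtain p1 p2 where p: "g1 = \<phi> p1" "g2 = \<phi> p2" using assms by blast
  obtain n1 n2 where n: "tdeg_le n1 p1" "tdeg_le n2 p2" using ex_tdeg_le by blast
  define n where "n = n1 + n2"
  have n: "tdeg_le n p1" "tdeg_le n p2" unfolding n_def using n by (auto intro: tdeg_le_mono)
  define x1 where "x1 = \<zeta> ^ n * g1"
  define x2 where "x2 = \<zeta> ^ n * g2"
  have x: "x1 \<in> ?O" "x2 \<in> ?O"
    unfolding x1_def x2_def p \<phi>_hval[OF n(1)] \<phi>_hval[OF n(2)]
    by (auto intro!: O.hval_mem gen O.one)
  have x2: "x2 \<noteq> 0" using assms(3) \<zeta>(2) by (simp add: x2_def)
  define N where "N = nat (fls_subdegree x2)"
  have N: "int N = fls_subdegree x2"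
    using vge_alg[OF E x(2)] x2 by (simp add: N_def vge_def)
  have "vge (int N) x1"
    using assms(3,4) \<zeta>(2) unfolding N x1_def x2_def vge_def by (cases "g1 = 0") auto
  obtain W where W: "W \<in> ?O" "fls_nth W 0 \<noteq> 0" "\<And>x. x \<in> {\<eta>, \<zeta>} \<Longrightarrow> \<exists>b\<in>?O. W * x = fls_X * b"
    using smooth by blast
  have X: "fls_X \<in> ?O" "fls_X \<noteq> (0 :: 'a fls)" "fls_subdegree (fls_X :: 'a fls) = 1"
    using curve_place.unif[OF curve_place_axioms] gen by auto
  obtain b1 where b1: "b1 \<in> ?O" "W ^ N * x1 = fls_X ^ N * b1"
    using alg_power_divisible[OF E W(1,2) X W(3) x(1) \<open>vge (int N) x1\<close>] by blast
  obtain b2 where b2: "b2 \<in> ?O" "W ^ N * x2 = fls_X ^ N * b2"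
    using alg_power_divisible[OF E W(1,2) X W(3) x(2), of N] N by (auto simp: vge_def)
  note W0 = fls_nth0_nonzero[OF vge_alg[OF E W(1)] W(2)]
  have "W ^ N * x2 \<noteq> 0" using W0(1) x2 by simp
  then have "b2 \<noteq> 0" unfolding b2 by auto
  have "int N = int N + fls_subdegree b2"
    using arg_cong[OF b2(2), of fls_subdegree] W0 x2 \<open>b2 \<noteq> 0\<close> N by (simp add: fls_subdegree_pow)
  then have "fls_nth b2 0 \<noteq> 0" using nth_fls_subdegree_nonzero[OF \<open>b2 \<noteq> 0\<close>] by simp
  moreover have "g1 * b2 = b1 * g2"
  proof -
    have "(fls_X ^ N * \<zeta> ^ n) * (g1 * b2) = x1 * (fls_X ^ N * b2)"
      unfolding x1_def by (simp only: ac_simps)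
    also have "\<dots> = (W ^ N * x1) * x2" unfolding b2(2)[symmetric] by (simp only: ac_simps)
    also have "\<dots> = (fls_X ^ N * \<zeta> ^ n) * (b1 * g2)"
      unfolding b1(2) x2_def by (simp only: ac_simps)
    finally show ?thesis using \<zeta>(2) by simp
  qed
  ultimately show ?thesis using b1 b2 by blast
qed

text \<open>\<open>\<eta>\<close> and \<open>\<zeta>\<close> need not lie in
  \<open>range \<phi>\<close>. If \<open>c\<close> in \<open>range \<phi>\<close> has the order of
  \<open>\<zeta>\<close>, then multiplication by the unit \<open>c / \<zeta>\<close> turns them into
  \<open>c * \<eta> / \<zeta>\<close> and \<open>c\<close>, which do. Powers of this unit transform
  the fractions of \<open>local_fraction\<close> into fractions over \<open>alg ?E\<close>.\<close>

lemma finitely_generated_place: "\<exists>E. finite E \<and> alg E = {x \<in> range \<phi>. vge 0 x}"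
proof -
  obtain c where c: "c \<in> range \<phi>" "c \<noteq> 0" "fls_subdegree c = fls_subdegree \<zeta>"
    using ex_value by blast
  let ?E = "{c, c / \<zeta>, c * \<eta> / \<zeta>}"
  interpret E: fls_subalgebra "alg ?E" by (rule fls_subalgebra_alg)
  have "c / \<zeta> = c * \<phi> l" "c * \<eta> / \<zeta> = c * \<phi> l'" unfolding \<phi>_l \<phi>_l' by auto
  then have ES: "?E \<subseteq> range \<phi>" using c(1) by (auto intro!: mult)
  have cz: "vge 0 (c / \<zeta>)" using c \<zeta>(2) by (simp add: vge_def fls_divide_subdegree)
  have czn: "fls_nth (c / \<zeta>) 0 \<noteq> 0"
    using nth_fls_subdegree_nonzero[of "c / \<zeta>"] c \<zeta>(2) by (simp add: fls_divide_subdegree)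
  have Ev: "vge 0 x" if "x \<in> ?E" for x
    using that cz vge_mult0[OF cz \<eta>0] c sd_\<zeta> by (auto simp: vge_def)
  have gen: "(c / \<zeta>) ^ 1 * x \<in> alg ?E" if "x \<in> {\<eta>, \<zeta>}" for x
    using that \<zeta>(2) by (auto intro: alg.incl)
  have cE: "c / \<zeta> \<in> alg ?E" by (auto intro: alg.incl)
  show ?thesis
  proof (rule finitely_generated[of "{T, Y}" ?E])
    show "{T, Y} \<subseteq> range \<phi>" using \<phi>_t \<phi>_y by (metis empty_subsetI insert_subset rangeI)
    show "range \<phi> \<subseteq> alg {T, Y}"
    proof safe
      fix g
      interpret TY: fls_subalgebra "alg {T, Y}" by (rule fls_subalgebra_alg)
      show "\<phi> g \<in> alg {T, Y}" unfolding \<phi>_def by (intro TY.ev_mem alg.incl) auto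
    qed
    fix g1 g2 assume g: "g1 \<in> range \<phi>" "g2 \<in> range \<phi>" "g2 \<noteq> 0" "vge (fls_subdegree g2) g1"
    obtain h1 h2 where h: "h1 \<in> alg {\<eta>, \<zeta>}" "h2 \<in> alg {\<eta>, \<zeta>}" "fls_nth h2 0 \<noteq> 0" "g1 * h2 = h1 * g2"
      using local_fraction[OF g] by blast
    obtain m1 where m1: "(c / \<zeta>) ^ m1 * h1 \<in> alg ?E"
      using clear_denominators[OF fls_subalgebra_alg cE gen h(1)] by blast
    obtain m2 where m2: "(c / \<zeta>) ^ m2 * h2 \<in> alg ?E"
      using clear_denominators[OF fls_subalgebra_alg cE gen h(2)] by blast
    let ?b = "(c / \<zeta>) ^ m2 * ((c / \<zeta>) ^ m1 * h1)" and ?s = "(c / \<zeta>) ^ m1 * ((c / \<zeta>) ^ m2 * h2)"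
    have "?b \<in> alg ?E" "?s \<in> alg ?E" by (intro E.mult E.power cE m1 m2)+
    moreover have "fls_nth ?s 0 \<noteq> 0"
    proof -
      have h2: "vge 0 h2" using vge_alg[OF _ h(2)] \<eta>0 \<zeta>0 by auto
      have "fls_nth ((c / \<zeta>) ^ k * y) 0 \<noteq> 0 \<and> vge 0 ((c / \<zeta>) ^ k * y)"
        if "fls_nth y 0 \<noteq> 0" "vge 0 y" for k y
      proof (induction k)
        case (Suc k)
        have "(c / \<zeta>) ^ Suc k * y = (c / \<zeta>) * ((c / \<zeta>) ^ k * y)" by (simp only: power_Suc ac_simps)
        moreover have "fls_nth ((c / \<zeta>) * ((c / \<zeta>) ^ k * y)) 0
            = fls_nth (c / \<zeta>) 0 * fls_nth ((c / \<zeta>) ^ k * y) 0"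
          using Suc fls_nth_mult_0[OF cz] by blast
        moreover have "vge 0 ((c / \<zeta>) * ((c / \<zeta>) ^ k * y))"
          using Suc vge_mult0[OF cz] by blast
        ultimately show ?case using czn Suc by (metis mult_eq_0_iff)
      qed (use that in simp)
      then show ?thesis using h(3) h2 by blast
    qed
    moreover have "g1 * ?s = ?b * g2"
    proof -
      have "g1 * ?s = (c / \<zeta>) ^ m1 * (c / \<zeta>) ^ m2 * (g1 * h2)" by (simp only: ac_simps)
      also have "\<dots> = ?b * g2" unfolding h(4) by (simp only: ac_simps)
      finally show ?thesis .
    qed
    ultimately show "\<exists>b\<in>alg ?E. \<exists>s\<in>alg ?E. fls_nth s 0 \<noteq> 0 \<and> g1 * s = b * g2" by blast
  qed (use ES Ev in auto)
qed

text \<open>Since \<open>\<eta> = \<zeta> * \<phi> l'\<close>, polynomials in \<open>\<eta>\<close>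
  and \<open>\<zeta>\<close> are forms divided by a power of the linear form \<open>l\<close>. As
  \<open>\<zeta> * \<phi> l = 1\<close>, factors \<open>l\<close> bring two summands to a common
  degree.\<close>

lemma alg_as_forms:
  assumes "x \<in> alg {\<eta>, \<zeta>}"
  shows "\<exists>n g. tdeg_le n g \<and> x = \<zeta> ^ n * \<phi> g"
  using assms
proof (induction rule: alg.induct)
  case (const c)
  then show ?case by (intro exI[of _ 0] exI[of _ "cconst c"]) (simp add: tdeg_le_cconst \<phi>_const)
next
  case (incl x)
  then consider "x = \<eta>" | "x = \<zeta>" by blast
  then show ?case
  proof cases
    case 1
    then have "x = \<zeta> ^ 1 * \<phi> l'" using \<zeta>(2) by (simp add: \<phi>_l')
    then show ?thesis using tdeg_l(2) by blast
  next
    case 2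
    then have "x = \<zeta> ^ 1 * \<phi> (cconst 1)" using \<phi>_const[of 1] by simp
    then show ?thesis using tdeg_le_cconst by blast
  qed
next
  case (add x y)
  then obtain n g m h where *: "tdeg_le n g" "x = \<zeta> ^ n * \<phi> g" "tdeg_le m h" "y = \<zeta> ^ m * \<phi> h"
    by blast
  have "tdeg_le (n + m) (g * l ^ m + h * l ^ n)"
    using tdeg_le_mult[OF *(1) tdeg_le_power[OF tdeg_l(1), of m]]
      tdeg_le_mult[OF *(3) tdeg_le_power[OF tdeg_l(1), of n]]
    by (intro tdeg_le_add) (simp_all add: add.commute)
  moreover have "x + y = \<zeta> ^ (n + m) * \<phi> (g * l ^ m + h * l ^ n)"
    unfolding * \<phi>_add \<phi>_mult \<phi>_power \<phi>_l using \<zeta>(2)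
    by (simp add: power_add power_divide distrib_left)
  ultimately show ?case by blast
next
  case (mult x y)
  then obtain n g m h where *: "tdeg_le n g" "x = \<zeta> ^ n * \<phi> g" "tdeg_le m h" "y = \<zeta> ^ m * \<phi> h"
    by blast
  have "x * y = \<zeta> ^ (n + m) * \<phi> (g * h)"
    unfolding * \<phi>_mult by (simp add: power_add)
  then show ?case using tdeg_le_mult[OF *(1,3)] by blast
qed

text \<open>The condition on the coefficient says that the degree \<open>n\<close> form of
  \<open>g2\<close> does not vanish at \<open>p\<close>, so the right side is regularity at
  \<open>p\<close> by quotients of forms of equal degree. Such a denominator is a unit at the
  place.\<close>

lemma vge_0_iff_quotient:
  "vge 0 (\<phi> g) \<longleftrightarrow> (\<exists>n g1 g2. tdeg_le n g1 \<and> tdeg_le n g2 \<and> cf (lin a b a' b' g2) n 0 \<noteq> 0 \<and>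
    \<phi> g * \<phi> g2 = \<phi> g1)" (is "?L \<longleftrightarrow> ?R")
proof
  assume ?L
  then obtain h1 h2 where h: "h1 \<in> alg {\<eta>, \<zeta>}" "h2 \<in> alg {\<eta>, \<zeta>}" "fls_nth h2 0 \<noteq> 0" "\<phi> g * h2 = h1"
    using local_fraction[of "\<phi> g" 1] one by auto
  obtain n1 p1 n2 p2 where p: "tdeg_le n1 p1" "h1 = \<zeta> ^ n1 * \<phi> p1" "tdeg_le n2 p2" "h2 = \<zeta> ^ n2 * \<phi> p2"
    using alg_as_forms h(1,2) by meson
  have t1: "tdeg_le (n1 + n2) (p1 * l ^ n2)" and t2: "tdeg_le (n1 + n2) (p2 * l ^ n1)"
    using tdeg_le_mult[OF p(1) tdeg_le_power[OF tdeg_l(1), of n2]]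
      tdeg_le_mult[OF p(3) tdeg_le_power[OF tdeg_l(1), of n1]] by (simp_all add: add.commute)
  have e1: "\<zeta> ^ (n1 + n2) * \<phi> (p1 * l ^ n2) = h1" and e2: "\<zeta> ^ (n1 + n2) * \<phi> (p2 * l ^ n1) = h2"
    unfolding p(2,4) \<phi>_mult \<phi>_power \<phi>_l using \<zeta>(2) by (simp_all add: power_add power_divide)
  have "cf (lin a b a' b' (p2 * l ^ n1)) (n1 + n2) 0 \<noteq> 0"
    using residue_\<phi>[OF t2] h(3) unfolding e2 by simp
  moreover have "\<zeta> ^ (n1 + n2) * (\<phi> g * \<phi> (p2 * l ^ n1)) = \<zeta> ^ (n1 + n2) * \<phi> (p1 * l ^ n2)"
    unfolding e1 using h(4) e2 by (metis mult.left_commute)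
  then have "\<phi> g * \<phi> (p2 * l ^ n1) = \<phi> (p1 * l ^ n2)" using \<zeta>(2) by simp
  ultimately show ?R using t1 t2 by blast
next
  assume ?R
  then obtain n g1 g2 where g: "tdeg_le n g1" "tdeg_le n g2" "cf (lin a b a' b' g2) n 0 \<noteq> 0"
    "\<phi> g * \<phi> g2 = \<phi> g1" by blast
  let ?x = "\<zeta> ^ n * \<phi> g2"
  have x: "?x \<noteq> 0" "fls_subdegree ?x = 0"
    using fls_nth0_nonzero[OF vge_\<phi>[OF g(2)]] residue_\<phi>[OF g(2)] g(3) by auto
  have e: "\<phi> g * ?x = \<zeta> ^ n * \<phi> g1" unfolding g(4)[symmetric] by (simp only: ac_simps)
  have "vge 0 (\<phi> g * ?x)" unfolding e by (rule vge_\<phi>[OF g(1)])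
  moreover have "fls_subdegree (\<phi> g * ?x) = fls_subdegree (\<phi> g)" if "\<phi> g \<noteq> 0"
    using fls_subdegree_mult[OF that x(1)] x(2) by (simp only: add_0_right)
  ultimately show ?L using x(1) unfolding vge_def by (metis mult_eq_0_iff)
qed

end

section \<open>Coordinates have poles\<close>

definition left_inverse_pair where
  "left_inverse_pair U V F G \<longleftrightarrow> ev cconst U F G = tvar \<and> ev cconst V F G = yvar"

lemma coeff_hom_pconst: "coeff_hom (\<lambda>c::'a::comm_ring_1. [:c:])"
  by unfold_locales (simp_all add: one_pCons)

lemma at_t_cconst: "at_t l (cconst c) = [:c:]" and at_t_tvar: "at_t l tvar = [:l:]"
  and at_t_yvar: "at_t l yvar = [:0, 1:]"
  by (simp_all add: map_poly_pCons)

lemma at_t_ev: "at_t l (ev cconst g F G) = ev (\<lambda>c. [:c:]) g (at_t l F) (at_t l G)"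
  using hom_ev[OF coeff_hom_cconst coeff_hom_at_t, of l g F G] by (simp add: at_t_cconst)

text \<open>If \<open>b\<close> is the degree of \<open>q\<close>, then
  \<open>1, v, ..., v ^ b\<close> are dependent modulo \<open>q\<close>. So some nonzero
  \<open>r\<close> of degree at most \<open>b\<close> has \<open>r(V)\<close> in the ideal of
  \<open>U - l\<close> and \<open>t - \<mu>\<close>. Substituting \<open>F\<close> and
  \<open>G\<close> on the line \<open>t = l\<close> turns \<open>V\<close> into \<open>y\<close> and
  kills \<open>U - l\<close>, so \<open>F(l, y) - \<mu>\<close> divides \<open>r\<close>.\<close>

lemma fibre_degree_le:
  fixes U V F G :: "'a::alg_closed_field poly poly"
  assumes inv: "left_inverse_pair U V F G" and q: "at_t \<mu> U - [:l:] \<noteq> 0"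
  shows "at_t l F - [:\<mu>:] \<noteq> 0"
    "Polynomial.degree (at_t l F - [:\<mu>:]) \<le> Polynomial.degree (at_t \<mu> U - [:l:])"
proof -
  note hc = coeff_hom_cconst[where 'a = 'a] and am = coeff_hom_at_t[of \<mu>]
  define q where "q = at_t \<mu> U - [:l:]"
  define b where "b = Polynomial.degree q"
  have q0: "q \<noteq> 0" using assms(2) by (simp add: q_def)
  define v where "v = at_t \<mu> V"
  obtain c where c: "\<exists>k\<in>{..b}. c k \<noteq> 0"
    "\<And>j. j \<in> {..<b} \<Longrightarrow> (\<Sum>k\<le>b. c k * Polynomial.coeff (v ^ k mod q) j) = 0"
    using ex_kernel_vector[of "{..<b}" "{..b}" "\<lambda>k j. Polynomial.coeff (v ^ k mod q) j"] by auto
  define r where "r = (\<Sum>k\<le>b. [:c k:] * [:0, 1:] ^ k)"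
  have cr: "Polynomial.coeff r k = (if k \<le> b then c k else 0)" for k
  proof -
    have "r = (\<Sum>k\<le>b. Polynomial.monom (c k) k)"
      unfolding r_def by (simp add: monom_altdef)
    then show ?thesis by (auto simp: coeff_sum)
  qed
  have r: "r \<noteq> 0" "Polynomial.degree r \<le> b"
    using c(1) cr by (metis atMost_iff coeff_0, simp add: Polynomial.degree_le cr)
  have sum0: "(\<Sum>k\<le>b. [:c k:] * (v ^ k mod q)) = 0"
  proof (rule poly_eqI)
    fix j
    have "Polynomial.coeff (v ^ k mod q) j = 0" if "j \<ge> b" for k
    proof (cases "v ^ k mod q = 0")
      case False
      then have "Polynomial.degree (v ^ k mod q) < b"
        using degree_mod_less[OF q0, of "v ^ k"] by (simp add: b_def)
      then show ?thesis using that by (intro coeff_eq_0) simp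
    qed simp
    then show "Polynomial.coeff (\<Sum>k\<le>b. [:c k:] * (v ^ k mod q)) j = Polynomial.coeff 0 j"
      using c(2)[of j] by (cases "j < b") (simp_all add: coeff_sum)
  qed
  have "q dvd (\<Sum>k\<le>b. [:c k:] * (v ^ k - v ^ k mod q))"
    by (intro dvd_sum dvd_mult dvd_minus_mod)
  also have "\<dots> = (\<Sum>k\<le>b. [:c k:] * v ^ k) - (\<Sum>k\<le>b. [:c k:] * (v ^ k mod q))"
    by (simp only: right_diff_distrib sum_subtractf)
  finally have "q dvd (\<Sum>k\<le>b. [:c k:] * v ^ k)" unfolding sum0 by simp
  then obtain s where s: "(\<Sum>k\<le>b. [:c k:] * v ^ k) = q * s" by (elim dvdE)
  define R where "R = (\<Sum>k\<le>b. cconst (c k) * V ^ k)"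
  define s' where "s' = map_poly (\<lambda>a. [:a:]) s"
  have s': "at_t \<mu> s' = s" by (simp add: s'_def map_poly_map_poly o_def)
  have "at_t \<mu> R = q * s"
    unfolding R_def coeff_hom.sum[OF am] coeff_hom.mult[OF am] coeff_hom.power[OF am] at_t_cconst
      v_def[symmetric] s ..
  then have "at_t \<mu> (R - (U - cconst l) * s') = 0"
    unfolding coeff_hom.diff[OF am] coeff_hom.mult[OF am] s' at_t_cconst by (simp add: q_def)
  then have "[:[:- \<mu>, 1:]:] dvd R - (U - cconst l) * s'" by (rule at_t_eq_0)
  then obtain w where w: "R - (U - cconst l) * s' = [:[:- \<mu>, 1:]:] * w" by (elim dvdE)
  have tm: "[:[:- \<mu>, 1:]:] = tvar - cconst \<mu>" by simp
  define E where "E g = at_t l (ev cconst g F G)" for g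
  have E: "coeff_hom E" unfolding E_def at_t_ev by (intro coeff_hom_ev coeff_hom_pconst)
  have EU: "E U = [:l:]" and EV: "E V = [:0, 1:]"
    using inv unfolding left_inverse_pair_def E_def by (simp_all only: at_t_tvar at_t_yvar)
  have Ec: "E (cconst x) = [:x:]" and Et: "E tvar = at_t l F" for x
    unfolding E_def by (simp_all only: coeff_hom.ev_cconst[OF hc] coeff_hom.ev_tvar[OF hc] at_t_cconst)
  have "E (R - (U - cconst l) * s') = E R"
    unfolding coeff_hom.diff[OF E] coeff_hom.mult[OF E] EU Ec by simp
  also have "E R = r"
    unfolding R_def r_def coeff_hom.sum[OF E] coeff_hom.mult[OF E] coeff_hom.power[OF E] Ec EV ..
  finally have "r = (at_t l F - [:\<mu>:]) * E w"
    unfolding w coeff_hom.mult[OF E] tm coeff_hom.diff[OF E] Ec Et by simp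
  then have dv: "at_t l F - [:\<mu>:] dvd r" by (metis dvd_triv_left)
  then show "at_t l F - [:\<mu>:] \<noteq> 0" using r(1) by auto
  show "Polynomial.degree (at_t l F - [:\<mu>:]) \<le> Polynomial.degree (at_t \<mu> U - [:l:])"
    using dvd_imp_degree_le[OF dv r(1)] r(2) by (simp add: b_def q_def)
qed

lemma coeff_at_t: "Polynomial.coeff (at_t l F) j = poly (Polynomial.coeff F j) l"
  by (simp add: coeff_map_poly)

text \<open>The leading coefficient is a polynomial in \<open>t\<close> without roots, hence a
  constant.\<close>

lemma constant_lead_coeff:
  fixes F :: "'a::alg_closed_field poly poly"
  assumes "\<And>l. Polynomial.degree (at_t l F) = n" "n \<ge> 1"
  shows "Polynomial.degree F = n" "\<exists>c. c \<noteq> 0 \<and> Polynomial.lead_coeff F = [:c:]"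
proof -
  have z: "Polynomial.coeff F j = 0" if "j > n" for j
  proof (rule poly_eq_0_cofinite[of "{}"])
    fix l
    show "poly (Polynomial.coeff F j) l = 0"
      using that assms(1)[of l] by (simp add: coeff_eq_0 flip: coeff_at_t)
  qed simp
  have nz: "poly (Polynomial.coeff F n) l \<noteq> 0" for l
  proof -
    have "at_t l F \<noteq> 0" using assms(1)[of l] assms(2) by auto
    then show ?thesis using assms(1)[of l] by (simp flip: coeff_at_t) (metis leading_coeff_0_iff)
  qed
  then have "Polynomial.degree (Polynomial.coeff F n) = 0"
    using alg_closed_imp_poly_has_root by (metis neq0_conv)
  then obtain c where c: "Polynomial.coeff F n = [:c:]" by (elim degree_eq_zeroE)
  then have "c \<noteq> 0" using nz[of 0] by auto
  show dg: "Polynomial.degree F = n"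
  proof (rule antisym)
    show "Polynomial.degree F \<le> n" using z by (intro Polynomial.degree_le) auto
    show "n \<le> Polynomial.degree F" using nz[of 0] by (intro le_degree) auto
  qed
  show "\<exists>c. c \<noteq> 0 \<and> Polynomial.lead_coeff F = [:c:]" using c \<open>c \<noteq> 0\<close> dg by auto
qed

text \<open>Both degrees are the dimension of \<open>\<k>[x, y] / (x - l, F - \<mu>) = \<k>[X, Y] / (U - l, X - \<mu>)\<close>, for
  arbitrary \<open>l\<close> and \<open>\<mu>\<close>.\<close>

lemma inverse_pair_degrees:
  fixes U V F G :: "'a::alg_closed_field poly poly"
  assumes inv: "left_inverse_pair U V F G" "left_inverse_pair F G U V"
    and l: "Polynomial.degree (at_t l F) \<ge> 1"
  shows "Polynomial.degree U = Polynomial.degree F" "Polynomial.degree F \<ge> 1"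
    "\<exists>c. c \<noteq> 0 \<and> Polynomial.lead_coeff F = [:c:]" "\<exists>c. c \<noteq> 0 \<and> Polynomial.lead_coeff U = [:c:]"
proof -
  define n where "n = Polynomial.degree (at_t l F)"
  have dc: "Polynomial.degree (x - [:c:]) = Polynomial.degree x" if "Polynomial.degree x \<ge> 1" for x :: "'a poly" and c
    unfolding diff_conv_add_uminus by (rule degree_add_eq_left) (use that in simp)
  have dc': "Polynomial.degree x = Polynomial.degree (x - [:c:])"
    if "Polynomial.degree (x - [:c:]) \<ge> 1" for x :: "'a poly" and c
  proof -
    have e: "x - [:c:] - [:- c:] = x" by (rule poly_eqI) (simp add: coeff_pCons split: nat.split)
    show ?thesis using dc[OF that, of "- c"] unfolding e .
  qed
  \<comment> \<open>The two inequalities at the same pair of \<open>l\<close> and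
    \<open>\<mu>\<close> give equality. Letting \<open>\<mu>\<close> vary shows that the fibre
    degree of \<open>U\<close> never drops, and exchanging the roles gives the same for
    \<open>F\<close>.\<close>
  have U: "Polynomial.degree (at_t \<mu> U) = n" for \<mu>
  proof -
    have p: "Polynomial.degree (at_t l F - [:\<mu>:]) = n" using dc[OF l] by (simp add: n_def)
    then have p0: "at_t l F - [:\<mu>:] \<noteq> 0" using l n_def by auto
    note 1 = fibre_degree_le[OF inv(2) p0]
    note 2 = fibre_degree_le(2)[OF inv(1) 1(1)]
    have "Polynomial.degree (at_t \<mu> U - [:l:]) = n" using 1(2) 2 p by simp
    then show ?thesis using dc'[of "at_t \<mu> U" l] l by (simp add: n_def)
  qed
  have n1: "n \<ge> 1" using l n_def by simp
  have F: "Polynomial.degree (at_t l' F) = n" for l'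
  proof -
    have p: "Polynomial.degree (at_t 0 U - [:l':]) = n" using dc[of "at_t 0 U"] U n1 by simp
    then have p0: "at_t 0 U - [:l':] \<noteq> 0" using n1 by auto
    note 1 = fibre_degree_le[OF inv(1) p0]
    note 2 = fibre_degree_le(2)[OF inv(2) 1(1)]
    have "Polynomial.degree (at_t l' F - [:0:]) = n" using 1(2) 2 p by simp
    then show ?thesis using dc'[of "at_t l' F" 0] n1 by simp
  qed
  show "Polynomial.degree U = Polynomial.degree F" "Polynomial.degree F \<ge> 1"
    "\<exists>c. c \<noteq> 0 \<and> Polynomial.lead_coeff F = [:c:]" "\<exists>c. c \<noteq> 0 \<and> Polynomial.lead_coeff U = [:c:]"
    using constant_lead_coeff[OF U n1] constant_lead_coeff[OF F n1] n1 by simp_all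
qed

section \<open>Orders of polynomial expressions, and degrees in a semigroup\<close>

lemma fls_subalgebra_vge: "fls_subalgebra {x :: 'a::field fls. vge 0 x}"
  by unfold_locales (auto intro: vge_add vge_mult0)

lemma subdegree_dominant:
  assumes "x \<noteq> 0" "vge (fls_subdegree x + 1) y"
  shows "fls_subdegree (x + y) = fls_subdegree x"
  using assms by (intro fls_subdegree_eqI) (auto simp: vge_iff)

text \<open>The top power of \<open>\<theta>\<close> has a strictly deeper pole than the other
  terms: its coefficient is a nonzero constant and theirs are regular.\<close>

lemma subdegree_ev:
  fixes F :: "'a::alg_closed_field poly poly"
  assumes \<gamma>: "vge 0 \<gamma>" and \<theta>: "fls_subdegree \<theta> < 0"
    and lc: "c \<noteq> 0" "Polynomial.lead_coeff F = [:c:]"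
  shows "fls_subdegree (ev fls_const F \<gamma> \<theta>) = int (Polynomial.degree F) * fls_subdegree \<theta>"
proof -
  note h = coeff_hom_fls_const[where 'a = 'a]
  define n where "n = Polynomial.degree F"
  have pv: "vge 0 (pv fls_const q \<gamma>)" for q
  proof -
    interpret v: fls_subalgebra "{x :: 'a fls. vge 0 x}" by (rule fls_subalgebra_vge)
    have "pv fls_const q \<gamma> \<in> {x. vge 0 x}"
      unfolding coeff_hom.pv_sum[OF h order_refl] using \<gamma>
      by (intro v.sum v.mult v.const v.power) auto
    then show ?thesis by simp
  qed
  have "ev fls_const F \<gamma> \<theta> = (\<Sum>j\<le>n. pv fls_const (Polynomial.coeff F j) \<gamma> * \<theta> ^ j)"
    unfolding ev_def by (subst coeff_hom.pv_sum[OF coeff_hom.coeff_hom_pv[OF h]]) (simp_all add: n_def)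
  also have "\<dots> = fls_const c * \<theta> ^ n + (\<Sum>j<n. pv fls_const (Polynomial.coeff F j) \<gamma> * \<theta> ^ j)"
    using lc(2) by (simp add: n_def lessThan_Suc_atMost[symmetric] pv_def map_poly_pCons)
  also have "fls_subdegree \<dots> = fls_subdegree (fls_const c * \<theta> ^ n)"
  proof (rule subdegree_dominant)
    have th: "\<theta> \<noteq> 0" using \<theta> by auto
    show "fls_const c * \<theta> ^ n \<noteq> 0" using lc th by simp
    have sd: "fls_subdegree (fls_const c * \<theta> ^ n) = int n * fls_subdegree \<theta>"
      using lc th by (simp add: fls_subdegree_pow)
    show "vge (fls_subdegree (fls_const c * \<theta> ^ n) + 1)
        (\<Sum>j<n. pv fls_const (Polynomial.coeff F j) \<gamma> * \<theta> ^ j)"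
      unfolding sd
    proof (rule vge_sum)
      fix j assume "j \<in> {..<n}"
      then have "int j + 1 \<le> int n" by simp
      then have "int n * fls_subdegree \<theta> \<le> (int j + 1) * fls_subdegree \<theta>"
        using \<theta> by (intro mult_right_mono_neg) auto
      then have "int n * fls_subdegree \<theta> + 1 \<le> int j * fls_subdegree \<theta>"
        using \<theta> by (simp add: algebra_simps)
      moreover have "vge (int j * fls_subdegree \<theta>) (\<theta> ^ j)" by (rule vge_power) (simp add: vge_def)
      ultimately show "vge (int n * fls_subdegree \<theta> + 1) (pv fls_const (Polynomial.coeff F j) \<gamma> * \<theta> ^ j)"
        using vge_mult0[OF pv] vge_mono by blast
    qed
  qed
  also have "\<dots> = int n * fls_subdegree \<theta>"
    using lc \<theta> by (subst fls_subdegree_mult) (auto simp: fls_subdegree_pow)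
  finally show ?thesis by (simp add: n_def)
qed

lemma degree_sum_distinct:
  fixes h :: "nat \<Rightarrow> 'a::field poly"
  assumes "(\<Sum>j<n. h j) \<noteq> 0"
    and inj: "\<And>i j. i < n \<Longrightarrow> j < n \<Longrightarrow> h i \<noteq> 0 \<Longrightarrow> h j \<noteq> 0 \<Longrightarrow>
      Polynomial.degree (h i) = Polynomial.degree (h j) \<Longrightarrow> i = j"
  shows "\<exists>j<n. h j \<noteq> 0 \<and> Polynomial.degree (\<Sum>j<n. h j) = Polynomial.degree (h j)"
proof -
  let ?N = "{j. j < n \<and> h j \<noteq> 0}"
  have "?N \<noteq> {}" using assms(1) by (metis (mono_tags, lifting) empty_Collect_eq lessThan_iff sum.neutral)
  then have fin: "finite ((\<lambda>j. Polynomial.degree (h j)) ` ?N)" "(\<lambda>j. Polynomial.degree (h j)) ` ?N \<noteq> {}"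
    by auto
  then obtain j where j: "j < n" "h j \<noteq> 0"
    and max: "Polynomial.degree (h j) = Max ((\<lambda>j. Polynomial.degree (h j)) ` ?N)"
    using Max_in[OF fin] by force
  have le: "Polynomial.degree (h i) \<le> Polynomial.degree (h j)" if "i < n" "h i \<noteq> 0" for i
    unfolding max using fin that by (intro Max_ge) auto
  have lt: "Polynomial.coeff (h i) (Polynomial.degree (h j)) = 0" if "i < n" "i \<noteq> j" for i
  proof (cases "h i = 0")
    case False
    then have "Polynomial.degree (h i) < Polynomial.degree (h j)"
      using le[OF that(1) False] inj[OF that(1) j(1) False j(2)] that(2) by linarith
    then show ?thesis by (rule coeff_eq_0)
  qed simp
  have "Polynomial.coeff (\<Sum>j<n. h j) (Polynomial.degree (h j))
      = (\<Sum>i<n. if i = j then Polynomial.lead_coeff (h j) else 0)"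
    unfolding coeff_sum using lt by (intro sum.cong) auto
  then have "Polynomial.coeff (\<Sum>j<n. h j) (Polynomial.degree (h j)) \<noteq> 0" using j by simp
  then have "Polynomial.degree (h j) \<le> Polynomial.degree (\<Sum>j<n. h j)" by (rule le_degree)
  moreover have "Polynomial.degree (\<Sum>j<n. h j) \<le> Polynomial.degree (h j)"
  proof (rule degree_sum_le)
    fix i assume "i \<in> {..<n}"
    then show "Polynomial.degree (h i) \<le> Polynomial.degree (h j)" using le[of i] by (cases "h i = 0") auto
  qed simp
  ultimately show ?thesis using j by auto
qed

text \<open>The relation \<open>U\<close> allows to write every element of \<open>\<k>[p, q]\<close> as \<open>\<Sum>j<n. c\<^sub>j(p) q\<^sup>j\<close>, whose degree
  lies in the semigroup generated by \<open>n\<close> and \<open>n - 1\<close>.\<close>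

lemma no_linear_element:
  fixes U V :: "'a::field poly poly" and p q :: "'a poly"
  assumes U: "ev (\<lambda>c. [:c:]) U p q = 0" "c \<noteq> 0" "Polynomial.lead_coeff U = [:c:]"
    and V: "ev (\<lambda>c. [:c:]) V p q = [:0, 1:]"
    and deg: "Polynomial.degree U = n" "Polynomial.degree p = n" "Polynomial.degree q = n - 1" "n \<ge> 3"
  shows False
proof -
  note h = coeff_hom_pconst[where 'a = 'a]
  have U0: "U \<noteq> 0" using deg(1,4) by auto
  \<comment> \<open>The leading coefficient of \<open>U\<close> is the constant \<open>c\<close>, so
    dividing \<open>V\<close> by \<open>U\<close> only costs a power of \<open>c\<close>.\<close>
  obtain s r where sr: "pseudo_divmod V U = (s, r)" by force
  from pseudo_divmod[OF U0 sr] U(3) obtain k where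
    e: "Polynomial.smult ([:c:] ^ k) V = U * s + r" and r: "r = 0 \<or> Polynomial.degree r < n"
    unfolding deg(1) by auto
  have "cconst (c ^ k) * V = U * s + r" using e by (simp add: poly_const_pow)
  then have "[:c ^ k:] * [:0, 1:] = ev (\<lambda>c. [:c:]) r p q"
    using arg_cong[of "cconst (c ^ k) * V" "U * s + r" "\<lambda>g. ev (\<lambda>c. [:c:]) g p q"]
    unfolding coeff_hom.ev_mult[OF h] coeff_hom.ev_add[OF h] coeff_hom.ev_cconst[OF h] U(1) V by simp
  also have "\<dots> = (\<Sum>j\<le>n - 1. pv (\<lambda>c. [:c:]) (Polynomial.coeff r j) p * q ^ j)"
    unfolding ev_def
    by (subst coeff_hom.pv_sum[OF coeff_hom.coeff_hom_pv[OF h]]) (use r deg(4) in auto)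
  also have "\<dots> = (\<Sum>j<n. pcompose (Polynomial.coeff r j) p * q ^ j)"
    using deg(4) by (intro sum.cong) (auto simp: pcompose_altdef pv_def)
  finally have s: "[:c ^ k:] * [:0, 1:] = (\<Sum>j<n. pcompose (Polynomial.coeff r j) p * q ^ j)" .
  have q0: "q \<noteq> 0" using deg(3,4) by auto
  have dh: "Polynomial.degree (pcompose (Polynomial.coeff r j) p * q ^ j)
      = Polynomial.degree (Polynomial.coeff r j) * n + (n - 1) * j"
    if "pcompose (Polynomial.coeff r j) p * q ^ j \<noteq> 0" for j
    using that by (subst degree_mult_eq) (auto simp: degree_pcompose degree_power_eq deg)
  have "\<exists>j<n. pcompose (Polynomial.coeff r j) p * q ^ j \<noteq> 0 \<and>
      Polynomial.degree (\<Sum>j<n. pcompose (Polynomial.coeff r j) p * q ^ j)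
      = Polynomial.degree (pcompose (Polynomial.coeff r j) p * q ^ j)"
  proof (rule degree_sum_distinct)
    show "(\<Sum>j<n. pcompose (Polynomial.coeff r j) p * q ^ j) \<noteq> 0" unfolding s[symmetric] using U(2) by simp
    fix i j assume ij: "i < n" "j < n" "pcompose (Polynomial.coeff r i) p * q ^ i \<noteq> 0"
      "pcompose (Polynomial.coeff r j) p * q ^ j \<noteq> 0"
      "Polynomial.degree (pcompose (Polynomial.coeff r i) p * q ^ i) =
       Polynomial.degree (pcompose (Polynomial.coeff r j) p * q ^ j)"
    define x y where "x = Polynomial.degree (Polynomial.coeff r i)" "y = Polynomial.degree (Polynomial.coeff r j)"
    have "x * n + (n - 1) * i = y * n + (n - 1) * j"
      using ij(5) unfolding dh[OF ij(3)] dh[OF ij(4)] x_y_def .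
    moreover obtain k where "n = Suc k" using deg(4) by (cases n) auto
    \<comment> \<open>Modulo \<open>n\<close> the degree of the \<open>j\<close>-th summand is
      \<open>- j\<close>, so distinct \<open>j < n\<close> give distinct degrees.\<close>
    ultimately have "n * (x + i) + j = n * (y + j) + i" by (simp add: algebra_simps)
    then have "(n * (x + i) + j) mod n = (n * (y + j) + i) mod n" by simp
    then show "i = j" using ij(1,2) by simp
  qed
  then obtain j where j: "pcompose (Polynomial.coeff r j) p * q ^ j \<noteq> 0"
      "Polynomial.degree ([:c ^ k:] * [:0, 1:]) = Polynomial.degree (pcompose (Polynomial.coeff r j) p * q ^ j)"
    unfolding s by blast
  \<comment> \<open>Here \<open>n \<ge> 3\<close> is decisive: for \<open>n = 2\<close> the term
    \<open>(n - 1) * j\<close> could be 1.\<close>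
  have "1 = Polynomial.degree (Polynomial.coeff r j) * n + (n - 1) * j"
    using j(2) U(2) unfolding dh[OF j(1)] by simp
  moreover have "Polynomial.degree (Polynomial.coeff r j) * n \<noteq> 1" using deg(4) by simp
  ultimately show False using deg(4)
    by (cases "Polynomial.degree (Polynomial.coeff r j)"; cases j) auto
qed

lemma coordinate_has_pole:
  fixes U V F G :: "'a::alg_closed_field poly poly"
  assumes inv: "left_inverse_pair U V F G" "left_inverse_pair F G U V"
    and sd: "fls_subdegree x = - int i" "fls_subdegree y = 1 - int i" "i \<ge> 3"
  shows "\<not> vge 0 (ev fls_const U x y)"
proof
  note h = coeff_hom_fls_const[where 'a = 'a] and hc = coeff_hom_cconst[where 'a = 'a]
  assume reg: "vge 0 (ev fls_const U x y)"
  define \<gamma> \<theta> where "\<gamma> = ev fls_const U x y" "\<theta> = ev fls_const V x y"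
  have \<gamma>: "vge 0 \<gamma>" using reg by (simp add: \<gamma>_\<theta>_def)
  have x: "x = ev fls_const F \<gamma> \<theta>" and y: "y = ev fls_const G \<gamma> \<theta>"
    using inv(2) unfolding left_inverse_pair_def \<gamma>_\<theta>_def
    by (metis coeff_hom.ev_ev[OF h] coeff_hom.ev_tvar[OF h], metis coeff_hom.ev_ev[OF h] coeff_hom.ev_yvar[OF h])
  have nx: "\<not> vge 0 x" and ny: "\<not> vge 0 y" using sd by (auto simp: vge_def)
  interpret v: fls_subalgebra "{x :: 'a fls. vge 0 x}" by (rule fls_subalgebra_vge)
  have ev0: "vge 0 (ev fls_const H \<gamma> \<tau>)" if "vge 0 \<tau>" for H \<tau>
    using v.ev_mem[of \<gamma> \<tau> H] \<gamma> that by simp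
  have "\<not> vge 0 \<theta>" using ev0[of \<theta> F] x nx by auto
  then have \<theta>: "fls_subdegree \<theta> < 0" by (auto simp: vge_def)
  have ex: "\<exists>l. Polynomial.degree (at_t l H) \<ge> 1" if "\<not> vge 0 (ev fls_const H \<gamma> \<theta>)" for H
  proof (rule ccontr)
    assume "\<nexists>l. Polynomial.degree (at_t l H) \<ge> 1"
    then have *: "Polynomial.degree (at_t l H) = 0" for l by (metis One_nat_def Suc_leI neq0_conv)
    have "Polynomial.coeff H j = 0" if "j > 0" for j
      by (rule poly_eq_0_cofinite[of "{}"]) (use that *[THEN coeff_eq_0[OF le_less_trans[OF eq_refl]]] in \<open>simp_all flip: coeff_at_t\<close>)
    then have "Polynomial.degree H = 0" by (metis leading_coeff_0_iff neq0_conv degree_0)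
    then obtain H0 where "H = [:H0:]" by (elim degree_eq_zeroE)
    then have "ev fls_const H \<gamma> \<theta> = ev fls_const H \<gamma> 0"
      by (simp add: ev_def pv_def map_poly_pCons)
    then show False using that ev0[of 0 H] by simp
  qed
  \<comment> \<open>Exchanging the two variables lets \<open>G\<close> take the role of
    \<open>F\<close> in \<open>inverse_pair_degrees\<close>.\<close>
  define Us Vs where "Us = ev cconst U yvar tvar" "Vs = ev cconst V yvar tvar"
  have swap: "ev cconst g Us Vs = ev cconst (ev cconst g U V) yvar tvar" for g
    unfolding Us_Vs_def by (simp only: coeff_hom.ev_ev[OF hc])
  have swap': "ev cconst Us G F = ev cconst U F G" "ev cconst Vs G F = ev cconst V F G"
    unfolding Us_Vs_def by (simp_all only: coeff_hom.ev_ev[OF hc] coeff_hom.ev_tvar[OF hc] coeff_hom.ev_yvar[OF hc])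
  have inv': "left_inverse_pair Us Vs G F" "left_inverse_pair G F Us Vs"
    using inv unfolding left_inverse_pair_def swap swap'
    by (simp_all only: coeff_hom.ev_tvar[OF hc] coeff_hom.ev_yvar[OF hc])
  obtain l where l: "Polynomial.degree (at_t l F) \<ge> 1" using ex nx x by blast
  obtain l' where l': "Polynomial.degree (at_t l' G) \<ge> 1" using ex ny y by blast
  note F = inverse_pair_degrees[OF inv l] and G = inverse_pair_degrees[OF inv' l']
  obtain cF cG cU where c: "cF \<noteq> 0" "Polynomial.lead_coeff F = [:cF:]"
      "cG \<noteq> 0" "Polynomial.lead_coeff G = [:cG:]" "cU \<noteq> 0" "Polynomial.lead_coeff U = [:cU:]"
    using F(3,4) G(3) by blast
  have dF: "- int i = int (Polynomial.degree F) * fls_subdegree \<theta>"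
    using subdegree_ev[OF \<gamma> \<theta> c(1,2)] sd(1) unfolding x[symmetric] by simp
  have dG: "1 - int i = int (Polynomial.degree G) * fls_subdegree \<theta>"
    using subdegree_ev[OF \<gamma> \<theta> c(3,4)] sd(2) unfolding y[symmetric] by simp
  have "fls_subdegree \<theta> dvd (1 - int i) - (- int i)" unfolding dF dG by (intro dvd_diff) auto
  then have \<theta>1: "fls_subdegree \<theta> = - 1" using \<theta> by (auto simp: zdvd1_eq)
  have degs: "Polynomial.degree F = i" "Polynomial.degree G = i - 1"
    using dF dG sd(3) unfolding \<theta>1 by auto
  have at: "Polynomial.degree (at_t 0 H) = Polynomial.degree H" if "Polynomial.lead_coeff H = [:e:]" "e \<noteq> 0"
    for H :: "'a poly poly" and e
    using that by (intro map_poly_degree_eq) simp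
  show False
  proof (rule no_linear_element)
    show "ev (\<lambda>c. [:c:]) U (at_t 0 F) (at_t 0 G) = 0" "ev (\<lambda>c. [:c:]) V (at_t 0 F) (at_t 0 G) = [:0, 1:]"
      using inv(1) unfolding left_inverse_pair_def at_t_ev[symmetric] by (simp_all add: at_t_tvar at_t_yvar)
    show "Polynomial.degree (at_t 0 F) = i" "Polynomial.degree (at_t 0 G) = i - 1"
      using at c degs by simp_all
  qed (use c F(1) degs sd(3) in auto)
qed

section \<open>Maximal and extending subrings from places\<close>

text \<open>\<open>val\<close> may have a kernel, which is contained in \<open>VR\<close>. The
  locale is used for the regular functions, where \<open>val\<close> is injective, and for
  \<open>k[t,y]\<close>, where it kills the multiples of the equation.\<close>

locale valued_cring = cring R + place_algebra S for R :: "('r, 'm) ring_scheme" (structure) and S :: "'a::field fls set" +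
  fixes val :: "'r \<Rightarrow> 'a fls"
  assumes val_add: "x \<in> carrier R \<Longrightarrow> y \<in> carrier R \<Longrightarrow> val (x \<oplus> y) = val x + val y"
    and val_mult: "x \<in> carrier R \<Longrightarrow> y \<in> carrier R \<Longrightarrow> val (x \<otimes> y) = val x * val y"
    and val_one: "val \<one> = 1"
    and val_image: "val ` carrier R = S"
begin

definition VR :: "'r set" where "VR = {h \<in> carrier R. vge 0 (val h)}"

lemma val_zero: "val \<zero> = 0"
proof -
  have "val \<zero> = val \<zero> + val \<zero>"
    using val_add[OF zero_closed zero_closed] by (simp only: l_zero zero_closed)
  then show ?thesis by (metis add_cancel_right_right)
qed

lemma val_a_inv: "x \<in> carrier R \<Longrightarrow> val (\<ominus> x) = - val x"
  using val_add[of x "\<ominus> x"] by (simp add: r_neg val_zero eq_neg_iff_add_eq_0 add.commute)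

lemma val_minus: "x \<in> carrier R \<Longrightarrow> y \<in> carrier R \<Longrightarrow> val (x \<ominus> y) = val x - val y"
  by (simp add: a_minus_def val_add val_a_inv)

lemma subring_VR: "subring VR R"
proof (rule subringI)
  show "\<ominus> h \<in> VR" if "h \<in> VR" for h
    using that vge_diff[OF vge_0, of 0 "val h"] by (auto simp: VR_def val_a_inv)
qed (auto simp: VR_def val_one val_add val_mult intro: vge_add vge_mult0)

lemma maximal_subring_VR: "maximal_subring VR R"
  unfolding maximal_subring_def
proof (intro conjI allI impI)
  show "subring VR R" by (rule subring_VR)
  obtain w where "w \<in> S" "fls_subdegree w < 0" using neg by blast
  then obtain r where "r \<in> carrier R" "\<not> vge 0 (val r)"
    using val_image by (force simp: vge_def)
  then show "VR \<noteq> carrier R" by (auto simp: VR_def)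
  fix B assume B: "subring B R \<and> VR \<subseteq> B"
  note sub = subringE[OF conjunct1[OF B]]
  show "B = VR \<or> B = carrier R"
  proof (cases "B \<subseteq> VR")
    case False
    then obtain h where h: "h \<in> B" "h \<notin> VR" by blast
    have "val ` B = S"
    proof (rule maximal)
      show "val ` B \<subseteq> S" using sub(1) val_image by blast
      show "x \<in> val ` B" if "x \<in> S" "vge 0 x" for x
        using that B unfolding val_image[symmetric] VR_def by auto
      show "x + y \<in> val ` B" if "x \<in> val ` B" "y \<in> val ` B" for x y
        using that sub(1,7) by (auto simp: subset_iff simp flip: val_add)
      show "x * y \<in> val ` B" if "x \<in> val ` B" "y \<in> val ` B" for x y
        using that sub(1,6) by (auto simp: subset_iff simp flip: val_mult)
      show "val h \<in> val ` B" using h(1) by blast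
      show "\<not> vge 0 (val h)" using h sub(1) by (auto simp: VR_def)
    qed
    have "r \<in> B" if r: "r \<in> carrier R" for r
    proof -
      have "val r \<in> val ` B" using r \<open>val ` B = S\<close> val_image by blast
      then obtain b where b: "b \<in> B" "val r = val b" by blast
      then have bR: "b \<in> carrier R" using sub(1) by blast
      have "r \<ominus> b \<in> VR" using r bR b(2) by (auto simp: VR_def val_minus)
      then have "(r \<ominus> b) \<oplus> b \<in> B" using B b(1) sub(7) by blast
      then show ?thesis using r bR by (simp add: a_minus_def a_assoc l_neg)
    qed
    then show ?thesis using sub(1) by blast
  qed (use B in blast)
qed

lemma extending_VR: "extending VR R"
proof -
  let ?A = "R\<lparr>carrier := VR\<rparr>" and ?k = "ring_of_type_algebra :: 'a ring"
  interpret k: field ?k by (rule field_from_type_algebra)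
  have rA: "ring ?A" by (rule subring_is_ring[OF subring_VR])
  have VR_carrier: "VR \<subseteq> carrier R" by (auto simp: VR_def)
  have cA: "cring ?A"
    using rA unfolding cring_def comm_monoid_def comm_monoid_axioms_def ring_def
    by (auto intro!: m_comm dest: subsetD[OF VR_carrier])
  \<comment> \<open>Reduction to the residue field exhibits the elements of positive order as a
    prime ideal of the subring.\<close>
  let ?res = "\<lambda>h. fls_nth (val h) 0"
  interpret res: ring_hom_ring ?A ?k ?res
    by (rule ring_hom_ringI[OF rA k.ring_axioms])
      (auto simp: ring_of_type_algebra_def VR_def val_mult val_add val_one fls_nth_mult_0)
  have P: "primeideal {h \<in> VR. vge 1 (val h)} ?A"
  proof -
    have "primeideal {h \<in> carrier ?A. ?res h \<in> {\<zero>\<^bsub>?k\<^esub>}} ?A"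
      by (rule res.primeideal_vimage[OF cA k.zeroprimeideal])
    moreover have "{h \<in> carrier ?A. ?res h \<in> {\<zero>\<^bsub>?k\<^esub>}} = {h \<in> VR. vge 1 (val h)}"
      using vge_residue by (force simp: VR_def ring_of_type_algebra_def vge_1_imp_nth0)
    ultimately show ?thesis by simp
  qed
  have "{h \<in> VR. vge 1 (val h)} \<noteq> Q \<inter> VR" if "primeideal Q R" for Q
  proof
    assume eq: "{h \<in> VR. vge 1 (val h)} = Q \<inter> VR"
    interpret Q: primeideal Q R by fact
    obtain u w e where uwe: "u \<in> carrier R" "w \<in> carrier R" "e \<in> carrier R"
      "vge 1 (val u)" "vge 1 (val e)" "val u * val w = 1 + val e"
      using no_lying_over unfolding val_image[symmetric] by blast
    have PQ: "h \<in> Q" if "h \<in> carrier R" "vge 1 (val h)" for h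
      using eq that vge_mono[of 1 "val h" 0] by (auto simp: VR_def)
    \<comment> \<open>In \<open>R\<close> the relation \<open>u * w = 1 + e\<close> holds only up to
      the kernel of \<open>val\<close>; the error \<open>z\<close> has value 0 and therefore lies in
      \<open>Q\<close> too.\<close>
    define z where "z = u \<otimes> w \<ominus> (\<one> \<oplus> e)"
    have "val z = 0" using uwe by (simp add: z_def val_minus val_mult val_add val_one)
    then have "z \<in> Q" using uwe by (intro PQ) (auto simp: z_def)
    moreover have "u \<otimes> w \<in> Q" using PQ[OF uwe(1,4)] uwe(2) by (rule Q.I_r_closed)
    moreover have "e \<in> Q" using PQ uwe by blast
    moreover have "\<one> = u \<otimes> w \<ominus> e \<ominus> z"
      using uwe by (simp add: z_def) algebra
    ultimately have "\<one> \<in> Q" by (metis Q.a_closed Q.a_inv_closed a_minus_def)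
    then have "Q = carrier R" by (rule Q.one_imp_carrier)
    then show False using Q.I_notcarr by simp
  qed
  then show ?thesis using P unfolding extending_def Spec_def by blast
qed

lemma subalgebra_VR:
  assumes "\<And>c. c \<in> K \<Longrightarrow> c \<in> VR"
  shows "subalgebra K VR R"
proof -
  have "subgroup VR (add_monoid R)" using subring_VR by (simp add: subring_def)
  moreover have "k \<otimes> v \<in> VR" if "k \<in> K" "v \<in> VR" for k v
    using subringE(6)[OF subring_VR] assms that by blast
  ultimately show ?thesis by (simp add: subalgebra_def subalgebra_axioms_def)
qed

lemma adjoin_subset_VR:
  assumes "K \<subseteq> VR" "H \<subseteq> VR"
  shows "adjoin R K H \<subseteq> VR"
proof
  fix h assume "h \<in> adjoin R K H"
  then show "h \<in> VR" unfolding adjoin_def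
    by (induction rule: generate_ring.induct) (use assms subringE[OF subring_VR] in auto)
qed

end

section \<open>Regular functions\<close>

lemma eval2_ev: "eval2 (ev cconst g p q) (x, y) = eval2 g (eval2 p (x, y), eval2 q (x, y))"
  by (simp only: eval2_eq_ev coeff_hom.ev_ev[OF coeff_hom_id])

text \<open>Polynomials that agree as functions are equal, the field being infinite; so inverse maps
  give identities between polynomials.\<close>

lemma plane_automorphism_inverse:
  fixes U V :: "'a::alg_closed_field poly poly"
  assumes "plane_automorphism U V"
  shows "\<exists>F G. left_inverse_pair U V F G \<and> left_inverse_pair F G U V"
proof -
  obtain F G where FG: "polynomial_map F G \<circ> polynomial_map U V = id"
    "polynomial_map U V \<circ> polynomial_map F G = id"
    using assms unfolding plane_automorphism_def by blast
  have *: "left_inverse_pair U' V' F' G'" if "polynomial_map U' V' \<circ> polynomial_map F' G' = id"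
    for U' V' F' G' :: "'a poly poly"
  proof -
    have e: "(eval2 U' (eval2 F' x, eval2 G' x), eval2 V' (eval2 F' x, eval2 G' x)) = x" for x
      using fun_cong[OF that, of x] by (simp add: polynomial_map_def)
    have "eval2 (ev cconst U' F' G' - tvar) x = 0" "eval2 (ev cconst V' F' G' - yvar) x = 0" for x
      using e[of x] by (cases x; simp add: eval2_diff eval2_ev; simp add: eval2_def)+
    then have "ev cconst U' F' G' - tvar = 0" "ev cconst V' F' G' - yvar = 0"
      by (blast intro: eval2_eq_0_imp)+
    then show ?thesis by (simp add: left_inverse_pair_def)
  qed
  show ?thesis using *[OF FG(1)] *[OF FG(2)] by blast
qed

lemma left_inverse_pair_swap:
  fixes U V F G :: "'a::comm_ring_1 poly poly"
  assumes "left_inverse_pair U V F G" "left_inverse_pair F G U V"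
  shows "\<exists>F' G'. left_inverse_pair V U F' G' \<and> left_inverse_pair F' G' V U"
proof (intro exI conjI)
  note hc = coeff_hom_cconst[where 'a = 'a]
  define F' G' where "F' = ev cconst F yvar tvar" "G' = ev cconst G yvar tvar"
  have "ev cconst g F' G' = ev cconst (ev cconst g F G) yvar tvar" for g
    unfolding F'_G'_def by (simp only: coeff_hom.ev_ev[OF hc])
  then show "left_inverse_pair V U F' G'"
    using assms(1) unfolding left_inverse_pair_def
    by (simp only: coeff_hom.ev_tvar[OF hc] coeff_hom.ev_yvar[OF hc])
  show "left_inverse_pair F' G' V U"
    using assms(2) unfolding left_inverse_pair_def F'_G'_def
    by (simp only: coeff_hom.ev_ev[OF hc] coeff_hom.ev_tvar[OF hc] coeff_hom.ev_yvar[OF hc])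
qed

lemma coordinate_inverse:
  fixes g :: "'a::alg_closed_field poly poly"
  assumes "coordinate g"
  shows "\<exists>V F G. left_inverse_pair g V F G \<and> left_inverse_pair F G g V"
  using assms plane_automorphism_inverse left_inverse_pair_swap unfolding coordinate_def by metis

section \<open>Values of forms at points of the projective plane\<close>

lemma eval3_hom_scale:
  assumes "homogeneous d H"
  shows "eval3 H (s * x, s * y, s * z) = s ^ d * eval3 H (x, y, z :: 'a::field)"
  unfolding eval3_homogeneous[OF assms] hval_def sum_distrib_left
proof (intro sum.cong refl, clarify)
  fix i j assume "(i, j) \<in> tri d"
  then have "d = i + j + (d - i - j)" by (simp add: tri_def)
  then have "s ^ d = s ^ i * s ^ j * s ^ (d - i - j)" by (metis power_add)
  then show "cf (poly H 1) i j * (s * x) ^ i * (s * y) ^ j * (s * z) ^ (d - i - j)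
    = s ^ d * (cf (poly H 1) i j * x ^ i * y ^ j * z ^ (d - i - j))"
    by (simp only: power_mult_distrib ac_simps)
qed

lemma vanishes_at_hpoint:
  assumes "homogeneous d H"
  shows "vanishes_at H (hpoint (x, y, z)) \<longleftrightarrow> eval3 H (x, y, z :: 'a::field) = 0"
proof
  assume "vanishes_at H (hpoint (x, y, z))"
  moreover have "(x, y, z) \<in> hpoint (x, y, z)" by (auto simp: hpoint_def intro: exI[of _ 1])
  ultimately show "eval3 H (x, y, z) = 0" unfolding vanishes_at_def by blast
next
  assume "eval3 H (x, y, z) = 0"
  then show "vanishes_at H (hpoint (x, y, z))"
    unfolding vanishes_at_def hpoint_def by (auto simp: eval3_hom_scale[OF assms])
qed

lemma PIdl_kty: "PIdl\<^bsub>k_ty\<^esub> f = {g. f dvd g}"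
  by (auto simp: cgenideal_def ring_of_type_algebra_def dvd_def mult.commute)

section \<open>Functions on the affine curve and their expansions\<close>

locale affine_curve_place = curve_place f d a b a' b' \<eta> \<zeta>
  for f :: "'a::alg_closed_field poly poly" and d a b a' b' \<eta> \<zeta> +
  fixes C :: "('a \<times> 'a) set"
  assumes C: "C = {x. eval2 f x = 0}" "C \<noteq> {}"
    and vanish: "(\<forall>x\<in>C. eval2 g x = 0) \<longleftrightarrow> f dvd g"
begin

definition \<rho> :: "'a poly poly \<Rightarrow> 'a \<times> 'a \<Rightarrow> 'a" where "\<rho> g = restrict (eval2 g) C"

text \<open>Restriction to the curve and expansion at the place have the same kernel, the multiples
  of \<open>f\<close>. Hence a function on the curve has a well-defined expansion.\<close>

lemma \<rho>_eq_iff: "\<rho> g = \<rho> h \<longleftrightarrow> \<phi> g = \<phi> h"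
proof -
  have "\<rho> g = \<rho> h \<longleftrightarrow> (\<forall>x\<in>C. eval2 (g - h) x = 0)"
    by (auto simp: \<rho>_def fun_eq_iff restrict_def eval2_diff)
  then show ?thesis unfolding vanish kernel[symmetric] \<phi>_diff by simp
qed

lemma regular_ops:
  "\<rho> g \<otimes>\<^bsub>regular_ring C\<^esub> \<rho> h = \<rho> (g * h)" "\<rho> g \<oplus>\<^bsub>regular_ring C\<^esub> \<rho> h = \<rho> (g + h)"
  "\<one>\<^bsub>regular_ring C\<^esub> = \<rho> 1" "\<zero>\<^bsub>regular_ring C\<^esub> = \<rho> 0"
  by (auto simp: regular_ring_def \<rho>_def fun_eq_iff restrict_def eval2_mult eval2_add)
    (simp add: eval2_def)

lemma defined_at_iff: "defined_at C (hpoint (a, b, 0)) (\<rho> g) \<longleftrightarrow> vge 0 (\<phi> g)"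
proof -
  have van: "vanishes_at H (hpoint (a, b, 0)) \<longleftrightarrow> cf (lin a b a' b' (poly H 1)) n 0 = 0"
    if H: "homogeneous n H" for H n
    unfolding vanishes_at_hpoint[OF H] eval3_homogeneous[OF H]
    using hval_lin[OF tdeg_le_dehomogenize[OF H], of a b a' b' 1 0 0]
      hval_100(1)[OF coeff_hom_id[where 'a = 'a], of n "lin a b a' b' (poly H 1)"] by simp
  show ?thesis
  proof
    assume "defined_at C (hpoint (a, b, 0)) (\<rho> g)"
    then obtain n G H where GH: "homogeneous n G" "homogeneous n H" "\<not> vanishes_at H (hpoint (a, b, 0))"
      and q: "\<And>x y. (x, y) \<in> C \<Longrightarrow> eval3 H (x, y, 1) \<noteq> 0 \<Longrightarrow>
        \<rho> g (x, y) = eval3 G (x, y, 1) / eval3 H (x, y, 1)"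
      unfolding defined_at_def by blast
    define g1 g2 where "g1 = poly G 1" "g2 = poly H 1"
    have t: "tdeg_le n g1" "tdeg_le n g2"
      unfolding g1_g2_def using GH tdeg_le_dehomogenize by blast+
    have nz: "cf (lin a b a' b' g2) n 0 \<noteq> 0" using van GH g1_g2_def by blast
    \<comment> \<open>The quotient represents \<open>g\<close> only where the denominator is
      nonzero. The extra factor \<open>g2\<close> makes the identity valid on the whole curve and is
      cancelled after expansion.\<close>
    have "eval2 (g2 * (g * g2 - g1)) x = 0" if "x \<in> C" for x
    proof (cases "eval2 g2 x = 0")
      case False
      obtain s t where x: "x = (s, t)" by (cases x)
      have "\<rho> g x = eval2 g1 x / eval2 g2 x"
        using q[of s t] that False unfolding x eval3_1 g1_g2_def by simp
      then have "eval2 g x * eval2 g2 x = eval2 g1 x"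
        using that False by (simp add: \<rho>_def)
      then show ?thesis by (simp add: eval2_mult eval2_diff)
    qed (simp add: eval2_mult)
    then have "\<phi> (g2 * (g * g2 - g1)) = 0" using vanish kernel by blast
    moreover have "\<phi> g2 \<noteq> 0" using residue_\<phi>[OF t(2)] nz by auto
    ultimately have "\<phi> g * \<phi> g2 = \<phi> g1" by (simp add: \<phi>_mult \<phi>_diff)
    then show "vge 0 (\<phi> g)" unfolding vge_0_iff_quotient using t nz by blast
  next
    assume "vge 0 (\<phi> g)"
    then obtain n g1 g2 where t: "tdeg_le n g1" "tdeg_le n g2" and nz: "cf (lin a b a' b' g2) n 0 \<noteq> 0"
      and e: "\<phi> g * \<phi> g2 = \<phi> g1"
      unfolding vge_0_iff_quotient by blast
    obtain G where G: "homogeneous n G" "poly G 1 = g1" using ex_homogenization[OF t(1)] .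
    obtain H where H: "homogeneous n H" "poly H 1 = g2" using ex_homogenization[OF t(2)] .
    have "\<phi> (g * g2 - g1) = 0" using e by (simp add: \<phi>_mult \<phi>_diff)
    then have z: "eval2 g x * eval2 g2 x = eval2 g1 x" if "x \<in> C" for x
      using vanish[of "g * g2 - g1"] kernel that by (simp add: eval2_diff eval2_mult)
    show "defined_at C (hpoint (a, b, 0)) (\<rho> g)"
      unfolding defined_at_def
    proof (intro exI conjI ballI, safe)
      show "homogeneous n G" "homogeneous n H" by (fact G(1), fact H(1))
      show False if "vanishes_at H (hpoint (a, b, 0))" using van[OF H(1)] that nz H(2) by simp
      fix x y assume xy: "(x, y) \<in> C" "eval3 H (x, y, 1) \<noteq> 0"
      then show "\<rho> g (x, y) = eval3 G (x, y, 1) / eval3 H (x, y, 1)"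
        using z[OF xy(1)] unfolding eval3_1 G(2) H(2) by (simp add: \<rho>_def field_simps)
    qed
  qed
qed

text \<open>For the inclusion from left to right, the polynomials \<open>q\<close> such that
  \<open>q * h\<close> is polynomial on the curve form an ideal. It has no common zero: local
  quotients provide a nonvanishing member at points of the curve, and \<open>f\<close> is one
  elsewhere.\<close>

lemma carrier_regular_ring: "carrier (regular_ring C) = range \<rho>"
proof
  show "range \<rho> \<subseteq> carrier (regular_ring C)"
  proof safe
    fix g :: "'a poly poly"
    obtain n where n: "tdeg_le n g" using ex_tdeg_le by blast
    obtain G where G: "homogeneous n G" "poly G 1 = g" using ex_homogenization[OF n] .
    obtain H where H: "homogeneous n H" "poly H 1 = cconst (1::'a)"
      using ex_homogenization[OF tdeg_le_cconst] .
    have H1: "eval3 H (x, y, 1) = 1" for x y unfolding eval3_1 H(2) by (simp add: eval2_cconst)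
    have "defined_at C (embed_plane x) (\<rho> g)" for x
      unfolding defined_at_def
    proof (intro exI conjI ballI, safe)
      show "homogeneous n G" "homogeneous n H" by (fact G(1), fact H(1))
      show False if "vanishes_at H (embed_plane x)"
        using that vanishes_at_hpoint[OF H(1)] H1 by (simp add: embed_plane_def)
    qed (simp add: H1[unfolded eval3_1] eval3_1 G(2) \<rho>_def)
    then show "\<rho> g \<in> carrier (regular_ring C)" by (simp add: regular_ring_def \<rho>_def)
  qed
  show "carrier (regular_ring C) \<subseteq> range \<rho>"
  proof
    fix h assume "h \<in> carrier (regular_ring C)"
    then have ext: "h \<in> extensional C" and reg: "\<And>x. x \<in> C \<Longrightarrow> defined_at C (embed_plane x) h"
      by (auto simp: regular_ring_def)
    define I where "I = {q. \<exists>g. \<forall>x\<in>C. eval2 q x * h x = eval2 g x}"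
    have "1 \<in> I"
    proof (rule nullstellensatz_curve[OF prime f0])
      fix u v assume "u \<in> I" "v \<in> I"
      then obtain u' v' where uv: "\<forall>x\<in>C. eval2 u x * h x = eval2 u' x" "\<forall>x\<in>C. eval2 v x * h x = eval2 v' x"
        unfolding I_def by blast
      then have "\<forall>x\<in>C. eval2 (u - v) x * h x = eval2 (u' - v') x"
        by (simp add: eval2_diff left_diff_distrib)
      then show "u - v \<in> I" unfolding I_def by blast
    next
      fix u v assume "u \<in> I"
      then obtain u' where u: "\<forall>x\<in>C. eval2 u x * h x = eval2 u' x" unfolding I_def by blast
      then have "\<forall>x\<in>C. eval2 (u * v) x * h x = eval2 (u' * v) x"
        by (simp add: eval2_mult mult_ac)
      then show "u * v \<in> I" unfolding I_def by blast
    next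
      have "\<forall>x\<in>C. eval2 f x * h x = eval2 0 x" using C(1) by simp
      then show "f \<in> I" unfolding I_def by blast
      show "\<exists>x. eval2 f x = 0" using C by blast
      fix x
      show "\<exists>g\<in>I. eval2 g x \<noteq> 0"
      proof (cases "x \<in> C")
        case False
        then show ?thesis using \<open>f \<in> I\<close> C(1) by blast
      next
        case True
        obtain n G H where GH: "homogeneous n G" "homogeneous n H" "\<not> vanishes_at H (embed_plane x)"
          and q: "\<And>s t. (s, t) \<in> C \<Longrightarrow> eval3 H (s, t, 1) \<noteq> 0 \<Longrightarrow> h (s, t) = eval3 G (s, t, 1) / eval3 H (s, t, 1)"
          using reg[OF True] unfolding defined_at_def by blast
        let ?g = "poly G 1" and ?k = "poly H 1"
        \<comment> \<open>Squaring the denominator makes the identity hold at its zeros on the curve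
          as well.\<close>
        have "eval2 (?k * ?k) y * h y = eval2 (?k * ?g) y" if "y \<in> C" for y
          using q[of "fst y" "snd y"] that unfolding eval3_1 by (cases "eval2 ?k y = 0") (auto simp: eval2_mult)
        then have "?k * ?k \<in> I" unfolding I_def by blast
        moreover have "eval2 ?k x \<noteq> 0"
          using GH(3) vanishes_at_hpoint[OF GH(2)] by (cases x) (simp add: embed_plane_def eval3_1)
        ultimately show ?thesis by (intro bexI[of _ "?k * ?k"]) (simp_all add: eval2_mult)
      qed
    qed
    then obtain g where "\<forall>x\<in>C. h x = eval2 g x" unfolding I_def by (auto simp: eval2_def)
    then have "h = \<rho> g" using ext unfolding \<rho>_def by (auto simp: fun_eq_iff extensional_def)
    then show "h \<in> range \<rho>" by blast
  qed
qed

lemma cring_regular_ring: "cring (regular_ring C)"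
proof (rule cringI)
  show "abelian_group (regular_ring C)"
  proof (rule abelian_groupI, goal_cases)
    case (6 x)
    then obtain g where "x = \<rho> g" unfolding carrier_regular_ring by blast
    then have "\<rho> (- g) \<oplus>\<^bsub>regular_ring C\<^esub> x = \<zero>\<^bsub>regular_ring C\<^esub>" by (simp add: regular_ops)
    then show ?case unfolding carrier_regular_ring by blast
  qed (auto simp: carrier_regular_ring regular_ops add_ac)
  show "comm_monoid (regular_ring C)"
    by (rule comm_monoidI) (auto simp: carrier_regular_ring regular_ops mult_ac)
qed (auto simp: carrier_regular_ring regular_ops distrib_right)

definition val :: "('a \<times> 'a \<Rightarrow> 'a) \<Rightarrow> 'a fls" where "val h = \<phi> (SOME g. \<rho> g = h)"

lemma val_\<rho> [simp]: "val (\<rho> g) = \<phi> g"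
  unfolding val_def using \<rho>_eq_iff by (metis (mono_tags, lifting) someI)

sublocale reg: valued_cring "regular_ring C" "range \<phi>" val
proof (intro valued_cring.intro valued_cring_axioms.intro)
  show "cring (regular_ring C)" by (rule cring_regular_ring)
  show "place_algebra (range \<phi>)" by unfold_locales
qed (auto simp: carrier_regular_ring regular_ops \<phi>_add \<phi>_mult \<phi>_1 image_image)

sublocale kty: valued_cring k_ty "range \<phi>" \<phi>
proof (intro valued_cring.intro valued_cring_axioms.intro)
  show "cring (k_ty :: 'a poly poly ring)" by (rule cring_from_type_algebra)
  show "place_algebra (range \<phi>)" by unfold_locales
qed (auto simp: ring_of_type_algebra_def \<phi>_add \<phi>_mult \<phi>_1)

lemma \<rho>_cconst: "\<rho> (cconst c) = restrict (\<lambda>x. c) C"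
  by (auto simp: \<rho>_def fun_eq_iff restrict_def eval2_cconst)

lemma reg_VR: "reg.VR = \<rho> ` {g. vge 0 (\<phi> g)}"
  unfolding reg.VR_def carrier_regular_ring by auto

lemma regular_at_place_eq_VR: "{h \<in> carrier (regular_ring C). defined_at C (hpoint (a, b, 0)) h} = reg.VR"
  unfolding reg_VR carrier_regular_ring by (auto simp: defined_at_iff)

lemma kty_VR: "kty.VR = {g. vge 0 (\<phi> g)}"
  unfolding kty.VR_def by (simp add: ring_of_type_algebra_def)

lemma consts_VR: "regular_consts C \<subseteq> reg.VR" "ty_consts \<subseteq> kty.VR"
  unfolding reg_VR kty_VR regular_consts_def ty_consts_def
  by (auto simp: \<phi>_const simp flip: \<rho>_cconst)

lemma maximal_subalgebra_VR:
  "maximal_subalgebra (regular_consts C) reg.VR (regular_ring C)"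
  "maximal_subalgebra ty_consts kty.VR k_ty"
  unfolding maximal_subalgebra_def
  using reg.maximal_subring_VR reg.subalgebra_VR kty.maximal_subring_VR kty.subalgebra_VR consts_VR
  by (simp_all add: subset_iff)

lemma finitely_generated_VR: "finitely_generated_over (regular_ring C) (regular_consts C) reg.VR"
proof -
  obtain E where E: "finite E" "alg E = {x \<in> range \<phi>. vge 0 x}" using finitely_generated_place by blast
  define H where "H = (\<lambda>x. \<rho> (SOME g. \<phi> g = x)) ` E"
  let ?G = "adjoin (regular_ring C) (regular_consts C) H"
  have ER: "E \<subseteq> {x \<in> range \<phi>. vge 0 x}" using E(2) alg.incl by blast
  have some: "\<phi> (SOME g. \<phi> g = x) = x" if "x \<in> E" for x
  proof -
    obtain g where "\<phi> g = x" using ER \<open>x \<in> E\<close> by blast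
    then show ?thesis by (rule someI)
  qed
  have HV: "H \<subseteq> reg.VR" unfolding H_def reg_VR using ER some by auto
  have "\<exists>g. \<rho> g \<in> ?G \<and> \<phi> g = x" if "x \<in> alg E" for x
    using that
  proof (induction rule: alg.induct)
    case (const c)
    have "\<rho> (cconst c) \<in> ?G" unfolding adjoin_def
      by (rule generate_ring.incl) (auto simp: regular_consts_def \<rho>_cconst)
    then show ?case using \<phi>_const by blast
  next
    case (incl x)
    have "\<rho> (SOME g. \<phi> g = x) \<in> ?G" unfolding adjoin_def
      by (rule generate_ring.incl) (use incl in \<open>auto simp: H_def\<close>)
    then show ?case using some[OF incl] by blast
  next
    case (add x y)
    then obtain g h where "\<rho> g \<in> ?G" "\<phi> g = x" "\<rho> h \<in> ?G" "\<phi> h = y" by blast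
    moreover from this have "\<rho> (g + h) \<in> ?G"
      unfolding adjoin_def regular_ops(2)[symmetric] by (intro generate_ring.eng_add)
    ultimately show ?case using \<phi>_add by blast
  next
    case (mult x y)
    then obtain g h where "\<rho> g \<in> ?G" "\<phi> g = x" "\<rho> h \<in> ?G" "\<phi> h = y" by blast
    moreover from this have "\<rho> (g * h) \<in> ?G"
      unfolding adjoin_def regular_ops(1)[symmetric] by (intro generate_ring.eng_mult)
    ultimately show ?case using \<phi>_mult by blast
  qed
  then have lift: "\<exists>h. \<rho> h \<in> ?G \<and> \<phi> h = \<phi> g" if "vge 0 (\<phi> g)" for g
    unfolding E(2) using that by blast
  have "reg.VR \<subseteq> ?G"
  proof
    fix x assume "x \<in> reg.VR"
    then obtain g where g: "x = \<rho> g" "vge 0 (\<phi> g)" unfolding reg_VR by blast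
    then show "x \<in> ?G" using lift[OF g(2)] \<rho>_eq_iff by metis
  qed
  moreover have "?G \<subseteq> reg.VR" by (rule reg.adjoin_subset_VR[OF consts_VR(1) HV])
  moreover have "H \<subseteq> carrier (regular_ring C)" using HV by (auto simp: reg.VR_def)
  moreover have "finite H" unfolding H_def using E(1) by simp
  ultimately show ?thesis unfolding finitely_generated_over_def by blast
qed

lemma minus_\<rho>: "\<ominus>\<^bsub>regular_ring C\<^esub> \<rho> g = \<rho> (- g)"
  by (rule reg.minus_equality) (auto simp: regular_ops carrier_regular_ring)

lemma minus_kty: "\<ominus>\<^bsub>k_ty\<^esub> g = - (g :: 'a poly poly)"
  by (rule kty.minus_equality) (auto simp: ring_of_type_algebra_def)

text \<open>\<open>kty.VR\<close> is the full preimage of \<open>reg.VR\<close> under restriction to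
  the curve, and the kernel of restriction consists of the multiples of \<open>f\<close>. So lifts
  of generators together with this kernel give everything.\<close>

lemma preimage_adjoin:
  assumes gen: "adjoin (regular_ring C) (regular_consts C) (\<alpha> ` {..<k}) = reg.VR"
    and r: "\<And>i. i < k \<Longrightarrow> \<rho> (r i) = \<alpha> i"
  shows "adjoin k_ty ty_consts (r ` {..<k}) <+>\<^bsub>k_ty\<^esub> PIdl\<^bsub>k_ty\<^esub> f = kty.VR"
proof -
  let ?G = "adjoin k_ty ty_consts (r ` {..<k})"
  have sum: "?G <+>\<^bsub>k_ty\<^esub> PIdl\<^bsub>k_ty\<^esub> f = {g + h |g h. g \<in> ?G \<and> f dvd h}"
    unfolding set_add_def' PIdl_kty by (auto simp: ring_of_type_algebra_def)
  have rV: "r ` {..<k} \<subseteq> kty.VR"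
  proof safe
    fix i assume i: "i < k"
    have "\<alpha> i \<in> adjoin (regular_ring C) (regular_consts C) (\<alpha> ` {..<k})"
      unfolding adjoin_def using i by (intro generate_ring.incl) auto
    then have "\<rho> (r i) \<in> reg.VR" unfolding gen r[OF i] .
    then show "r i \<in> kty.VR" unfolding reg.VR_def kty_VR by simp
  qed
  have lift: "\<exists>g\<in>?G. \<rho> g = h" if "h \<in> adjoin (regular_ring C) (regular_consts C) (\<alpha> ` {..<k})" for h
    using that unfolding adjoin_def
  proof (induction rule: generate_ring.induct)
    case one
    have "1 \<in> generate_ring k_ty (ty_consts \<union> r ` {..<k})"
      using generate_ring.one[of k_ty] by (simp add: ring_of_type_algebra_def)
    then show ?case unfolding regular_ops by blast
  next
    case (incl h)
    then consider c where "h = \<rho> (cconst c)" | i where "i < k" "h = \<rho> (r i)"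
      using r unfolding regular_consts_def \<rho>_cconst by auto
    then show ?case
    proof cases
      case 1
      then show ?thesis by (intro bexI[of _ "cconst c"] generate_ring.incl) (auto simp: ty_consts_def)
    next
      case 2
      then show ?thesis by (intro bexI[of _ "r i"] generate_ring.incl) auto
    qed
  next
    case (a_inv h)
    then obtain g where g: "g \<in> generate_ring k_ty (ty_consts \<union> r ` {..<k})" "\<rho> g = h" by blast
    then show ?case using generate_ring.a_inv[OF g(1)] minus_\<rho>[of g] unfolding minus_kty by metis
  next
    case (eng_add h1 h2)
    then obtain g1 g2 where g: "g1 \<in> generate_ring k_ty (ty_consts \<union> r ` {..<k})" "\<rho> g1 = h1"
      "g2 \<in> generate_ring k_ty (ty_consts \<union> r ` {..<k})" "\<rho> g2 = h2" by blast
    have "g1 + g2 \<in> generate_ring k_ty (ty_consts \<union> r ` {..<k})"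
      using generate_ring.eng_add[OF g(1,3)] by (simp add: ring_of_type_algebra_def)
    then show ?case using g(2,4) regular_ops(2)[of g1 g2] by metis
  next
    case (eng_mult h1 h2)
    then obtain g1 g2 where g: "g1 \<in> generate_ring k_ty (ty_consts \<union> r ` {..<k})" "\<rho> g1 = h1"
      "g2 \<in> generate_ring k_ty (ty_consts \<union> r ` {..<k})" "\<rho> g2 = h2" by blast
    have "g1 * g2 \<in> generate_ring k_ty (ty_consts \<union> r ` {..<k})"
      using generate_ring.eng_mult[OF g(1,3)] by (simp add: ring_of_type_algebra_def)
    then show ?case using g(2,4) regular_ops(1)[of g1 g2] by metis
  qed
  show ?thesis
  proof
    show "?G <+>\<^bsub>k_ty\<^esub> PIdl\<^bsub>k_ty\<^esub> f \<subseteq> kty.VR"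
    proof -
      have "\<phi> (g + h) = \<phi> g" if "f dvd h" for g h
        using that kernel by (simp add: \<phi>_add)
      then show ?thesis
        using kty.adjoin_subset_VR[OF consts_VR(2) rV] unfolding sum kty_VR by auto
    qed
    show "kty.VR \<subseteq> ?G <+>\<^bsub>k_ty\<^esub> PIdl\<^bsub>k_ty\<^esub> f"
    proof
      fix g assume "g \<in> kty.VR"
      then have "\<rho> g \<in> reg.VR" unfolding kty_VR reg_VR by blast
      then obtain g' where g': "g' \<in> ?G" "\<rho> g' = \<rho> g" using lift unfolding gen by blast
      then have "\<phi> (g - g') = 0" using \<rho>_eq_iff[of g' g] by (simp add: \<phi>_diff)
      then have "g = g' + (g - g')" "f dvd g - g'" using kernel by auto
      then show "g \<in> ?G <+>\<^bsub>k_ty\<^esub> PIdl\<^bsub>k_ty\<^esub> f" unfolding sum using g'(1) by blast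
    qed
  qed
qed

text \<open>In the linear coordinates \<open>l\<close> and \<open>l'\<close> the pole orders are
  those of \<open>1 / \<zeta>\<close> and \<open>\<eta> / \<zeta>\<close>, namely \<open>i\<close>
  and \<open>i - 1\<close>. A linear substitution preserves automorphisms, so
  \<open>coordinate_has_pole\<close> applies to \<open>lin a b a' b' g\<close>.\<close>

lemma no_coordinate_VR:
  assumes "\<eta> = fls_X" "fls_subdegree \<zeta> \<ge> 3" "g \<in> kty.VR"
  shows "\<not> coordinate g"
proof
  note hc = coeff_hom_cconst[where 'a = 'a]
  assume "coordinate g"
  then obtain V F G where inv: "left_inverse_pair g V F G" "left_inverse_pair F G g V"
    using coordinate_inverse by blast
  let ?D = "a * b' - a' * b"
  let ?L1 = "cconst a * tvar + cconst a' * yvar" and ?L2 = "cconst b * tvar + cconst b' * yvar"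
  have lin: "lin a b a' b' h = ev cconst h ?L1 ?L2" for h by (simp only: lin_def)
  have L: "ev cconst l ?L1 ?L2 = tvar" "ev cconst l' ?L1 ?L2 = yvar"
    using det unfolding l_def l'_def coeff_hom.ev_diff[OF hc] coeff_hom.ev_mult[OF hc]
      coeff_hom.ev_cconst[OF hc] coeff_hom.ev_tvar[OF hc] coeff_hom.ev_yvar[OF hc]
    by (auto simp: field_simps simp flip: diff_divide_distrib)
  have L': "ev cconst ?L1 l l' = tvar" "ev cconst ?L2 l l' = yvar"
    using det unfolding l_def l'_def coeff_hom.ev_add[OF hc] coeff_hom.ev_mult[OF hc]
      coeff_hom.ev_cconst[OF hc] coeff_hom.ev_tvar[OF hc] coeff_hom.ev_yvar[OF hc]
    by (auto simp: field_simps simp flip: diff_divide_distrib)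
  define F' G' where "F' = ev cconst l F G" "G' = ev cconst l' F G"
  have a: "ev cconst (lin a b a' b' h) F' G' = ev cconst h F G" for h
  proof -
    have "ev cconst (lin a b a' b' h) F' G'
        = ev cconst h (ev cconst (ev cconst ?L1 l l') F G) (ev cconst (ev cconst ?L2 l l') F G)"
      unfolding lin F'_G'_def by (simp only: coeff_hom.ev_ev[OF hc])
    then show ?thesis unfolding L' by (simp only: coeff_hom.ev_tvar[OF hc] coeff_hom.ev_yvar[OF hc])
  qed
  have b: "ev cconst (ev cconst h F G) (lin a b a' b' g) (lin a b a' b' V) = ev cconst h ?L1 ?L2" for h
  proof -
    have "ev cconst (ev cconst h F G) (lin a b a' b' g) (lin a b a' b' V)
        = ev cconst h (ev cconst (ev cconst F g V) ?L1 ?L2) (ev cconst (ev cconst G g V) ?L1 ?L2)"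
      unfolding lin by (simp only: coeff_hom.ev_ev[OF hc])
    then show ?thesis using inv(2) unfolding left_inverse_pair_def
      by (simp only: coeff_hom.ev_tvar[OF hc] coeff_hom.ev_yvar[OF hc])
  qed
  have inv': "left_inverse_pair (lin a b a' b' g) (lin a b a' b' V) F' G'"
    "left_inverse_pair F' G' (lin a b a' b' g) (lin a b a' b' V)"
    using inv(1) unfolding left_inverse_pair_def a by (simp_all only: F'_G'_def b L)
  define i where "i = nat (fls_subdegree \<zeta>)"
  have "fls_subdegree (1 / \<zeta>) = - int i" "fls_subdegree (\<eta> / \<zeta>) = 1 - int i" "i \<ge> 3"
    using assms(1,2) \<zeta>(2) by (simp_all add: i_def fls_divide_subdegree)
  from coordinate_has_pole[OF inv' this]
  have "\<not> vge 0 (\<phi> g)"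
    unfolding ev_lin[OF coeff_hom_fls_const] \<phi>_def T_def Y_def .
  then show False using assms(3) kty_VR by simp
qed

end

section \<open>The projective closure\<close>

text \<open>Primality comes from geometry: if \<open>f\<close> divides \<open>u * v\<close>, the
  curve is the union of its parts with \<open>u = 0\<close> and \<open>v = 0\<close>, and one of
  them is the whole curve. The curve is the entire zero set of \<open>f\<close> because all its
  equations are multiples of \<open>f\<close>.\<close>

lemma defined_by_prime:
  fixes f :: "'a::alg_closed_field poly poly"
  assumes C: "irreducible_closed C" and f: "defined_by C f"
  shows "f \<noteq> 0" "C = {x. eval2 f x = 0}" "C \<noteq> {}"
    "\<And>g. (\<forall>x\<in>C. eval2 g x = 0) \<longleftrightarrow> f dvd g" "\<And>u v. f dvd u * v \<Longrightarrow> f dvd u \<or> f dvd v"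
proof -
  show f0: "f \<noteq> 0" using f by (auto simp: defined_by_def)
  show vanish: "(\<forall>x\<in>C. eval2 g x = 0) \<longleftrightarrow> f dvd g" for g
    using f unfolding defined_by_def PIdl_kty vanishing_ideal_def by blast
  show "C \<noteq> {}" using C by (simp add: irreducible_closed_def)
  obtain S where S: "C = {x. \<forall>g\<in>S. eval2 g x = 0}"
    using C unfolding irreducible_closed_def affine_closed_def by blast
  show "C = {x. eval2 f x = 0}"
  proof
    show "C \<subseteq> {x. eval2 f x = 0}" using vanish[of f] by auto
    show "{x. eval2 f x = 0} \<subseteq> C"
    proof
      fix x assume x: "x \<in> {x. eval2 f x = 0}"
      have "eval2 g x = 0" if "g \<in> S" for g
      proof -
        have "f dvd g" using that S vanish by blast
        then obtain h where "g = f * h" by (elim dvdE)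
        then show ?thesis using x by (simp add: eval2_mult)
      qed
      then show "x \<in> C" unfolding S by blast
    qed
  qed
  fix u v assume uv: "f dvd u * v"
  let ?Z = "\<lambda>u. {x. \<forall>g\<in>insert u S. eval2 g x = 0}"
  have "C = ?Z u \<union> ?Z v"
    using uv vanish[of "u * v"] unfolding S by (auto simp: eval2_mult)
  moreover have "affine_closed (?Z u)" "affine_closed (?Z v)"
    unfolding affine_closed_def by blast+
  ultimately have "C = ?Z u \<or> C = ?Z v" using C unfolding irreducible_closed_def by blast
  then have "(\<forall>x\<in>C. eval2 u x = 0) \<or> (\<forall>x\<in>C. eval2 v x = 0)" by blast
  then show "f dvd u \<or> f dvd v" unfolding vanish .
qed

lemma hpoint_eqI: "s \<noteq> 0 \<Longrightarrow> hpoint (s * x, s * y, s * z) = hpoint (x, y, z :: 'a::field)"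
  unfolding hpoint_def
  by (auto intro: exI[of _ "s' * s" for s'] exI[of _ "s' / s" for s'])

lemma mem_hpoint: "(x, y, z :: 'a::field) \<in> hpoint (x, y, z)"
  by (auto simp: hpoint_def intro: exI[of _ 1])

lemma hpoint_eqD:
  assumes "hpoint (x, y, z) = hpoint (x', y', z' :: 'a::field)"
  shows "\<exists>s. s \<noteq> 0 \<and> x = s * x' \<and> y = s * y' \<and> z = s * z'"
  using mem_hpoint[of x y z] unfolding assms by (auto simp: hpoint_def)

lemma hpoint_in_embed_iff: "hpoint (x, y, z) \<in> range embed_plane \<longleftrightarrow> z \<noteq> (0 :: 'a::field)"
proof
  assume "hpoint (x, y, z) \<in> range embed_plane"
  then obtain s where "s \<noteq> 0" "z = s * 1" unfolding embed_plane_def using hpoint_eqD by blast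
  then show "z \<noteq> 0" by simp
next
  assume "z \<noteq> 0"
  then have "hpoint (x, y, z) = embed_plane (x / z, y / z)"
    using hpoint_eqI[of z "x / z" "y / z" 1] by (simp add: embed_plane_def)
  then show "hpoint (x, y, z) \<in> range embed_plane" by blast
qed

lemma closure_subset_zeros:
  fixes f :: "'a::field poly poly"
  assumes F: "homogeneous d F" "poly F 1 = f" and C: "\<And>x. x \<in> C \<Longrightarrow> eval2 f x = 0"
    and r: "hpoint (x, y, z) \<in> proj_closed hull (embed_plane ` C)"
  shows "hval (\<lambda>c. c) d f x y z = 0"
proof -
  let ?Z = "{p \<in> P2. \<forall>G\<in>{F}. vanishes_at G p}"
  have "proj_closed ?Z" unfolding proj_closed_def using F(1) by blast
  moreover have "embed_plane ` C \<subseteq> ?Z"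
  proof safe
    fix s t assume st: "(s, t) \<in> C"
    show "embed_plane (s, t) \<in> P2" by (auto simp: embed_plane_def P2_def)
    show "vanishes_at F (embed_plane (s, t))"
      using C[OF st] F by (simp add: embed_plane_def vanishes_at_hpoint eval3_1)
  qed
  ultimately have "proj_closed hull (embed_plane ` C) \<subseteq> ?Z" by (intro hull_minimal)
  then have "vanishes_at F (hpoint (x, y, z))" using r by blast
  then show ?thesis using F by (simp add: vanishes_at_hpoint eval3_homogeneous)
qed

lemma proj_closed_P2: "proj_closed P2"
  unfolding proj_closed_def by (intro exI[of _ "{}"]) auto

text \<open>A point of the closure with nonzero third coordinate is an affine zero of
  \<open>f\<close>, hence lies on the curve itself.\<close>

lemma point_at_infinity:
  fixes f :: "'a::field poly poly"
  assumes f: "tdeg_le d f" and C: "C = {x. eval2 f x = 0}"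
    and r: "r \<in> proj_closed hull (embed_plane ` C)" "r \<notin> embed_plane ` C"
  shows "\<exists>a b. r = hpoint (a, b, 0) \<and> (a, b) \<noteq> (0, 0) \<and> hval (\<lambda>c. c) d f a b 0 = 0"
proof -
  obtain F where F: "homogeneous d F" "poly F 1 = f" using ex_homogenization[OF f] .
  have "proj_closed hull (embed_plane ` C) \<subseteq> P2"
    by (intro hull_minimal proj_closed_P2) (auto simp: embed_plane_def P2_def)
  then obtain x y z where xyz: "r = hpoint (x, y, z)" "(x, y, z) \<noteq> (0, 0, 0)"
    using r(1) unfolding P2_def by force
  have h: "hval (\<lambda>c. c) d f x' y' z' = 0" if "r = hpoint (x', y', z')" for x' y' z'
    using closure_subset_zeros[OF F, of C x' y' z'] C r(1) that by auto
  have "z = 0"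
  proof (rule ccontr)
    assume z: "z \<noteq> 0"
    then have e: "r = embed_plane (x / z, y / z)"
      using hpoint_eqI[of z "x / z" "y / z" 1] by (simp add: embed_plane_def xyz)
    then have "hval (\<lambda>c. c) d f (x / z) (y / z) 1 = 0" by (intro h) (simp add: embed_plane_def)
    then have "(x / z, y / z) \<in> C"
      by (simp add: C eval2_eq_ev hval_1[OF coeff_hom_id f])
    then show False using e r(2) by blast
  qed
  then show ?thesis using xyz h by blast
qed

lemma hpoints_distinct_det:
  fixes a b a' b' :: "'a::field"
  assumes "hpoint (a, b, 0) \<noteq> hpoint (a', b', 0)" "(a, b) \<noteq> (0, 0)" "(a', b') \<noteq> (0, 0)"
  shows "a * b' - a' * b \<noteq> 0"
proof
  assume det: "a * b' - a' * b = 0"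
  have "\<exists>s. s \<noteq> 0 \<and> a = s * a' \<and> b = s * b'"
  proof (cases "a' = 0")
    case True
    then have "b' \<noteq> 0" "a = 0" using det assms by auto
    then show ?thesis using True assms by (intro exI[of _ "b / b'"]) auto
  next
    case False
    then have "b = a / a' * b'" using det by (simp add: field_simps)
    moreover from this have "a \<noteq> 0" using assms by auto
    ultimately show ?thesis using False by (intro exI[of _ "a / a'"]) auto
  qed
  then show False using assms(1) hpoint_eqI[of _ a' b' 0] by force
qed

text \<open>If the transformed top form vanished, the inverse matrix would make the original one
  vanish at all \<open>[1:y:0]\<close>, and then all its coefficients would be zero.\<close>

lemma lin_top_form:
  fixes f :: "'a::alg_closed_field poly poly"
  assumes f: "tdeg_le (Suc d) f" "\<exists>i\<le>Suc d. cf f i (Suc d - i) \<noteq> 0" and det: "a * b' - a' * b \<noteq> 0"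
  shows "\<exists>j\<le>Suc d. cf (lin a b a' b' f) (Suc d - j) j \<noteq> 0"
proof (rule ccontr)
  assume "\<not> ?thesis"
  then have 0: "hval (\<lambda>c. c) (Suc d) (lin a b a' b' f) x y 0 = 0" for x y
    by (simp add: hval_Suc top_form_def)
  let ?D = "a * b' - a' * b"
  have "hval (\<lambda>c. c) (Suc d) f 1 y 0 = 0" for y
  proof -
    have e: "a * ((b' - a' * y) / ?D) + a' * ((a * y - b) / ?D) = 1"
      "b * ((b' - a' * y) / ?D) + b' * ((a * y - b) / ?D) = y"
    proof -
      have d: "k * (u / ?D) + k' * (w / ?D) = (k * u + k' * w) / ?D" for k u k' w
        by (simp add: add_divide_distrib)
      have "a * (b' - a' * y) + a' * (a * y - b) = ?D" "b * (b' - a' * y) + b' * (a * y - b) = y * ?D"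
        by (simp_all add: algebra_simps)
      then show "a * ((b' - a' * y) / ?D) + a' * ((a * y - b) / ?D) = 1"
        "b * ((b' - a' * y) / ?D) + b' * ((a * y - b) / ?D) = y"
        unfolding d using det by simp_all
    qed
    show ?thesis
      using 0[of "(b' - a' * y) / ?D" "(a * y - b) / ?D"] unfolding hval_lin[OF f(1)] e .
  qed
  then have "poly (\<Sum>j\<le>Suc d. Polynomial.monom (cf f (Suc d - j) j) j) y = 0" for y
    by (simp add: hval_Suc top_form_def poly_sum Polynomial.poly_monom)
  then have z: "(\<Sum>j\<le>Suc d. Polynomial.monom (cf f (Suc d - j) j) j) = 0"
    by (intro poly_eq_0_cofinite[of "{}"]) auto
  obtain i where i: "i \<le> Suc d" "cf f i (Suc d - i) \<noteq> 0" using f(2) by blast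
  have "Polynomial.coeff (\<Sum>j\<le>Suc d. Polynomial.monom (cf f (Suc d - j) j) j) (Suc d - i) = cf f i (Suc d - i)"
    using i(1) by (simp only: coeff_sum coeff_monom sum.delta finite_atMost) simp
  then show False using i(2) unfolding z by simp
qed

subsection \<open>Smoothness\<close>

lemma linear_coeff_unique:
  fixes P R :: "'a::alg_closed_field poly"
  assumes "\<And>e. A + e * G + e\<^sup>2 * poly R e = poly P e"
  shows "G = Polynomial.coeff P 1"
proof -
  have "[:A, G:] + [:0, 0, 1:] * R - P = 0"
    by (rule poly_eq_0_cofinite[of "{}"]) (simp_all add: assms[symmetric] power2_eq_square algebra_simps)
  then have "Polynomial.coeff ([:A, G:] + [:0, 0, 1:] * R - P) 1 = 0" by simp
  then show ?thesis by simp
qed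

lemma hval_axis:
  "hval (\<lambda>c. c) n g x 0 0 = cf g n 0 * (x :: 'a::field) ^ n"
  "hval (\<lambda>c. c) n g x e 0 = poly (\<Sum>j\<le>n. Polynomial.monom (cf g (n - j) j * x ^ (n - j)) j) e"
  "hval (\<lambda>c. c) n g x 0 e = poly (\<Sum>j\<le>n. Polynomial.monom (cf g (n - j) 0 * x ^ (n - j)) j) e"
proof -
  have t: "inj_on (\<lambda>j. (n - j, j)) {..n}" "(\<lambda>j. (n - j, j)) ` {..n} \<subseteq> tri n"
    "inj_on (\<lambda>j. (n - j, 0::nat)) {..n}" "(\<lambda>j. (n - j, 0)) ` {..n} \<subseteq> tri n"
    by (auto simp: inj_on_def tri_def)
  have "hval (\<lambda>c. c) n g x 0 0 = (\<Sum>(i, j)\<in>{(n, 0)}. cf g i j * x ^ i * 0 ^ j * 0 ^ (n - i - j))"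
    unfolding hval_def
    by (rule sum.mono_neutral_right[OF finite_tri]) (auto simp: tri_def power_0_left split: if_splits)
  then show "hval (\<lambda>c. c) n g x 0 0 = cf g n 0 * x ^ n" by simp
  have "hval (\<lambda>c. c) n g x e 0
      = (\<Sum>(i, j)\<in>(\<lambda>j. (n - j, j)) ` {..n}. cf g i j * x ^ i * e ^ j * 0 ^ (n - i - j))"
    unfolding hval_def
    by (rule sum.mono_neutral_right[OF finite_tri]) (use t in \<open>auto simp: tri_def power_0_left image_iff split: if_splits\<close>)
  also have "\<dots> = (\<Sum>j\<le>n. cf g (n - j) j * x ^ (n - j) * e ^ j)"
    by (subst sum.reindex[OF t(1)]) (intro sum.cong; simp)
  finally show "hval (\<lambda>c. c) n g x e 0
      = poly (\<Sum>j\<le>n. Polynomial.monom (cf g (n - j) j * x ^ (n - j)) j) e"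
    by (simp add: poly_sum Polynomial.poly_monom)
  have "hval (\<lambda>c. c) n g x 0 e
      = (\<Sum>(i, j)\<in>(\<lambda>j. (n - j, 0)) ` {..n}. cf g i j * x ^ i * 0 ^ j * e ^ (n - i - j))"
    unfolding hval_def
  proof (rule sum.mono_neutral_right)
    show "\<forall>p\<in>tri n - (\<lambda>j. (n - j, 0)) ` {..n}. (case p of (i, j) \<Rightarrow> cf g i j * x ^ i * 0 ^ j * e ^ (n - i - j)) = 0"
    proof safe
      fix i j assume "(i, j) \<in> tri n" "(i, j) \<notin> (\<lambda>j. (n - j, 0)) ` {..n}"
      then have "j \<noteq> 0" by (auto simp: tri_def image_iff dest!: bspec[of _ _ "n - i"])
      then show "cf g i j * x ^ i * 0 ^ j * e ^ (n - i - j) = 0" by simp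
    qed
  qed (use t in auto)
  also have "\<dots> = (\<Sum>j\<le>n. cf g (n - j) 0 * x ^ (n - j) * e ^ j)"
    by (subst sum.reindex[OF t(3)]) (intro sum.cong; simp)
  finally show "hval (\<lambda>c. c) n g x 0 e
      = poly (\<Sum>j\<le>n. Polynomial.monom (cf g (n - j) 0 * x ^ (n - j)) j) e"
    by (simp add: poly_sum Polynomial.poly_monom)
qed

text \<open>The three coefficients are the value and the two transversal partial derivatives at
  \<open>[1:0:0]\<close> of the form; a multiple of a form singular there is singular there as
  well.\<close>

lemma singular_multiple:
  fixes f q :: "'a::field poly poly"
  assumes f: "tdeg_le (Suc d) f" "cf f (Suc d) 0 = 0" "cf f d 0 = 0" "cf f d 1 = 0"
    and q: "tdeg_le e q"
  shows "cf (f * q) (Suc d + e) 0 = 0" "cf (f * q) (d + e) 0 = 0" "cf (f * q) (d + e) 1 = 0"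
proof -
  have z: "cf f i' 0 * cf q (i - i') 0 = 0" if "i \<ge> d + e" "i' \<le> i" for i i'
  proof -
    have "i' > Suc d \<or> i' = Suc d \<or> i' = d \<or> i - i' > e" using that by linarith
    then show ?thesis using f tdeg_leD[OF f(1), of i' 0] tdeg_leD[OF q, of "i - i'" 0] by auto
  qed
  show "cf (f * q) (Suc d + e) 0 = 0" "cf (f * q) (d + e) 0 = 0"
    unfolding cf_mult by (intro sum.neutral ballI; use z in simp)+
  have z': "cf f i' j' * cf q (d + e - i') (1 - j') = 0" if "j' \<le> 1" "i' \<le> d + e" for i' j'
  proof (cases "i' + j' = Suc d")
    case True
    then have "(i' = Suc d \<and> j' = 0) \<or> (i' = d \<and> j' = 1)" using that by linarith
    then show ?thesis using f by auto
  next
    case False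
    then have "i' + j' > Suc d \<or> d + e - i' + (1 - j') > e" using that by linarith
    then show ?thesis using tdeg_leD[OF f(1), of i' j'] tdeg_leD[OF q, of "d + e - i'" "1 - j'"] by auto
  qed
  show "cf (f * q) (d + e) 1 = 0"
    unfolding cf_mult using z' by (intro sum.neutral ballI) auto
qed

text \<open>Total degrees add because leading monomials multiply. The bound permits homogenizing the
  cofactor to degree \<open>n - d\<close>.\<close>

lemma tdeg_le_cofactor:
  fixes f q :: "'a::field poly poly"
  assumes f: "tdeg_le d f" "\<exists>i\<le>d. cf f i (d - i) \<noteq> 0" and q: "q \<noteq> 0" and fq: "tdeg_le n (f * q)"
  shows "\<exists>e. tdeg_le e q \<and> d + e \<le> n"
proof -
  obtain d' i where d': "tdeg_le d' f" "i \<le> d'" "cf f i (d' - i) \<noteq> 0"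
    "\<And>i'. i < i' \<and> i' \<le> d' \<Longrightarrow> cf f i' (d' - i') = 0"
    using ex_total_degree[of f] f(2) by fastforce
  obtain e j where e: "tdeg_le e q" "j \<le> e" "cf q j (e - j) \<noteq> 0"
    "\<And>i'. j < i' \<and> i' \<le> e \<Longrightarrow> cf q i' (e - i') = 0"
    using ex_total_degree[OF q] by fastforce
  have "d \<le> d'" using d'(1) f(2) unfolding tdeg_le_def by (metis le_add_diff_inverse)
  have "cf (f * q) (i + j) (d' - i + (e - j)) \<noteq> 0"
    using cf_mult_top[of d' f i e q j] d' e by simp
  then have "d' + e \<le> n" using fq d'(2) e(2) unfolding tdeg_le_def by fastforce
  then show ?thesis using e(1) \<open>d \<le> d'\<close> by (intro exI[of _ e]) simp
qed

text \<open>\<open>smooth_point\<close> provides a form of some degree with nonzero gradient at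
  \<open>p\<close>, whose dehomogenization is a multiple of \<open>f\<close>. If the equation of the
  curve were singular at \<open>p\<close>, the derivatives of this form in the independent
  directions \<open>(a, b, 0)\<close>, \<open>(a', b', 0)\<close> and \<open>(0, 0, 1)\<close> would
  all vanish.\<close>

lemma smooth_point_coeffs:
  fixes f :: "'a::alg_closed_field poly poly"
  assumes f: "tdeg_le (Suc d) f" "\<exists>i\<le>Suc d. cf f i (Suc d - i) \<noteq> 0"
    and vanish: "\<And>g. (\<forall>x\<in>C. eval2 g x = 0) \<longleftrightarrow> f dvd g"
    and det: "a * b' - a' * b \<noteq> 0" and p: "cf (lin a b a' b' f) (Suc d) 0 = 0"
    and smooth: "smooth_point (proj_closed hull (embed_plane ` C)) (hpoint (a, b, 0))"
  shows "cf (lin a b a' b' f) d 0 \<noteq> 0 \<or> cf (lin a b a' b' f) d 1 \<noteq> 0"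
proof (rule ccontr)
  assume "\<not> ?thesis"
  then have c: "cf (lin a b a' b' f) d 0 = 0" "cf (lin a b a' b' f) d 1 = 0" by auto
  obtain n F where F: "homogeneous n F"
    and van: "\<forall>q\<in>proj_closed hull (embed_plane ` C). vanishes_at F q"
    and grad: "\<not> (vanishes_at (map_poly (map_poly pderiv) F) (hpoint (a, b, 0)) \<and>
      vanishes_at (map_poly pderiv F) (hpoint (a, b, 0)) \<and> vanishes_at (pderiv F) (hpoint (a, b, 0)))"
    using smooth unfolding smooth_point_def by blast
  define g where "g = poly F 1"
  have tg: "tdeg_le n g" unfolding g_def by (rule tdeg_le_dehomogenize[OF F])
  have "\<forall>x\<in>C. eval2 g x = 0"
  proof safe
    fix x y assume "(x, y) \<in> C"
    then have "embed_plane (x, y) \<in> proj_closed hull (embed_plane ` C)" by (intro hull_inc) blast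
    then have "vanishes_at F (embed_plane (x, y))" using van by blast
    then show "eval2 g (x, y) = 0"
      by (simp add: embed_plane_def vanishes_at_hpoint[OF F] eval3_1 g_def)
  qed
  then obtain q where q: "g = f * q" unfolding vanish by (elim dvdE)
  let ?g = "lin a b a' b' g" and ?f = "lin a b a' b' f"
  have lq: "?g = ?f * lin a b a' b' q" unfolding q by (rule coeff_hom.mult[OF coeff_hom_lin])
  have cg: "cf ?g n 0 = 0 \<and> cf ?g (n - 1) 0 = 0 \<and> cf ?g (n - 1) 1 = 0"
  proof (cases "q = 0")
    case True
    then show ?thesis unfolding lq by (simp add: coeff_hom.zero[OF coeff_hom_lin])
  next
    case False
    obtain e where e: "tdeg_le e q" "Suc d + e \<le> n"
      using tdeg_le_cofactor[OF f False, of n] tg unfolding q by blast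
    then have "tdeg_le (n - Suc d) q" by (intro tdeg_le_mono[OF e(1)]) simp
    note * = singular_multiple[OF tdeg_le_lin[OF f(1)] p c tdeg_le_lin[OF this]]
    have "Suc d + (n - Suc d) = n" "d + (n - Suc d) = n - 1" using e(2) by auto
    then show ?thesis using * unfolding lq by simp
  qed
  \<comment> \<open>The base point is an arbitrary multiple \<open>(s * a, s * b, 0)\<close>, since
    \<open>vanishes_at\<close> ranges over all representatives of \<open>p\<close>.\<close>
  have dir: "u * eval3 (map_poly (map_poly pderiv) F) (s * a, s * b, 0)
      + v * eval3 (map_poly pderiv F) (s * a, s * b, 0) + w * eval3 (pderiv F) (s * a, s * b, 0)
      = Polynomial.coeff P 1"
    if "\<And>e. hval (\<lambda>c. c) n g (s * a + e * u) (s * b + e * v) (0 + e * w) = poly P e"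
    for u v w s P
  proof -
    obtain R where "\<And>e. eval3 F (s * a + e * u, s * b + e * v, 0 + e * w) = eval3 F (s * a, s * b, 0)
      + e * (u * eval3 (map_poly (map_poly pderiv) F) (s * a, s * b, 0)
        + v * eval3 (map_poly pderiv F) (s * a, s * b, 0) + w * eval3 (pderiv F) (s * a, s * b, 0))
      + e\<^sup>2 * poly R e"
      using eval3_directional[of F "s * a" u "s * b" v 0 w] by blast
    then have "eval3 F (s * a, s * b, 0)
      + e * (u * eval3 (map_poly (map_poly pderiv) F) (s * a, s * b, 0)
        + v * eval3 (map_poly pderiv F) (s * a, s * b, 0) + w * eval3 (pderiv F) (s * a, s * b, 0))
      + e\<^sup>2 * poly R e = poly P e" for e
      using that[of e] unfolding eval3_homogeneous[OF F] g_def by simp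
    then show ?thesis by (rule linear_coeff_unique)
  qed
  have hl: "hval (\<lambda>c. c) n g (a * x + a' * y) (b * x + b' * y) z = hval (\<lambda>c. c) n ?g x y z" for x y z
    by (rule hval_lin[OF tg, symmetric])
  have zero: "eval3 (map_poly (map_poly pderiv) F) (s * a, s * b, 0) = 0 \<and>
    eval3 (map_poly pderiv F) (s * a, s * b, 0) = 0 \<and> eval3 (pderiv F) (s * a, s * b, 0) = 0" for s
  proof -
    let ?x = "eval3 (map_poly (map_poly pderiv) F) (s * a, s * b, 0)"
      and ?y = "eval3 (map_poly pderiv F) (s * a, s * b, 0)" and ?z = "eval3 (pderiv F) (s * a, s * b, 0)"
    have "hval (\<lambda>c. c) n g (s * a + e * a) (s * b + e * b) (0 + e * 0) = poly 0 e" for e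
      using hl[of "s + e" 0 0] cg hval_axis(1)[of n ?g "s + e"] by (simp add: algebra_simps)
    from dir[OF this] have 1: "a * ?x + b * ?y = 0" by simp
    have "hval (\<lambda>c. c) n g (s * a + e * a') (s * b + e * b') (0 + e * 0)
        = poly (\<Sum>j\<le>n. Polynomial.monom (cf ?g (n - j) j * s ^ (n - j)) j) e" for e
      using hl[of s e 0] hval_axis(2)[of n ?g s e] by (simp add: algebra_simps)
    from dir[OF this] have 2: "a' * ?x + b' * ?y = 0" using cg by (simp add: coeff_sum)
    have "hval (\<lambda>c. c) n g (s * a + e * 0) (s * b + e * 0) (0 + e * 1)
        = poly (\<Sum>j\<le>n. Polynomial.monom (cf ?g (n - j) 0 * s ^ (n - j)) j) e" for e
      using hl[of s 0 e] hval_axis(3)[of n ?g s e] by (simp add: algebra_simps)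
    from dir[OF this] have 3: "?z = 0" using cg by (simp add: coeff_sum)
    have "(a * b' - a' * b) * ?x = b' * (a * ?x + b * ?y) - b * (a' * ?x + b' * ?y)"
      "(a * b' - a' * b) * ?y = a * (a' * ?x + b' * ?y) - a' * (a * ?x + b * ?y)"
      by (simp_all add: algebra_simps)
    then have "?x = 0" "?y = 0" unfolding 1 2 using det by simp_all
    then show ?thesis using 3 by blast
  qed
  have "vanishes_at G (hpoint (a, b, 0))" if "\<And>s. eval3 G (s * a, s * b, 0) = 0" for G
    using that unfolding vanishes_at_def hpoint_def by auto
  then show False using zero grad by blast
qed

subsection \<open>Tangency\<close>

lemma blowup_tower_2:
  assumes "blowup_tower p 2 \<psi> E"
  shows "\<exists>\<phi>\<in>standard_charts. \<exists>c. \<phi> c = p \<and> (\<exists>\<beta>\<in>blowup_charts c. \<exists>c'\<in>\<beta> -` {c}.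
    \<exists>\<beta>'\<in>blowup_charts c'. \<psi> = (\<phi> \<circ> \<beta>) \<circ> \<beta>' \<and> E = \<beta>' -` {c'})"
proof -
  have pos: "m \<noteq> 0" if "blowup_tower p m \<psi>' E'" for m \<psi>' E'
    using that by (induction rule: blowup_tower.induct) auto
  have one: "\<exists>\<phi>\<in>standard_charts. \<exists>c. \<phi> c = p \<and> (\<exists>\<beta>\<in>blowup_charts c. \<psi>' = \<phi> \<circ> \<beta> \<and> E' = \<beta> -` {c})"
    if "blowup_tower p (Suc 0) \<psi>' E'" for \<psi>' E'
    using that
  proof (cases rule: blowup_tower.cases)
    case (first \<phi> c \<beta>)
    then show ?thesis by blast
  next
    case further
    then show ?thesis using pos by blast
  qed
  have "blowup_tower p (Suc (Suc 0)) \<psi> E" using assms by (simp add: numeral_2_eq_2)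
  then obtain m \<psi>' E' c' \<beta>' where *: "Suc (Suc 0) = Suc m" "blowup_tower p m \<psi>' E'" "c' \<in> E'"
    "\<beta>' \<in> blowup_charts c'" "\<psi> = \<psi>' \<circ> \<beta>'" "E = \<beta>' -` {c'}"
    by (cases rule: blowup_tower.cases) auto
  then have "blowup_tower p (Suc 0) \<psi>' E'" by simp
  from one[OF this] obtain \<phi> c \<beta> where "\<phi> \<in> standard_charts" "\<phi> c = p" "\<beta> \<in> blowup_charts c"
    "\<psi>' = \<phi> \<circ> \<beta>" "E' = \<beta> -` {c}" by blast
  then show ?thesis using *(3-6) by blast
qed

lemma affine_closed_zeros: "affine_closed {x. eval2 g x = 0}"
  unfolding affine_closed_def by (intro exI[of _ "{g}"]) auto

text \<open>An equation that holds away from \<open>p\<close> persists on the closure; so points of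
  a strict transform are controlled by exhibiting equations.\<close>

lemma strict_transform_subset:
  assumes "\<And>x. \<psi> x \<in> D - {p} \<Longrightarrow> eval2 g x = 0"
  shows "strict_transform p \<psi> D \<subseteq> {x. eval2 g x = 0}"
  unfolding strict_transform_def by (rule hull_minimal) (use assms affine_closed_zeros in auto)

text \<open>Near a point at infinity, each standard chart has the shape \<open>\<Phi>\<close> below, with the
  line at infinity given by \<open>v = 0\<close>.\<close>

lemma tower_2_at_infinity:
  fixes \<Phi> :: "'a::field \<Rightarrow> 'a \<Rightarrow> ('a \<times> 'a \<times> 'a) set"
  assumes L: "\<And>u v. \<Phi> u v \<in> L \<longleftrightarrow> v = 0" and p: "\<Phi> c 0 = p"
    and \<beta>: "\<beta> \<in> blowup_charts (c, 0)" "c' \<in> \<beta> -` {(c, 0)}" "\<beta>' \<in> blowup_charts c'"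
    and \<psi>: "\<psi> = ((\<lambda>(u, v). \<Phi> u v) \<circ> \<beta>) \<circ> \<beta>'" and E: "E = \<beta>' -` {c'}"
    and w: "w \<in> strict_transform p \<psi> L" "w \<in> E"
  shows "w = (0, 0)" "\<And>u v. \<psi> (u, v) = \<Phi> (c + u) (u * (u * v))"
proof -
  have empty: False if "\<And>x. \<psi> x \<notin> L - {p}"
    using strict_transform_subset[of \<psi> L p "cconst 1"] that w(1) by (auto simp: eval2_def)
  \<comment> \<open>In the other chart every point over \<open>L\<close> lies over \<open>p\<close>,
    so the strict transform of \<open>L\<close> is empty there.\<close>
  have \<beta>1: "\<beta> = (\<lambda>(u, v). (c + u, u * v))"
  proof (rule ccontr)
    assume "\<beta> \<noteq> (\<lambda>(u, v). (c + u, u * v))"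
    then have b: "\<beta> = (\<lambda>(u, v). (c + u * v, v))" using \<beta>(1) by (auto simp: blowup_charts_def)
    have "\<psi> x \<notin> L - {p}" for x
      using L p by (cases "\<beta>' x") (auto simp: \<psi> b)
    then show False by (rule empty)
  qed
  then obtain e where c': "c' = (0, e)" using \<beta>(2) by (cases c') auto
  have on_L: "\<Phi> (c + u) (u * v) \<in> L - {p} \<Longrightarrow> u \<noteq> 0 \<and> v = 0" for u v
    using L p by auto
  have on_L': "eval2 g y = 0"
    if "\<psi> y \<in> L - {p}" "\<And>u v. y = (u, v) \<Longrightarrow> \<psi> (u, v) = \<Phi> (c + s u v) (s u v * t u v)"
      "\<And>u v. s u v \<noteq> 0 \<Longrightarrow> t u v = 0 \<Longrightarrow> eval2 g (u, v) = 0" for y g and s t :: "'a \<Rightarrow> 'a \<Rightarrow> 'a"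
  proof -
    obtain u v where y: "y = (u, v)" by (cases y)
    have "\<Phi> (c + s u v) (s u v * t u v) \<in> L - {p}" using that(1) that(2)[OF y] y by simp
    from on_L[OF this] show ?thesis using that(3) y by simp
  qed
  \<comment> \<open>The strict transform of \<open>L\<close> meets the first exceptional divisor
    \<open>u = 0\<close> only at the origin, so the second center has \<open>e = 0\<close>; the
    other chart of this blow-up misses the strict transform again.\<close>
  have \<beta>'1: "\<beta>' = (\<lambda>(u, v). (u, e + u * v))" and e0: "e = 0"
  proof -
    consider "\<beta>' = (\<lambda>(u, v). (u, e + u * v))" | "\<beta>' = (\<lambda>(u, v). (u * v, e + v))"
      using \<beta>(3) by (auto simp: blowup_charts_def c')
    then have "\<beta>' = (\<lambda>(u, v). (u, e + u * v)) \<and> e = 0"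
    proof cases
      case 1
      let ?g = "cconst e + tvar * yvar"
      have "strict_transform p \<psi> L \<subseteq> {x. eval2 ?g x = 0}"
        by (rule strict_transform_subset, erule on_L'[where s = "\<lambda>u v. u" and t = "\<lambda>u v. e + u * v"])
          (simp_all add: \<psi> \<beta>1 1 eval2_def)
      then have "eval2 ?g w = 0" using w(1) by blast
      then show ?thesis using 1 w(2) by (cases w) (auto simp: E c' eval2_def)
    next
      case 2
      let ?g = "cconst e + yvar"
      have "strict_transform p \<psi> L \<subseteq> {x. eval2 ?g x = 0}"
        by (rule strict_transform_subset, erule on_L'[where s = "\<lambda>u v. u * v" and t = "\<lambda>u v. e + v"])
          (simp_all add: \<psi> \<beta>1 2 eval2_def)
      then have "eval2 ?g w = 0" using w(1) by blast
      then have "e = 0" using w(2) by (cases w) (auto simp: E c' 2 eval2_def)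
      have "\<psi> x \<notin> L - {p}" for x
      proof
        assume "\<psi> x \<in> L - {p}"
        moreover obtain u v where x: "x = (u, v)" by (cases x)
        ultimately have "\<Phi> (c + u * v) (u * v * v) \<in> L - {p}" by (simp add: \<psi> \<beta>1 2 \<open>e = 0\<close>)
        from on_L[OF this] show False by simp
      qed
      then show ?thesis using empty by blast
    qed
    then show "\<beta>' = (\<lambda>(u, v). (u, e + u * v))" "e = 0" by auto
  qed
  have "strict_transform p \<psi> L \<subseteq> {x. eval2 yvar x = 0}"
    by (rule strict_transform_subset, erule on_L'[where s = "\<lambda>u v. u" and t = "\<lambda>u v. u * v"])
      (simp_all add: \<psi> \<beta>1 \<beta>'1 e0 eval2_def)
  then have "eval2 yvar w = 0" using w(1) by blast
  then show "w = (0, 0)" using w(2) by (cases w) (auto simp: E c' \<beta>'1 e0 eval2_def)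
  show "\<psi> (u, v) = \<Phi> (c + u) (u * (u * v))" for u v
    by (simp add: \<psi> \<beta>1 \<beta>'1 e0)
qed

lemma coeff_hom_eval2: "coeff_hom (\<lambda>g. eval2 g x)"
proof (cases x)
  case (Pair u v)
  show ?thesis unfolding Pair eval2_eq_ev by (rule coeff_hom_ev[OF coeff_hom_id])
qed

text \<open>If the intersection number of the curve with the line at infinity is \<open>m \<le> 2\<close>, the strict
  transform of the curve is given by an equation obtained by division by \<open>u\<^sup>m\<close>, which does not
  vanish at the origin.\<close>

lemma tangent_coeffs_aux:
  fixes h :: "'a::field poly poly"
  assumes c0: "cf h (Suc d) 0 = 0" and \<kappa>: "\<kappa> \<noteq> 0" "\<kappa>2 \<noteq> 0"
    and \<Gamma>: "\<And>u v. \<psi> (u, v) \<in> \<Gamma> - {p} \<Longrightarrow> u \<noteq> 0 \<and>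
      hval (\<lambda>c. c) (Suc d) h (\<kappa> + \<kappa>1 * u) (\<kappa>2 * u) (u * (u * v)) = 0"
    and w: "(0, 0) \<in> strict_transform p \<psi> \<Gamma>"
  shows "cf h d 1 = 0" "d \<ge> 1 \<Longrightarrow> cf h (d - 1) 2 = 0"
proof -
  define x :: "'a poly poly" where "x = cconst \<kappa> + cconst \<kappa>1 * tvar"
  define z :: "'a poly poly" where "z = tvar * (tvar * yvar)"
  define H where "H = hval cconst d h x (cconst \<kappa>2 * tvar) z"
  have vars: "eval2 tvar y = fst y" "eval2 yvar y = snd y" "eval2 x y = \<kappa> + \<kappa>1 * fst y"
    "eval2 z y = fst y * (fst y * snd y)" for y :: "'a \<times> 'a"
    by (simp_all add: eval2_def x_def z_def)
  note he = coeff_hom_eval2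
  have H: "eval2 H (u, v) = hval (\<lambda>c. c) d h (\<kappa> + \<kappa>1 * u) (\<kappa>2 * u) (u * (u * v))" for u v
    unfolding H_def using hom_hval[OF coeff_hom_eval2[of "(u, v)"], of cconst d h x "cconst \<kappa>2 * tvar" z]
    by (simp only: vars coeff_hom.mult[OF he] eval2_cconst fst_conv snd_conv)
  \<comment> \<open>For \<open>m + n = d + 1\<close> this is the top form, as a polynomial in
    \<open>u\<close>, without its first \<open>m\<close> terms and divided by
    \<open>u ^ m\<close>.\<close>
  define G where "G m n = (\<Sum>j\<le>n. cconst (cf h (n - j) (j + m) * \<kappa>2 ^ (j + m)) * x ^ (n - j) * tvar ^ j)" for m n
  have G: "eval2 (G m n) (u, v) = (\<Sum>j\<le>n. cf h (n - j) (j + m) * \<kappa>2 ^ (j + m) * (\<kappa> + \<kappa>1 * u) ^ (n - j) * u ^ j)" for m n u v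
    unfolding G_def coeff_hom.sum[OF he] coeff_hom.mult[OF he] coeff_hom.power[OF he] eval2_cconst vars by simp
  have G0: "eval2 (G m n) (0, 0) = cf h n m * \<kappa>2 ^ m * \<kappa> ^ n" for m n
    unfolding G by (cases n) (simp_all add: sum.atMost_Suc_shift)
  have shift: "(\<Sum>j\<le>Suc n. cf h (Suc n - j) (j + m) * \<kappa>2 ^ (j + m) * s ^ (Suc n - j) * u ^ j)
      = cf h (Suc n) m * \<kappa>2 ^ m * s ^ Suc n + u * (\<Sum>j\<le>n. cf h (n - j) (j + Suc m) * \<kappa>2 ^ (j + Suc m) * s ^ (n - j) * u ^ j)"
    for n m s u
    by (subst sum.atMost_Suc_shift) (simp add: sum_distrib_left mult_ac)
  have top: "top_form (\<lambda>c. c) (Suc d) h s (\<kappa>2 * u)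
      = (\<Sum>j\<le>Suc d. cf h (Suc d - j) (j + 0) * \<kappa>2 ^ (j + 0) * s ^ (Suc d - j) * u ^ j)" for s u
    unfolding top_form_def by (intro sum.cong) (simp_all add: power_mult_distrib mult_ac)
  \<comment> \<open>One factor \<open>u\<close> splits off by \<open>c0\<close>. Away from
    \<open>p\<close> it is nonzero, so the cofactor is still an equation of the strict transform,
    and its value at the origin gives the next coefficient.\<close>
  have 1: "hval (\<lambda>c. c) (Suc d) h (\<kappa> + \<kappa>1 * u) (\<kappa>2 * u) (u * (u * v))
      = u * eval2 (G 1 d + tvar * yvar * H) (u, v)" for u v
    unfolding hval_Suc top shift coeff_hom.add[OF he] coeff_hom.mult[OF he] vars G H c0
    by (simp add: algebra_simps)
  have "strict_transform p \<psi> \<Gamma> \<subseteq> {x. eval2 (G 1 d + tvar * yvar * H) x = 0}"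
    by (rule strict_transform_subset) (use \<Gamma> 1 in force)
  then have "eval2 (G 1 d + tvar * yvar * H) (0, 0) = 0" using w by blast
  then show c1: "cf h d 1 = 0"
    unfolding coeff_hom.add[OF he] coeff_hom.mult[OF he] vars G0 using \<kappa> by simp
  assume "d \<ge> 1"
  then obtain d' where d': "d = Suc d'" by (cases d) auto
  have 2: "eval2 (G 1 d + tvar * yvar * H) (u, v) = u * eval2 (G 2 d' + yvar * H) (u, v)" for u v
    unfolding coeff_hom.add[OF he] coeff_hom.mult[OF he] vars G d' shift using c1
    by (simp add: d' algebra_simps numeral_2_eq_2)
  have "strict_transform p \<psi> \<Gamma> \<subseteq> {x. eval2 (G 2 d' + yvar * H) x = 0}"
    by (rule strict_transform_subset) (use \<Gamma> 1 2 in force)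
  then have "eval2 (G 2 d' + yvar * H) (0, 0) = 0" using w by blast
  then have "cf h d' 2 * \<kappa>2\<^sup>2 * \<kappa> ^ d' = 0"
    unfolding coeff_hom.add[OF he] coeff_hom.mult[OF he] vars G0 by simp
  then show "cf h (d - 1) 2 = 0" using \<kappa> by (simp add: d')
qed

lemma P2_hpoint: "(x, y, z) \<noteq> (0, 0, 0) \<Longrightarrow> hpoint (x, y, z) \<in> P2"
  by (auto simp: P2_def)

lemma tangent_coeffs:
  fixes f :: "'a::alg_closed_field poly poly"
  assumes f: "tdeg_le (Suc d) f" and C: "C = {x. eval2 f x = 0}"
    and det: "a * b' - a' * b \<noteq> 0" and c0: "cf (lin a b a' b' f) (Suc d) 0 = 0"
    and tangent: "tangent_order_ge 2 (proj_closed hull (embed_plane ` C)) (P2 - range embed_plane) (hpoint (a, b, 0))"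
  shows "cf (lin a b a' b' f) d 1 = 0 \<and> (d \<ge> 1 \<longrightarrow> cf (lin a b a' b' f) (d - 1) 2 = 0)"
proof -
  let ?p = "hpoint (a, b, 0)" and ?L = "P2 - range embed_plane :: ('a \<times> 'a \<times> 'a) set set"
    and ?\<Gamma> = "proj_closed hull (embed_plane ` C)"
  obtain \<psi> E w where tower: "blowup_tower ?p 2 \<psi> E"
    and w: "w \<in> strict_transform ?p \<psi> ?L" "w \<in> strict_transform ?p \<psi> ?\<Gamma>" "w \<in> E"
    using tangent unfolding tangent_order_ge_def by blast
  obtain \<phi> c \<beta> c' \<beta>' where \<phi>: "\<phi> \<in> standard_charts" "\<phi> c = ?p"
    and \<beta>: "\<beta> \<in> blowup_charts c" "c' \<in> \<beta> -` {c}" "\<beta>' \<in> blowup_charts c'"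
    and \<psi>: "\<psi> = (\<phi> \<circ> \<beta>) \<circ> \<beta>'" and E: "E = \<beta>' -` {c'}"
    using blowup_tower_2[OF tower] by blast
  obtain c1 c2 where c: "c = (c1, c2)" by (cases c)
  obtain F where F: "homogeneous (Suc d) F" "poly F 1 = f" using ex_homogenization[OF f] .
  have main: ?thesis
    if \<Phi>: "\<phi> = (\<lambda>(u, v). hpoint (x0 + u * x1, y0 + u * y1, v))"
      and nz: "\<And>u. (x0 + u * x1, y0 + u * y1) \<noteq> (0, 0)" and ind: "x0 * y1 - x1 * y0 \<noteq> 0" for x0 x1 y0 y1
  proof -
    have p: "hpoint (x0 + c1 * x1, y0 + c1 * y1, c2) = ?p" using \<phi>(2) by (simp add: \<Phi> c)
    obtain s where s: "s \<noteq> 0" "x0 + c1 * x1 = s * a" "y0 + c1 * y1 = s * b" "c2 = 0"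
      using hpoint_eqD[OF p] by auto
    let ?D = "a * b' - a' * b"
    \<comment> \<open>The direction \<open>(x1, y1)\<close> of the chart in the basis
      \<open>(a, b)\<close>, \<open>(a', b')\<close>. That \<open>\<kappa>2\<close> is nonzero means
      that the chart moves away from \<open>p\<close> along the line at infinity.\<close>
    define \<kappa>1 \<kappa>2 where "\<kappa>1 = (b' * x1 - a' * y1) / ?D" "\<kappa>2 = (a * y1 - b * x1) / ?D"
    have e1: "a * \<kappa>1 + a' * \<kappa>2 = x1" and e2: "b * \<kappa>1 + b' * \<kappa>2 = y1"
    proof -
      have d: "k * (u / ?D) + k' * (w / ?D) = (k * u + k' * w) / ?D" for k u k' w
        by (simp add: add_divide_distrib)
      have "a * (b' * x1 - a' * y1) + a' * (a * y1 - b * x1) = x1 * ?D"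
        "b * (b' * x1 - a' * y1) + b' * (a * y1 - b * x1) = y1 * ?D"
        by (simp_all add: algebra_simps)
      then show "a * \<kappa>1 + a' * \<kappa>2 = x1" "b * \<kappa>1 + b' * \<kappa>2 = y1"
        unfolding \<kappa>1_\<kappa>2_def d using det by simp_all
    qed
    have "s * (a * y1 - b * x1) = (x0 + c1 * x1) * y1 - (y0 + c1 * y1) * x1"
      unfolding s by (simp add: algebra_simps)
    also have "\<dots> = x0 * y1 - x1 * y0" by (simp add: algebra_simps)
    finally have "a * y1 - b * x1 \<noteq> 0" using ind by auto
    then have \<kappa>2: "\<kappa>2 \<noteq> 0" using det by (simp add: \<kappa>1_\<kappa>2_def)
    define \<Psi> where "\<Psi> u v = hpoint (x0 + u * x1, y0 + u * y1, v)" for u v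
    have L: "\<Psi> u v \<in> ?L \<longleftrightarrow> v = 0" for u v
      unfolding \<Psi>_def using nz[of u] by (auto simp: hpoint_in_embed_iff intro!: P2_hpoint)
    have pc: "\<Psi> c1 0 = ?p" using p s(4) by (simp add: \<Psi>_def)
    have \<psi>': "\<psi> = ((\<lambda>(u, v). \<Psi> u v) \<circ> \<beta>) \<circ> \<beta>'" unfolding \<psi> \<Phi> \<Psi>_def ..
    note \<beta>' = \<beta>[unfolded c s(4)]
    note t = tower_2_at_infinity[OF L pc \<beta>' \<psi>' E w(1,3)]
    have "u \<noteq> 0 \<and> hval (\<lambda>c. c) (Suc d) (lin a b a' b' f) (s + \<kappa>1 * u) (\<kappa>2 * u) (u * (u * v)) = 0"
      if uv: "\<psi> (u, v) \<in> ?\<Gamma> - {?p}" for u v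
    proof
      show "u \<noteq> 0" using uv pc t(2)[of u v] by auto
      have "hpoint (x0 + (c1 + u) * x1, y0 + (c1 + u) * y1, u * (u * v)) \<in> ?\<Gamma>"
        using uv t(2)[of u v] by (simp add: \<Psi>_def)
      then have "hval (\<lambda>c. c) (Suc d) f (x0 + (c1 + u) * x1) (y0 + (c1 + u) * y1) (u * (u * v)) = 0"
        by (rule closure_subset_zeros[OF F, rotated]) (simp add: C)
      moreover have "x0 + (c1 + u) * x1 = a * (s + \<kappa>1 * u) + a' * (\<kappa>2 * u)"
        "y0 + (c1 + u) * y1 = b * (s + \<kappa>1 * u) + b' * (\<kappa>2 * u)"
      proof -
        have "x0 + (c1 + u) * x1 = s * a + u * (a * \<kappa>1 + a' * \<kappa>2)"
          "y0 + (c1 + u) * y1 = s * b + u * (b * \<kappa>1 + b' * \<kappa>2)"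
          unfolding e1 e2 s(2,3)[symmetric] by (simp_all add: algebra_simps)
        then show "x0 + (c1 + u) * x1 = a * (s + \<kappa>1 * u) + a' * (\<kappa>2 * u)"
          "y0 + (c1 + u) * y1 = b * (s + \<kappa>1 * u) + b' * (\<kappa>2 * u)"
          by (simp_all add: algebra_simps)
      qed
      ultimately show "hval (\<lambda>c. c) (Suc d) (lin a b a' b' f) (s + \<kappa>1 * u) (\<kappa>2 * u) (u * (u * v)) = 0"
        unfolding hval_lin[OF f] by simp
    qed
    from tangent_coeffs_aux[OF c0 s(1) \<kappa>2 this] w(2) show ?thesis unfolding t(1) by blast
  qed
  from \<phi>(1) consider "\<phi> = (\<lambda>(u, v). hpoint (1, u, v))" | "\<phi> = (\<lambda>(u, v). hpoint (u, 1, v))"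
    | "\<phi> = (\<lambda>(u, v). hpoint (u, v, 1))"
    by (auto simp: standard_charts_def)
  then show ?thesis
  proof cases
    case 1
    then show ?thesis by (intro main[of 1 0 0 1]) simp_all
  next
    case 2
    then show ?thesis by (intro main[of 0 1 1 0]) simp_all
  next
    case 3
    then have "hpoint (c1, c2, 1) = ?p" using \<phi>(2) by (simp add: c)
    from hpoint_eqD[OF this] show ?thesis by auto
  qed
qed

section \<open>The theorem\<close>

theorem mainTheorem6:
  fixes f :: "'a::alg_closed_field poly poly"
    and C :: "('a \<times> 'a) set"
    and \<Gamma> L :: "('a \<times> 'a \<times> 'a) set set"
    and p :: "('a \<times> 'a \<times> 'a) set"
    and A :: "('a \<times> 'a \<Rightarrow> 'a) set"
  assumes "irreducible_curve C"
    and "defined_by C f"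
    and "\<Gamma> = proj_closed hull (embed_plane ` C)"
    and "L = P2 - range embed_plane"
    and "smooth_point \<Gamma> p"
    and "p \<notin> embed_plane ` C"
    and "\<exists>q\<in>\<Gamma> - embed_plane ` C. \<exists>q'\<in>\<Gamma> - embed_plane ` C. q \<noteq> q'"
    and "A = {h \<in> carrier (regular_ring C). defined_at C p h}"
  shows "maximal_subalgebra (regular_consts C) A (regular_ring C) \<and>
    extending A (regular_ring C) \<and>
    finitely_generated_over (regular_ring C) (regular_consts C) A \<and>
    (\<forall>(k::nat) (a :: nat \<Rightarrow> 'a \<times> 'a \<Rightarrow> 'a) (r :: nat \<Rightarrow> 'a poly poly) B.
       (\<forall>i<k. a i \<in> A) \<and>
       adjoin (regular_ring C) (regular_consts C) (a ` {..<k}) = A \<and>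
       (\<forall>i<k. restrict (eval2 (r i)) C = a i) \<and>
       tangent_order_ge 2 \<Gamma> L p \<and>
       B = adjoin k_ty ty_consts (r ` {..<k}) <+>\<^bsub>k_ty\<^esub> PIdl\<^bsub>k_ty\<^esub> f \<longrightarrow>
       maximal_subalgebra ty_consts B k_ty \<and> extending B k_ty \<and>
       (\<forall>g\<in>B. \<not> coordinate g))"
  proof -
  note C = assms(1,2) and \<Gamma> = assms(3) and L = assms(4)
  have irr: "irreducible_closed C" using assms(1) by (simp add: irreducible_curve_def)
  note f = defined_by_prime[OF irr assms(2)]
  obtain D i where D: "tdeg_le D f" "i \<le> D" "cf f i (D - i) \<noteq> 0" using ex_total_degree[OF f(1)] by blast
  have "D \<noteq> 0"
  proof
    assume "D = 0"
    then have "eval2 f (x, y) = cf f 0 0" for x y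
      unfolding eval2_eq_ev using coeff_hom.ev_tri[OF coeff_hom_id D(1)] by (simp add: tri_def)
    then show False using f(2,3) D \<open>D = 0\<close> by force
  qed
  then obtain d where d: "D = Suc d" by (cases D) auto
  note D = D[unfolded d]
  have top: "\<exists>i\<le>Suc d. cf f i (Suc d - i) \<noteq> 0" using D by blast
  have "p \<in> \<Gamma>" using assms(5) by (simp add: smooth_point_def)
  then obtain a b where p: "p = hpoint (a, b, 0)" "(a, b) \<noteq> (0, 0)" "hval (\<lambda>c. c) (Suc d) f a b 0 = 0"
    using point_at_infinity[OF D(1) f(2)] assms(6) unfolding \<Gamma> by blast
  obtain q where q: "q \<in> \<Gamma> - embed_plane ` C" "q \<noteq> p" using assms(7) by metis
  then obtain a' b' where q': "q = hpoint (a', b', 0)" "(a', b') \<noteq> (0, 0)" "hval (\<lambda>c. c) (Suc d) f a' b' 0 = 0"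
    using point_at_infinity[OF D(1) f(2)] unfolding \<Gamma> by blast
  have det: "a * b' - a' * b \<noteq> 0"
    using hpoints_distinct_det[of a b a' b'] p q' q(2) by auto
  let ?f = "lin a b a' b' f"
  \<comment> \<open>In the new coordinates \<open>p\<close> and \<open>q\<close> are
    \<open>[1:0:0]\<close> and \<open>[0:1:0]\<close>; the two coefficients are the values there of
    the equation of the curve.\<close>
  have c0: "cf ?f (Suc d) 0 = 0" and c1: "cf ?f 0 (Suc d) = 0"
    using hval_lin[OF D(1), of a b a' b' 1 0 0] hval_lin[OF D(1), of a b a' b' 0 1 0] p(3) q'(3)
      hval_100[OF coeff_hom_id, of "Suc d" ?f] by simp_all
  have smooth: "cf ?f d 0 \<noteq> 0 \<or> cf ?f d 1 \<noteq> 0"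
    using smooth_point_coeffs[OF D(1) top f(4) det c0] assms(5) unfolding \<Gamma> p(1) by blast
  obtain \<eta> \<zeta> where place: "vge 1 \<eta>" "vge 1 \<zeta>" "hval fls_const (Suc d) ?f 1 \<eta> \<zeta> = 0" "fls_X \<in> {\<eta>, \<zeta>}"
    "\<zeta> \<noteq> 0" "fls_subdegree \<zeta> < int (Suc d)"
    "\<exists>W\<in>alg {\<eta>, \<zeta>}. fls_nth W 0 \<noteq> 0 \<and> (\<forall>x\<in>{\<eta>, \<zeta>}. \<exists>b\<in>alg {\<eta>, \<zeta>}. W * x = fls_X * b)"
    and tangent: "cf ?f d 1 = 0 \<and> (d \<ge> 1 \<longrightarrow> cf ?f (d - 1) 2 = 0) \<Longrightarrow> \<eta> = fls_X \<and> fls_subdegree \<zeta> \<ge> 3"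
    using ex_place[OF c0 smooth c1 lin_top_form[OF D(1) top det]] by blast
  interpret P: affine_curve_place f "Suc d" a b a' b' \<eta> \<zeta> C
    by (unfold_locales; fact f place D(1) top det)
  have A: "A = P.reg.VR" using P.regular_at_place_eq_VR unfolding assms(8) p(1) .
  have "maximal_subalgebra ty_consts B k_ty \<and> extending B k_ty \<and> (\<forall>g\<in>B. \<not> coordinate g)"
    if h: "\<forall>i<k. a i \<in> A" "adjoin (regular_ring C) (regular_consts C) (a ` {..<k}) = A"
      "\<forall>i<k. restrict (eval2 (r i)) C = a i" "tangent_order_ge 2 \<Gamma> L p"
      "B = adjoin k_ty ty_consts (r ` {..<k}) <+>\<^bsub>k_ty\<^esub> PIdl\<^bsub>k_ty\<^esub> f"
    for k a r B
  proof -
    \<comment> \<open>\<open>B\<close> is the full subring of polynomials without pole at the place,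
      whichever generators and lifts are chosen.\<close>
    have B: "B = P.kty.VR"
      unfolding h(5) using h(2,3) by (intro P.preimage_adjoin[of a]) (simp_all add: A P.\<rho>_def)
    have "\<eta> = fls_X \<and> fls_subdegree \<zeta> \<ge> 3"
      using tangent_coeffs[OF D(1) f(2) det c0] h(4) unfolding \<Gamma> L p(1) by (intro tangent) blast
    then show ?thesis
      unfolding B using P.maximal_subalgebra_VR(2) P.kty.extending_VR P.no_coordinate_VR by blast
  qed
  then show ?thesis
    unfolding A using P.maximal_subalgebra_VR(1) P.reg.extending_VR P.finitely_generated_VR by blast
qed

end
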